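(* Let $A$ be a unital $C^*$-algebra. If $A$ is $W^*$-$C^*$-projective (respectively $W^*$-$W^*$-projective) in the non-unital category, then for each $n\in\mathbb{N}$, $M_n(A)$ is $W^*$-$C^*$-projective (respectively $W^*$-$W^*$-projective) in the non-unital category.
   Context: A $C^*$-algebra $\mathcal{A}$ is $W^*$-$C^*$-projective (resp. $W^*$-$W^*$-projective) in the non-unital category if for every von Neumann algebra $\mathcal{B}$, every $C^*$-algebra (resp. von Neumann algebra) $\mathcal{M}$, every surjective $\ast$-homomorphism $\pi:\mathcal{B}\to\mathcal{M}$ and every $\ast$-homomorphism $\phi:\mathcal{A}\to\mathcal{M}$ (none required to be unital), there is a $\ast$-homomorphism $\psi:\mathcal{A}\to\mathcal{B}$ with $\pi\circ\psi=\phi$. *)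

theory Defs
  imports Complex_Main
begin

record 'a calg =
  cset   :: "'a set"
  czero  :: 'a
  cadd   :: "'a \<Rightarrow> 'a \<Rightarrow> 'a"
  csmult :: "complex \<Rightarrow> 'a \<Rightarrow> 'a"
  cmult  :: "'a \<Rightarrow> 'a \<Rightarrow> 'a"
  cstar  :: "'a \<Rightarrow> 'a"
  cnorm  :: "'a \<Rightarrow> real"

definition csub :: "('a, 'x) calg_scheme \<Rightarrow> 'a \<Rightarrow> 'a \<Rightarrow> 'a" where
  "csub A x y = cadd A x (csmult A (-1) y)"

definition cstar_algebra :: "('a, 'x) calg_scheme \<Rightarrow> bool" where
  "cstar_algebra A \<longleftrightarrow>
     czero A \<in> cset A \<and>
     (\<forall>x\<in>cset A. \<forall>y\<in>cset A. cadd A x y \<in> cset A) \<and>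
     (\<forall>c. \<forall>x\<in>cset A. csmult A c x \<in> cset A) \<and>
     (\<forall>x\<in>cset A. \<forall>y\<in>cset A. cmult A x y \<in> cset A) \<and>
     (\<forall>x\<in>cset A. cstar A x \<in> cset A) \<and>
     \<comment> \<open>complex vector space\<close>
     (\<forall>x\<in>cset A. \<forall>y\<in>cset A. \<forall>z\<in>cset A. cadd A (cadd A x y) z = cadd A x (cadd A y z)) \<and>
     (\<forall>x\<in>cset A. \<forall>y\<in>cset A. cadd A x y = cadd A y x) \<and>
     (\<forall>x\<in>cset A. cadd A (czero A) x = x) \<and>
     (\<forall>x\<in>cset A. csmult A 1 x = x) \<and>
     (\<forall>x\<in>cset A. csmult A 0 x = czero A) \<and>
     (\<forall>a b. \<forall>x\<in>cset A. csmult A a (csmult A b x) = csmult A (a * b) x) \<and>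
     (\<forall>a b. \<forall>x\<in>cset A. csmult A (a + b) x = cadd A (csmult A a x) (csmult A b x)) \<and>
     (\<forall>a. \<forall>x\<in>cset A. \<forall>y\<in>cset A. csmult A a (cadd A x y) = cadd A (csmult A a x) (csmult A a y)) \<and>
     \<comment> \<open>associative algebra\<close>
     (\<forall>x\<in>cset A. \<forall>y\<in>cset A. \<forall>z\<in>cset A. cmult A (cmult A x y) z = cmult A x (cmult A y z)) \<and>
     (\<forall>x\<in>cset A. \<forall>y\<in>cset A. \<forall>z\<in>cset A. cmult A (cadd A x y) z = cadd A (cmult A x z) (cmult A y z)) \<and>
     (\<forall>x\<in>cset A. \<forall>y\<in>cset A. \<forall>z\<in>cset A. cmult A x (cadd A y z) = cadd A (cmult A x y) (cmult A x z)) \<and>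
     (\<forall>a. \<forall>x\<in>cset A. \<forall>y\<in>cset A. cmult A (csmult A a x) y = csmult A a (cmult A x y)) \<and>
     (\<forall>a. \<forall>x\<in>cset A. \<forall>y\<in>cset A. cmult A x (csmult A a y) = csmult A a (cmult A x y)) \<and>
     \<comment> \<open>involution\<close>
     (\<forall>x\<in>cset A. cstar A (cstar A x) = x) \<and>
     (\<forall>x\<in>cset A. \<forall>y\<in>cset A. cstar A (cadd A x y) = cadd A (cstar A x) (cstar A y)) \<and>
     (\<forall>a. \<forall>x\<in>cset A. cstar A (csmult A a x) = csmult A (cnj a) (cstar A x)) \<and>
     (\<forall>x\<in>cset A. \<forall>y\<in>cset A. cstar A (cmult A x y) = cmult A (cstar A y) (cstar A x)) \<and>
     \<comment> \<open>norm, submultiplicativity, C*-identity\<close>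
     (\<forall>x\<in>cset A. cnorm A x = 0 \<longleftrightarrow> x = czero A) \<and>
     (\<forall>x\<in>cset A. \<forall>y\<in>cset A. cnorm A (cadd A x y) \<le> cnorm A x + cnorm A y) \<and>
     (\<forall>a. \<forall>x\<in>cset A. cnorm A (csmult A a x) = cmod a * cnorm A x) \<and>
     (\<forall>x\<in>cset A. \<forall>y\<in>cset A. cnorm A (cmult A x y) \<le> cnorm A x * cnorm A y) \<and>
     (\<forall>x\<in>cset A. cnorm A (cmult A (cstar A x) x) = (cnorm A x)\<^sup>2) \<and>
     \<comment> \<open>completeness\<close>
     (\<forall>f :: nat \<Rightarrow> 'a. (\<forall>k. f k \<in> cset A) \<longrightarrow>
        (\<forall>e>0. \<exists>N. \<forall>m\<ge>N. \<forall>k\<ge>N. cnorm A (csub A (f m) (f k)) < e) \<longrightarrow>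
        (\<exists>x\<in>cset A. (\<lambda>k. cnorm A (csub A (f k) x)) \<longlonglongrightarrow> 0))"

definition unital :: "('a, 'x) calg_scheme \<Rightarrow> bool" where
  "unital A \<longleftrightarrow> (\<exists>u\<in>cset A. \<forall>x\<in>cset A. cmult A u x = x \<and> cmult A x u = x)"

definition star_hom :: "('a, 'x) calg_scheme \<Rightarrow> ('b, 'y) calg_scheme \<Rightarrow> ('a \<Rightarrow> 'b) \<Rightarrow> bool" where
  "star_hom A B f \<longleftrightarrow>
     (\<forall>x\<in>cset A. f x \<in> cset B) \<and>
     (\<forall>x\<in>cset A. \<forall>y\<in>cset A. f (cadd A x y) = cadd B (f x) (f y)) \<and>
     (\<forall>c. \<forall>x\<in>cset A. f (csmult A c x) = csmult B c (f x)) \<and>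
     (\<forall>x\<in>cset A. \<forall>y\<in>cset A. f (cmult A x y) = cmult B (f x) (f y)) \<and>
     (\<forall>x\<in>cset A. f (cstar A x) = cstar B (f x))"

definition dual_space :: "('a, 'x) calg_scheme \<Rightarrow> ('a \<Rightarrow> complex) set" where
  "dual_space A = {f.
     (\<forall>x\<in>cset A. \<forall>y\<in>cset A. f (cadd A x y) = f x + f y) \<and>
     (\<forall>c. \<forall>x\<in>cset A. f (csmult A c x) = c * f x) \<and>
     (\<exists>K. \<forall>x\<in>cset A. cmod (f x) \<le> K * cnorm A x) \<and>
     (\<forall>x. x \<notin> cset A \<longrightarrow> f x = 0)}"

definition dual_norm :: "('a, 'x) calg_scheme \<Rightarrow> ('a \<Rightarrow> complex) \<Rightarrow> real" where
  "dual_norm A f = (SUP x\<in>{x\<in>cset A. cnorm A x \<le> 1}. cmod (f x))"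

text \<open>A W*-algebra (von Neumann algebra, abstractly): a C*-algebra that is a dual Banach
  space, i.e. there is a norm-closed subspace F of its dual such that the canonical map
  A \<rightarrow> F* is an isometric bijection onto the bounded linear functionals on F.\<close>
definition wstar_algebra :: "('a, 'x) calg_scheme \<Rightarrow> bool" where
  "wstar_algebra A \<longleftrightarrow> cstar_algebra A \<and>
     (\<exists>F. F \<subseteq> dual_space A \<and> (\<lambda>_. 0) \<in> F \<and>
        (\<forall>f\<in>F. \<forall>g\<in>F. (\<lambda>x. f x + g x) \<in> F) \<and>
        (\<forall>c. \<forall>f\<in>F. (\<lambda>x. c * f x) \<in> F) \<and>
        (\<forall>s :: nat \<Rightarrow> 'a \<Rightarrow> complex. \<forall>f\<in>dual_space A. (\<forall>k. s k \<in> F) \<longrightarrow>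
            (\<lambda>k. dual_norm A (\<lambda>x. s k x - f x)) \<longlonglongrightarrow> 0 \<longrightarrow> f \<in> F) \<and>
        (\<forall>x\<in>cset A. cnorm A x = (SUP f\<in>{f\<in>F. dual_norm A f \<le> 1}. cmod (f x))) \<and>
        (\<forall>g :: ('a \<Rightarrow> complex) \<Rightarrow> complex.
            (\<forall>f\<in>F. \<forall>h\<in>F. g (\<lambda>x. f x + h x) = g f + g h) \<longrightarrow>
            (\<forall>c. \<forall>f\<in>F. g (\<lambda>x. c * f x) = c * g f) \<longrightarrow>
            (\<exists>K. \<forall>f\<in>F. cmod (g f) \<le> K * dual_norm A f) \<longrightarrow>
            (\<exists>!x\<in>cset A. \<forall>f\<in>F. g f = f x)))"

text \<open>Projectivity notions in the non-unital category. Since HOL cannot quantify over all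
  types, the algebras B and M range over all structures on fixed (arbitrary) types 'b, 'm.\<close>
definition wc_projective :: "('a, 'x) calg_scheme \<Rightarrow> 'b itself \<Rightarrow> 'm itself \<Rightarrow> bool" where
  "wc_projective A _ _ \<longleftrightarrow>
     (\<forall>(B :: 'b calg) (M :: 'm calg) \<pi> \<phi>.
        wstar_algebra B \<longrightarrow> cstar_algebra M \<longrightarrow> star_hom B M \<pi> \<longrightarrow> \<pi> ` cset B = cset M \<longrightarrow>
        star_hom A M \<phi> \<longrightarrow>
        (\<exists>\<psi>. star_hom A B \<psi> \<and> (\<forall>x\<in>cset A. \<pi> (\<psi> x) = \<phi> x)))"

definition ww_projective :: "('a, 'x) calg_scheme \<Rightarrow> 'b itself \<Rightarrow> 'm itself \<Rightarrow> bool" where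
  "ww_projective A _ _ \<longleftrightarrow>
     (\<forall>(B :: 'b calg) (M :: 'm calg) \<pi> \<phi>.
        wstar_algebra B \<longrightarrow> wstar_algebra M \<longrightarrow> star_hom B M \<pi> \<longrightarrow> \<pi> ` cset B = cset M \<longrightarrow>
        star_hom A M \<phi> \<longrightarrow>
        (\<exists>\<psi>. star_hom A B \<psi> \<and> (\<forall>x\<in>cset A. \<pi> (\<psi> x) = \<phi> x)))"

fun csum :: "('a, 'x) calg_scheme \<Rightarrow> (nat \<Rightarrow> 'a) \<Rightarrow> nat \<Rightarrow> 'a" where
  "csum A f 0 = czero A"
| "csum A f (Suc k) = cadd A (csum A f k) (f k)"

definition mat_pre :: "nat \<Rightarrow> ('a, 'x) calg_scheme \<Rightarrow> (nat \<Rightarrow> nat \<Rightarrow> 'a) calg" where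
  "mat_pre n A = \<lparr>
     cset = {X. (\<forall>i j. i < n \<and> j < n \<longrightarrow> X i j \<in> cset A) \<and>
                (\<forall>i j. \<not> (i < n \<and> j < n) \<longrightarrow> X i j = czero A)},
     czero = (\<lambda>i j. czero A),
     cadd = (\<lambda>X Y i j. if i < n \<and> j < n then cadd A (X i j) (Y i j) else czero A),
     csmult = (\<lambda>c X i j. if i < n \<and> j < n then csmult A c (X i j) else czero A),
     cmult = (\<lambda>X Y i j. if i < n \<and> j < n then csum A (\<lambda>k. cmult A (X i k) (Y k j)) n else czero A),
     cstar = (\<lambda>X i j. if i < n \<and> j < n then cstar A (X j i) else czero A),
     cnorm = (\<lambda>X. 0) \<rparr>"

text \<open>M_n(A) carries its unique C*-norm (normalised to 0 outside the carrier).\<close>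
definition Mn :: "nat \<Rightarrow> ('a, 'x) calg_scheme \<Rightarrow> (nat \<Rightarrow> nat \<Rightarrow> 'a) calg" where
  "Mn n A = (mat_pre n A) \<lparr> cnorm := (THE N. cstar_algebra ((mat_pre n A)\<lparr>cnorm := N\<rparr>) \<and>
                                        (\<forall>X. X \<notin> cset (mat_pre n A) \<longrightarrow> N X = 0)) \<rparr>"

end

theory Submission
  imports Defs "HOL-Analysis.Function_Topology" "HOL-Analysis.Topology_Euclidean_Space"
begin

text \<open>The norm of \<open>M\<^sub>n(A)\<close> plays no role, since *-homomorphisms are defined algebraically. Given
  \<open>\<phi> : M\<^sub>n(A) \<rightarrow> M\<close>, lifting \<open>a \<mapsto> \<phi>(a \<otimes> e\<^sub>1\<^sub>1)\<close> to \<open>B\<close> by projectivity provides a projection over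
  \<open>\<phi>(1 \<otimes> e\<^sub>1\<^sub>1)\<close>. Cutting it down by spectral projections of \<open>B\<close> yields a smaller projection \<open>P\<close> and
  partial isometries \<open>v\<^sub>i\<close> over \<open>\<phi>(1 \<otimes> e\<^sub>i\<^sub>1)\<close> with \<open>v\<^sub>i\<^sup>* v\<^sub>j = \<delta>\<^sub>i\<^sub>j P\<close>. The corner \<open>P B P\<close> is again a
  W*-algebra, so projectivity applies a second time, now to the map into the corner of \<open>M\<close>, and gives
  \<open>\<psi>\<^sub>1 : A \<rightarrow> P B P\<close>. The lift of \<open>\<phi>\<close> is \<open>X \<mapsto> \<Sum> v\<^sub>i \<psi>\<^sub>1(X\<^sub>i\<^sub>j) v\<^sub>j\<^sup>*\<close>.\<close>

subsection \<open>C*-algebras inside a type class\<close>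

text \<open>The first lift cannot be reused for the matrix formula: it takes values in
  \<open>p B p\<close>, and compressing it to the smaller \<open>P\<close> is in general not
  multiplicative. Hence the second use of projectivity, and with it the burden of showing that
  corners of \<open>B\<close> (in the W*-W* case also of \<open>M\<close>) are W*-algebras. The
  second lift need not send 1 to \<open>P\<close>; it is enough that \<open>P\<close> acts as
  identity on its values. W*-algebras are given abstractly by a predual, with no spectrum or
  functional calculus at hand. Square roots and inverses come from norm-convergent iterations,
  positivity from a norm inequality, and the weak* topology enters through one consequence of
  Banach-Alaoglu: a bounded sequence has a point lying in every closed ball that eventually contains
  it. Order bounds are ball conditions, so this yields suprema of increasing sequences and from them
  spectral projections. Positivity of \<open>adj x * x\<close> for general \<open>x\<close> is
  avoided; everything is arranged around self-adjoint elements.\<close>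

class star_algebra = ring +
  fixes cscale :: "complex \<Rightarrow> 'a \<Rightarrow> 'a" (infixr \<open>*\<^sub>C\<close> 75)
    and adj :: "'a \<Rightarrow> 'a"
  assumes cscale_add_right: "c *\<^sub>C (x + y) = c *\<^sub>C x + c *\<^sub>C y"
    and cscale_add_left: "(c + d) *\<^sub>C x = c *\<^sub>C x + d *\<^sub>C x"
    and cscale_cscale: "c *\<^sub>C d *\<^sub>C x = (c * d) *\<^sub>C x"
    and cscale_one: "1 *\<^sub>C x = x"
    and mult_cscale_left [simp]: "(c *\<^sub>C x) * y = c *\<^sub>C (x * y)"
    and mult_cscale_right [simp]: "x * (c *\<^sub>C y) = c *\<^sub>C (x * y)"
    and adj_adj [simp]: "adj (adj x) = x"
    and adj_add [simp]: "adj (x + y) = adj x + adj y"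
    and adj_cscale [simp]: "adj (c *\<^sub>C x) = cnj c *\<^sub>C adj x"
    and adj_mult [simp]: "adj (x * y) = adj y * adj x"

global_interpretation cscale: vector_space "cscale :: complex \<Rightarrow> 'a::star_algebra \<Rightarrow> 'a"
  by unfold_locales (simp_all add: cscale_add_right cscale_add_left cscale_cscale cscale_one)

lemmas cscale_simps = cscale_cscale cscale_one cscale.scale_right_distrib cscale.scale_left_distrib
  cscale.scale_right_diff_distrib cscale.scale_left_diff_distrib

lemma adj_zero [simp]: "adj (0::'a::star_algebra) = 0"
  by (metis add_cancel_left_left adj_add)

lemma adj_minus [simp]: "adj (- x) = - adj (x::'a::star_algebra)"
  by (metis adj_add adj_zero add_eq_0_iff add.right_inverse)

lemma adj_diff [simp]: "adj (x - y) = adj x - adj (y::'a::star_algebra)"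
  by (metis adj_add adj_minus diff_conv_add_uminus)

lemma adj_sum: "adj (\<Sum>i\<in>I. f i) = (\<Sum>i\<in>I. adj (f i :: 'a::star_algebra))"
  by (induction I rule: infinite_finite_induct) auto

text \<open>An algebra is a carrier inside a type because one type has to host many algebras at
  once: \<open>B\<close>, its corners with their different units, and every record in the ambient
  product built later.\<close>

locale cstar_set =
  fixes S :: "'a::star_algebra set" and N :: "'a \<Rightarrow> real"
  assumes zero_mem [simp]: "0 \<in> S"
    and add_mem [simp]: "x \<in> S \<Longrightarrow> y \<in> S \<Longrightarrow> x + y \<in> S"
    and cscale_mem [simp]: "x \<in> S \<Longrightarrow> c *\<^sub>C x \<in> S"
    and mult_mem [simp]: "x \<in> S \<Longrightarrow> y \<in> S \<Longrightarrow> x * y \<in> S"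
    and adj_mem [simp]: "x \<in> S \<Longrightarrow> adj x \<in> S"
    and N_eq_0_iff: "x \<in> S \<Longrightarrow> N x = 0 \<longleftrightarrow> x = 0"
    and N_triangle: "x \<in> S \<Longrightarrow> y \<in> S \<Longrightarrow> N (x + y) \<le> N x + N y"
    and N_cscale: "x \<in> S \<Longrightarrow> N (c *\<^sub>C x) = cmod c * N x"
    and N_mult: "x \<in> S \<Longrightarrow> y \<in> S \<Longrightarrow> N (x * y) \<le> N x * N y"
    and N_adj_mult: "x \<in> S \<Longrightarrow> N (adj x * x) = (N x)\<^sup>2"
    and complete: "\<And>f :: nat \<Rightarrow> 'a. (\<And>k. f k \<in> S) \<Longrightarrow>
      (\<And>e. e > 0 \<Longrightarrow> \<exists>M. \<forall>m\<ge>M. \<forall>k\<ge>M. N (f m - f k) < e) \<Longrightarrow>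
      \<exists>x\<in>S. (\<lambda>k. N (f k - x)) \<longlonglongrightarrow> 0"
begin

lemma uminus_mem [simp]: "x \<in> S \<Longrightarrow> - x \<in> S"
  using cscale_mem[of x "-1"] by simp

lemma diff_mem [simp]: "x \<in> S \<Longrightarrow> y \<in> S \<Longrightarrow> x - y \<in> S"
  using add_mem[of x "- y"] by simp

lemma sum_mem [simp]: "(\<And>i. i \<in> I \<Longrightarrow> f i \<in> S) \<Longrightarrow> sum f I \<in> S"
  by (induction I rule: infinite_finite_induct) auto

lemma N_zero [simp]: "N 0 = 0"
  using N_eq_0_iff by simp

lemma N_minus [simp]: "x \<in> S \<Longrightarrow> N (- x) = N x"
  using N_cscale[of x "-1"] by simp

lemma N_nonneg [simp]: "x \<in> S \<Longrightarrow> 0 \<le> N x"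
  using N_triangle[of x "- x"] by simp

lemma N_diff_triangle: "x \<in> S \<Longrightarrow> y \<in> S \<Longrightarrow> N (x - y) \<le> N x + N y"
  using N_triangle[of x "- y"] by simp

lemma N_diff_commute: "x \<in> S \<Longrightarrow> y \<in> S \<Longrightarrow> N (x - y) = N (y - x)"
  using N_minus[of "x - y"] by simp

lemma N_le_adj: "x \<in> S \<Longrightarrow> N x \<le> N (adj x)"
proof -
  assume x: "x \<in> S"
  have "(N x)\<^sup>2 \<le> N (adj x) * N x"
    using N_mult[of "adj x" x] N_adj_mult[of x] x by simp
  then show ?thesis
    using N_nonneg[OF x] N_nonneg[of "adj x"] x
    by (cases "N x = 0") (auto simp: power2_eq_square)
qed

lemma N_adj [simp]: "x \<in> S \<Longrightarrow> N (adj x) = N x"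
  using N_le_adj[of x] N_le_adj[of "adj x"] by simp

lemma N_mult_adj: "x \<in> S \<Longrightarrow> N (x * adj x) = (N x)\<^sup>2"
  using N_adj_mult[of "adj x"] by simp

lemma N_self_adjoint_square: "x \<in> S \<Longrightarrow> adj x = x \<Longrightarrow> N (x * x) = (N x)\<^sup>2"
  using N_adj_mult[of x] by simp

lemma convergent_if_summable_increments:
  fixes f :: "nat \<Rightarrow> 'a"
  assumes f: "\<And>k. f k \<in> S" and d: "summable d" and inc: "\<And>k. N (f (Suc k) - f k) \<le> d k"
  shows "\<exists>x\<in>S. (\<lambda>k. N (f k - x)) \<longlonglongrightarrow> 0"
proof (rule complete)
  have le: "N (f (m + k) - f m) \<le> sum d {m..<m + k}" for m k
  proof (induction k)
    case (Suc k)
    have "N (f (m + Suc k) - f m) \<le> N (f (Suc (m + k)) - f (m + k)) + N (f (m + k) - f m)"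
      using N_triangle[of "f (Suc (m + k)) - f (m + k)" "f (m + k) - f m"] f by simp
    with Suc inc[of "m + k"] show ?case by simp
  qed simp
  fix \<epsilon> :: real assume "\<epsilon> > 0"
  then obtain M where M: "\<And>m n. m \<ge> M \<Longrightarrow> norm (sum d {m..<n}) < \<epsilon>"
    using d unfolding summable_Cauchy by blast
  have "N (f m - f k) < \<epsilon>" if "m \<ge> M" "k \<ge> M" for m k
    using that
  proof (induction m k rule: linorder_wlog)
    case (le a b)
    then show ?case
      using le(1) M[of a b] \<open>N (f (a + (b - a)) - f a) \<le> sum d {a..<a + (b - a)}\<close>
        N_diff_commute[of "f a" "f b"] f by auto
  next
    case (sym a b)
    then show ?case using N_diff_commute f by metis
  qed
  then show "\<exists>M. \<forall>m\<ge>M. \<forall>k\<ge>M. N (f m - f k) < \<epsilon>" by blast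
qed (use f in auto)

lemma eq_zero_if_N_small:
  assumes "x \<in> S" and "\<And>k. N x \<le> b k" and "b \<longlonglongrightarrow> 0"
  shows "x = 0"
proof -
  have "N x \<le> 0" by (rule LIMSEQ_le_const[OF assms(3)]) (use assms(2) in auto)
  then show ?thesis using N_nonneg[OF assms(1)] N_eq_0_iff[OF assms(1)] by simp
qed

lemma limit_unique:
  assumes "\<And>k. f k \<in> S" "x \<in> S" "y \<in> S" "(\<lambda>k. N (f k - x)) \<longlonglongrightarrow> 0" "(\<lambda>k. N (f k - y)) \<longlonglongrightarrow> 0"
  shows "x = y"
proof -
  have "N (x - y) \<le> N (f k - x) + N (f k - y)" for k
    using N_diff_triangle[of "f k - y" "f k - x"] assms by (simp add: add.commute)
  then have "x - y = 0"
    using assms by (intro eq_zero_if_N_small[of _ "\<lambda>k. N (f k - x) + N (f k - y)"])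
      (auto intro: tendsto_eq_intros)
  then show ?thesis by simp
qed

lemma limit_add:
  assumes "\<And>k. f k \<in> S" "\<And>k. g k \<in> S" "x \<in> S" "y \<in> S"
    "(\<lambda>k. N (f k - x)) \<longlonglongrightarrow> 0" "(\<lambda>k. N (g k - y)) \<longlonglongrightarrow> 0"
  shows "(\<lambda>k. N (f k + g k - (x + y))) \<longlonglongrightarrow> 0"
proof (rule tendsto_sandwich[OF _ _ tendsto_const, where h = "\<lambda>k. N (f k - x) + N (g k - y)"])
  have "N (f k + g k - (x + y)) \<le> N (f k - x) + N (g k - y)" for k
    using N_triangle[of "f k - x" "g k - y"] assms by (simp add: algebra_simps)
  then show "\<forall>\<^sub>F k in sequentially. N (f k + g k - (x + y)) \<le> N (f k - x) + N (g k - y)" by simp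
  show "(\<lambda>k. N (f k - x) + N (g k - y)) \<longlonglongrightarrow> 0"
    using tendsto_add[OF assms(5,6)] by simp
qed (use assms in auto)

lemma limit_mult_left:
  assumes "\<And>k. f k \<in> S" "x \<in> S" "z \<in> S" "(\<lambda>k. N (f k - x)) \<longlonglongrightarrow> 0"
  shows "(\<lambda>k. N (z * f k - z * x)) \<longlonglongrightarrow> 0"
proof (rule tendsto_sandwich[OF _ _ tendsto_const, where h = "\<lambda>k. N z * N (f k - x)"])
  have "N (z * f k - z * x) \<le> N z * N (f k - x)" for k
    using N_mult[of z "f k - x"] assms by (simp add: algebra_simps)
  then show "\<forall>\<^sub>F k in sequentially. N (z * f k - z * x) \<le> N z * N (f k - x)" by simp
  show "(\<lambda>k. N z * N (f k - x)) \<longlonglongrightarrow> 0"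
    using tendsto_mult_left[OF assms(4), of "N z"] by simp
qed (use assms in auto)

lemma limit_adj:
  assumes "\<And>k. f k \<in> S" "x \<in> S" "(\<lambda>k. N (f k - x)) \<longlonglongrightarrow> 0"
  shows "(\<lambda>k. N (adj (f k) - adj x)) \<longlonglongrightarrow> 0"
proof -
  have "N (adj (f k) - adj x) = N (f k - x)" for k
    using N_adj[of "f k - x"] assms by simp
  then show ?thesis using assms(3) by simp
qed

lemma limit_mult_right:
  assumes "\<And>k. f k \<in> S" "x \<in> S" "z \<in> S" "(\<lambda>k. N (f k - x)) \<longlonglongrightarrow> 0"
  shows "(\<lambda>k. N (f k * z - x * z)) \<longlonglongrightarrow> 0"
  using limit_adj[OF _ _ limit_mult_left[OF _ _ _ limit_adj[OF assms(1,2,4)], of "adj z"]] assms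
  by simp

lemma limit_N_le:
  assumes "\<And>k. f k \<in> S" "x \<in> S" "(\<lambda>k. N (f k - x)) \<longlonglongrightarrow> 0" "\<And>k. N (f k) \<le> C"
  shows "N x \<le> C"
proof -
  have "N x \<le> N (f k - x) + C" for k
    using N_diff_triangle[of "f k" "f k - x"] assms(1,2) assms(4)[of k] by simp
  then have "N x \<le> 0 + C"
    by (intro LIMSEQ_le_const[OF tendsto_add[OF assms(3) tendsto_const]]) auto
  then show ?thesis by simp
qed

end

subsection \<open>Square roots and inverses by iteration\<close>

text \<open>Solving \<open>(1 - y)^2 = 1 - x\<close> for \<open>y\<close> gives the fixed point
  equation \<open>y = (x + y^2) / 2\<close>; this is its iteration at \<open>x = 1\<close>, the
  worst case. The limit 1 is approached slower than geometrically, so the increments are summed by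
  telescoping a bounded monotone sequence.\<close>

definition scalar_sqrt_iter :: "nat \<Rightarrow> real" where
  "scalar_sqrt_iter k = ((\<lambda>y. (1 + y\<^sup>2) / 2) ^^ k) 0"

lemma scalar_sqrt_iter_simps [simp]:
  "scalar_sqrt_iter 0 = 0" "scalar_sqrt_iter (Suc k) = (1 + (scalar_sqrt_iter k)\<^sup>2) / 2"
  by (simp_all add: scalar_sqrt_iter_def)

lemma scalar_sqrt_iter_nonneg: "0 \<le> scalar_sqrt_iter k"
  by (cases k) auto

lemma scalar_sqrt_iter_le_1: "scalar_sqrt_iter k \<le> 1"
proof (induction k)
  case (Suc k)
  then show ?case using power_mono[OF Suc scalar_sqrt_iter_nonneg, of 2] by simp
qed simp

lemma scalar_sqrt_iter_increments_summable:
  "summable (\<lambda>k. scalar_sqrt_iter (Suc k) - scalar_sqrt_iter k)"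
proof -
  have "incseq scalar_sqrt_iter"
  proof (rule incseq_SucI)
    fix k
    have "0 \<le> (1 - scalar_sqrt_iter k)\<^sup>2" by simp
    then show "scalar_sqrt_iter k \<le> scalar_sqrt_iter (Suc k)"
      by (simp add: power2_eq_square algebra_simps)
  qed
  then have "convergent scalar_sqrt_iter"
    using scalar_sqrt_iter_le_1 by (metis incseq_convergent convergentI)
  then show ?thesis
    by (auto simp: convergent_def simp del: scalar_sqrt_iter_simps intro: telescope_summable)
qed

context cstar_set
begin

fun sqrt_iter :: "'a \<Rightarrow> nat \<Rightarrow> 'a" where
  "sqrt_iter x 0 = 0"
| "sqrt_iter x (Suc k) = (1/2) *\<^sub>C (x + sqrt_iter x k * sqrt_iter x k)"

text \<open>Formally \<open>y = 1 - (1 - x)\<^sup>1\<^sup>/\<^sup>2\<close>; phrased without a unit. The iteration converges even on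
  the boundary \<open>N x = 1\<close> because it is dominated by the scalar iteration for \<open>x = 1\<close>.\<close>

lemma exists_sqrt_complement:
  assumes x: "x \<in> S" "adj x = x" and \<beta>: "0 \<le> \<beta>" "\<beta> \<le> 1" and Nx: "N x \<le> 2 * \<beta> - \<beta>\<^sup>2"
  obtains y where "y \<in> S" "adj y = y" "N y \<le> \<beta>" "y + y = x + y * y"
    "\<And>z. z \<in> S \<Longrightarrow> z * x = x * z \<Longrightarrow> z * y = y * z"
proof -
  let ?Y = "sqrt_iter x"
  have mem [simp]: "?Y k \<in> S" for k by (induction k) (auto simp: x)
  have sa [simp]: "adj (?Y k) = ?Y k" for k by (induction k) (auto simp: x)
  have comm: "z * ?Y k = ?Y k * z" if "z * x = x * z" for z k
  proof (induction k)
    case (Suc k)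
    have "z * (?Y k * ?Y k) = ?Y k * ?Y k * z"
      using Suc by (metis mult.assoc)
    then show ?case by (simp add: that algebra_simps)
  qed simp
  have comm2: "?Y j * ?Y k = ?Y k * ?Y j" for j k
    by (rule comm) (metis comm)
  \<comment> \<open>\<open>\<beta>\<close> is a fixed point of the norm recursion
    \<open>s = (2 \<beta> - \<beta>^2 + s^2) / 2\<close>, which is where the bound on
    \<open>N x\<close> comes from.\<close>
  have bound: "N (?Y k) \<le> \<beta>" for k
  proof (induction k)
    case (Suc k)
    have "N (?Y (Suc k)) \<le> (N x + N (?Y k) * N (?Y k)) / 2"
      using N_triangle[of x "?Y k * ?Y k"] N_mult[of "?Y k" "?Y k"] x by (simp add: N_cscale)
    also have "\<dots> \<le> (2 * \<beta> - \<beta>\<^sup>2 + \<beta> * \<beta>) / 2"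
      using Nx Suc by (intro divide_right_mono add_mono mult_mono) (auto simp: \<beta>)
    finally show ?case by (simp add: power2_eq_square)
  qed (simp add: \<beta>)
  have one: "2 * \<beta> - \<beta>\<^sup>2 \<le> 1"
    using zero_le_power2[of "1 - \<beta>"] by (simp add: power2_eq_square algebra_simps)
  have dom: "N (?Y k) \<le> scalar_sqrt_iter k" for k
  proof (induction k)
    case (Suc k)
    have "N (?Y (Suc k)) \<le> (N x + N (?Y k) * N (?Y k)) / 2"
      using N_triangle[of x "?Y k * ?Y k"] N_mult[of "?Y k" "?Y k"] x by (simp add: N_cscale)
    also have "\<dots> \<le> (1 + scalar_sqrt_iter k * scalar_sqrt_iter k) / 2"
      using Nx one Suc by (intro divide_right_mono add_mono mult_mono)
        (auto simp: scalar_sqrt_iter_nonneg)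
    finally show ?case by (simp add: power2_eq_square)
  qed simp
  have inc: "N (?Y (Suc k) - ?Y k) \<le> scalar_sqrt_iter (Suc k) - scalar_sqrt_iter k" for k
  proof (induction k)
    case 0
    then show ?case using Nx one x by (simp add: N_cscale)
  next
    case (Suc k)
    let ?d = "?Y (Suc k) - ?Y k" and ?s = "?Y (Suc k) + ?Y k"
    \<comment> \<open>Since the iterates commute, the difference of their squares factors. The
      increments thus obey the recursion of the scalar increments: half of difference times
      sum.\<close>
    have "?Y (Suc (Suc k)) - ?Y (Suc k) = (1/2) *\<^sub>C (?Y (Suc k) * ?Y (Suc k) - ?Y k * ?Y k)"
      unfolding sqrt_iter.simps(2)[of x "Suc k"] sqrt_iter.simps(2)[of x k]
      by (simp only: cscale_simps) (simp add: algebra_simps)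
    also have "?Y (Suc k) * ?Y (Suc k) - ?Y k * ?Y k = ?d * ?s"
      using comm2[of k "Suc k"] by (simp add: algebra_simps del: sqrt_iter.simps)
    finally have eq: "?Y (Suc (Suc k)) - ?Y (Suc k) = (1/2) *\<^sub>C (?d * ?s)" .
    have "N (?d * ?s) \<le> (scalar_sqrt_iter (Suc k) - scalar_sqrt_iter k) *
        (scalar_sqrt_iter (Suc k) + scalar_sqrt_iter k)"
    proof (rule order_trans[OF N_mult])
      show "N ?d * N ?s \<le> (scalar_sqrt_iter (Suc k) - scalar_sqrt_iter k) *
        (scalar_sqrt_iter (Suc k) + scalar_sqrt_iter k)"
        using Suc order_trans[OF N_triangle add_mono[OF dom[of "Suc k"] dom[of k]]]
          order_trans[OF N_nonneg Suc]
        by (intro mult_mono) (simp_all del: sqrt_iter.simps scalar_sqrt_iter_simps)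
    qed (simp_all del: sqrt_iter.simps)
    then have "N (?Y (Suc (Suc k)) - ?Y (Suc k)) \<le> (scalar_sqrt_iter (Suc k) - scalar_sqrt_iter k) *
        (scalar_sqrt_iter (Suc k) + scalar_sqrt_iter k) / 2"
      unfolding eq by (subst N_cscale) (simp_all del: sqrt_iter.simps scalar_sqrt_iter_simps)
    also have "\<dots> = scalar_sqrt_iter (Suc (Suc k)) - scalar_sqrt_iter (Suc k)"
      unfolding scalar_sqrt_iter_simps(2)[of "Suc k"] using scalar_sqrt_iter_simps(2)[of k]
      by (simp add: power2_eq_square field_simps del: scalar_sqrt_iter_simps)
    finally show ?case .
  qed
  obtain y where y: "y \<in> S" and lim: "(\<lambda>k. N (?Y k - y)) \<longlonglongrightarrow> 0"
    using convergent_if_summable_increments[OF _ scalar_sqrt_iter_increments_summable, of ?Y] inc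
    by auto
  have 1: "adj y = y"
    using limit_unique[of ?Y "adj y" y] limit_adj[of ?Y y] y lim by simp
  have 2: "N y \<le> \<beta>"
    using limit_N_le[of ?Y y \<beta>] y lim bound by simp
  have comm_y: "z * y = y * z" if "z \<in> S" "z * x = x * z" for z
    using limit_unique[of "\<lambda>k. z * ?Y k" "z * y" "y * z"] limit_mult_left[of ?Y y z]
      limit_mult_right[of ?Y y z] y lim that comm[OF that(2)] by simp
  have sq: "(\<lambda>k. N (?Y k * ?Y k - y * y)) \<longlonglongrightarrow> 0"
  proof (rule tendsto_sandwich[OF _ _ tendsto_const, where h = "\<lambda>k. 2 * N (?Y k - y)"])
    have "N (?Y k * ?Y k - y * y) \<le> 2 * N (?Y k - y)" for k
    proof -
      have "?Y k * ?Y k - y * y = (?Y k - y) * (?Y k + y)"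
        using comm_y[of "?Y k"] comm[of x k] by (simp add: algebra_simps)
      moreover have "N ((?Y k - y) * (?Y k + y)) \<le> N (?Y k - y) * N (?Y k + y)"
        by (rule N_mult) (simp_all add: y)
      moreover have "N (?Y k - y) * N (?Y k + y) \<le> N (?Y k - y) * 2"
        using N_triangle[of "?Y k" y] bound[of k] 2 \<beta> y by (intro mult_left_mono) auto
      ultimately show ?thesis by simp
    qed
    then show "\<forall>\<^sub>F k in sequentially. N (?Y k * ?Y k - y * y) \<le> 2 * N (?Y k - y)" by simp
    show "(\<lambda>k. 2 * N (?Y k - y)) \<longlonglongrightarrow> 0" using tendsto_mult_left[OF lim, of 2] by simp
  qed (use y in auto)
  have 3: "y + y = x + y * y"
  proof (rule limit_unique[of "\<lambda>k. ?Y (Suc k) + ?Y (Suc k)"])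
    have "(\<lambda>k. N (?Y (Suc k) - y)) \<longlonglongrightarrow> 0" using LIMSEQ_Suc[OF lim] .
    from limit_add[OF _ _ _ _ this this]
    show "(\<lambda>k. N (?Y (Suc k) + ?Y (Suc k) - (y + y))) \<longlonglongrightarrow> 0"
      using y by (simp del: sqrt_iter.simps)
    have "?Y (Suc k) + ?Y (Suc k) = x + ?Y k * ?Y k" for k
      using cscale.scale_left_distrib[of "1/2" "1/2" "x + ?Y k * ?Y k"] by simp
    then show "(\<lambda>k. N (?Y (Suc k) + ?Y (Suc k) - (x + y * y))) \<longlonglongrightarrow> 0"
      using sq by (simp del: sqrt_iter.simps)
  qed (simp_all add: x y)
  show ?thesis
    using that[OF y 1 2 3] comm_y by blast
qed

text \<open>The geometric series of \<open>y\<close> with \<open>e\<close> as its zeroth power; the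
  equation for \<open>g\<close> says \<open>g - y * g = e\<close>. Later \<open>e - y\<close> is a
  square root produced by the iteration above, so \<open>g\<close> supplies inverse square
  roots.\<close>

lemma neumann_series:
  assumes e: "e \<in> S" "e * y = y" "y * e = y" and y: "y \<in> S" "adj y = y" "adj e = e" and Ny: "N y < 1"
  obtains g where "g \<in> S" "adj g = g" "g = e + y * g"
    "\<And>z. z \<in> S \<Longrightarrow> z * e = e * z \<Longrightarrow> z * y = y * z \<Longrightarrow> z * g = g * z"
proof -
  define G where "G = rec_nat 0 (\<lambda>_ g. e + y * g)"
  have G [simp]: "G 0 = 0" "G (Suc k) = e + y * G k" for k by (simp_all add: G_def)
  have mem [simp]: "G k \<in> S" for k by (induction k) (auto simp: y e)
  have comm: "z * G k = G k * z" if "z * e = e * z" "z * y = y * z" for z k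
  proof (induction k)
    case (Suc k)
    have "z * (y * G k) = y * G k * z" using Suc that by (metis mult.assoc)
    then show ?case by (simp add: that algebra_simps)
  qed simp
  have sa [simp]: "adj (G k) = G k" for k
    by (induction k) (use comm[of y] e y in auto)
  have inc: "N (G (Suc k) - G k) \<le> N e * N y ^ k" for k
  proof (induction k)
    case (Suc k)
    have "N (G (Suc (Suc k)) - G (Suc k)) = N (y * (G (Suc k) - G k))"
      by (simp add: algebra_simps)
    also have "\<dots> \<le> N y * N (G (Suc k) - G k)"
      by (rule N_mult) (simp_all add: y e)
    also have "\<dots> \<le> N y * (N e * N y ^ k)"
      using Suc y by (intro mult_left_mono) auto
    finally show ?case by (simp add: mult_ac)
  qed simp
  have "summable (\<lambda>k. N e * N y ^ k)"
    using Ny y by (intro summable_mult summable_geometric) auto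
  from convergent_if_summable_increments[OF _ this inc]
  obtain g where g: "g \<in> S" and lim: "(\<lambda>k. N (G k - g)) \<longlonglongrightarrow> 0" by auto
  have 1: "adj g = g"
    using limit_unique[of G "adj g" g] limit_adj[of G g] g lim by simp
  have 2: "z * g = g * z" if "z \<in> S" "z * e = e * z" "z * y = y * z" for z
    using limit_unique[of "\<lambda>k. z * G k" "z * g" "g * z"] limit_mult_left[of G g z]
      limit_mult_right[of G g z] g lim that comm[OF that(2,3)] by simp
  have 3: "g = e + y * g"
    using limit_unique[of "\<lambda>k. G (Suc k)" g "e + y * g"] LIMSEQ_Suc[OF lim]
      limit_mult_left[of G g y] g lim y e by simp
  show ?thesis using that[OF g 1 3] 2 by blast
qed

text \<open>The trick is that \<open>b + i w\<close> is normal, so its square norm is \<open>N (b\<^sup>2 + w\<^sup>2)\<close>.\<close>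

lemma N_square_le_sum_squares:
  assumes "b \<in> S" "adj b = b" "w \<in> S" "adj w = w" "b * w = w * b"
  shows "(N b)\<^sup>2 \<le> N (b * b + w * w)"
proof -
  define u where "u = b + \<i> *\<^sub>C w"
  have u: "u \<in> S" "adj u = b - \<i> *\<^sub>C w" using assms by (simp_all add: u_def)
  have "adj u * u = b * b + w * w"
    unfolding u(2) by (simp add: u_def algebra_simps cscale_simps assms(5))
  then have Nu: "(N u)\<^sup>2 = N (b * b + w * w)" using N_adj_mult[OF u(1)] by simp
  have "b = (1/2) *\<^sub>C (u + adj u)"
    unfolding u(2) by (simp add: u_def cscale_simps flip: cscale.scale_left_distrib)
  then have "N b = N ((1/2) *\<^sub>C (u + adj u))" by simp
  also have "\<dots> = N (u + adj u) / 2" using u(1) by (subst N_cscale) (simp_all add: norm_divide)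
  also have "\<dots> \<le> N u" using N_triangle[of u "adj u"] u(1) by simp
  finally show ?thesis using Nu assms(1) power_mono[of "N b" "N u" 2] by simp
qed

end

subsection \<open>Positivity\<close>

locale cstar_unital = cstar_set S N for S :: "'a::star_algebra set" and N :: "'a \<Rightarrow> real" +
  fixes e :: 'a
  assumes e_mem [simp]: "e \<in> S"
    and e_left [simp]: "x \<in> S \<Longrightarrow> e * x = x"
    and e_right [simp]: "x \<in> S \<Longrightarrow> x * e = x"
begin

lemma adj_e [simp]: "adj e = e"
  using adj_mult[of "adj e" e] e_left[of "adj e"] e_right[of "adj e"] by simp

text \<open>Not an equality: the carrier may be \<open>{0}\<close>, as for the corner of the zero
  projection.\<close>

lemma N_e_le_1: "N e \<le> 1"
  using N_adj_mult[of e] N_nonneg[of e] by (cases "N e = 0") (auto simp: power2_eq_square)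

definition sc :: "real \<Rightarrow> 'a" where
  "sc t = complex_of_real t *\<^sub>C e"

lemma sc_mem [simp]: "sc t \<in> S"
  and adj_sc [simp]: "adj (sc t) = sc t"
  and sc_mult_left [simp]: "x \<in> S \<Longrightarrow> sc t * x = complex_of_real t *\<^sub>C x"
  and sc_mult_right [simp]: "x \<in> S \<Longrightarrow> x * sc t = complex_of_real t *\<^sub>C x"
  and sc_add: "sc (s + t) = sc s + sc t"
  and sc_diff: "sc (s - t) = sc s - sc t"
  and sc_0 [simp]: "sc 0 = 0"
  and sc_1: "sc 1 = e"
  and cscale_sc: "complex_of_real s *\<^sub>C sc t = sc (s * t)"
  by (simp_all add: sc_def cscale_simps)

lemma N_sc_le: "N (sc t) \<le> \<bar>t\<bar>"
  using N_e_le_1 mult_left_mono[of "N e" 1 "\<bar>t\<bar>"] by (simp add: sc_def N_cscale)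

text \<open>Positivity is read off the norm: \<open>y \<ge> 0\<close> iff the spectrum of \<open>y\<close> lies in a disc centred at
  some \<open>t \<ge> 0\<close> and of radius \<open>t\<close>. This is stable under limits of every kind that preserve norm
  bounds.\<close>

definition pos :: "'a \<Rightarrow> bool" where
  "pos y \<longleftrightarrow> y \<in> S \<and> adj y = y \<and> (\<exists>t\<ge>0. N (sc t - y) \<le> t)"

lemma posI: "y \<in> S \<Longrightarrow> adj y = y \<Longrightarrow> N (sc t - y) \<le> t \<Longrightarrow> pos y"
  unfolding pos_def by (metis N_nonneg diff_mem order_trans sc_mem)

lemma pos_mem [simp]: "pos y \<Longrightarrow> y \<in> S"
  and pos_adj [simp]: "pos y \<Longrightarrow> adj y = y"
  by (simp_all add: pos_def)

lemma pos_zero [simp]: "pos 0"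
  by (rule posI[where t = 0]) auto

lemma pos_add [intro]:
  assumes "pos x" "pos y"
  shows "pos (x + y)"
proof -
  obtain s t where "N (sc s - x) \<le> s" "N (sc t - y) \<le> t"
    using assms unfolding pos_def by blast
  then have "N (sc (s + t) - (x + y)) \<le> s + t"
    using N_triangle[of "sc s - x" "sc t - y"] assms by (simp add: sc_add algebra_simps)
  then show ?thesis using assms by (intro posI) auto
qed

lemma pos_cscale [intro]:
  assumes "pos x" "0 \<le> r"
  shows "pos (complex_of_real r *\<^sub>C x)"
proof -
  obtain t where t: "N (sc t - x) \<le> t"
    using assms unfolding pos_def by blast
  have "sc (r * t) - complex_of_real r *\<^sub>C x = complex_of_real r *\<^sub>C (sc t - x)"
    by (simp add: cscale_simps cscale_sc)
  then have "N (sc (r * t) - complex_of_real r *\<^sub>C x) = r * N (sc t - x)"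
    using assms by (simp only: N_cscale diff_mem sc_mem pos_mem) simp
  then show ?thesis using assms t by (intro posI[of _ "r * t"]) (auto intro: mult_left_mono)
qed

lemma pos_sc: "0 \<le> t \<Longrightarrow> pos (sc t)"
  by (rule posI[where t = t]) auto

lemma pos_e [simp]: "pos e"
  using pos_sc[of 1] by (simp add: sc_1)

lemma pos_sc_diff: "x \<in> S \<Longrightarrow> adj x = x \<Longrightarrow> N x \<le> t \<Longrightarrow> pos (sc t - x)"
  by (rule posI[where t = t]) auto

text \<open>If \<open>N (sc t - y) \<le> t\<close> with \<open>t > 0\<close>, then
  \<open>y / t = e - x\<close> with \<open>N x \<le> 1\<close>, and
  \<open>exists_sqrt_complement\<close> extracts a root of \<open>e - x\<close>. The boundary case
  \<open>\<beta> = 1\<close> is the right one, since a positive element need not be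
  invertible.\<close>

lemma pos_sqrt:
  assumes "pos y"
  obtains w where "pos w" "w * w = y" "\<And>z. z \<in> S \<Longrightarrow> z * y = y * z \<Longrightarrow> z * w = w * z"
proof -
  obtain t where t: "0 \<le> t" "N (sc t - y) \<le> t" using assms unfolding pos_def by blast
  show ?thesis
  proof (cases "t = 0")
    case True
    then have "N y \<le> 0" "y \<in> S" using t assms by auto
    then have "y = 0" using N_nonneg[of y] N_eq_0_iff[of y] by linarith
    then show ?thesis using that[of 0] by simp
  next
    case False
    then have t0: "t > 0" using t by simp
    define x where "x = e - complex_of_real (1/t) *\<^sub>C y"
    have y: "y \<in> S" "adj y = y" using assms by simp_all
    have x: "x \<in> S" "adj x = x" using y by (simp_all add: x_def)
    have "x = complex_of_real (1/t) *\<^sub>C (sc t - y)"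
      using t0 by (simp add: x_def sc_def cscale_simps flip: of_real_mult)
    then have "N x = (1/t) * N (sc t - y)"
      using t0 y by (simp only: N_cscale diff_mem sc_mem) (simp add: norm_divide)
    then have "N x \<le> 2 * 1 - 1\<^sup>2" using t t0 by (simp add: divide_le_eq)
    from exists_sqrt_complement[OF x zero_le_one order_refl this] obtain v
      where v: "v \<in> S" "adj v = v" "N v \<le> 1" "v + v = x + v * v"
        and vc: "\<And>z. z \<in> S \<Longrightarrow> z * x = x * z \<Longrightarrow> z * v = v * z" by blast
    define w where "w = complex_of_real (sqrt t) *\<^sub>C (e - v)"
    have "(e - v) * (e - v) = e - (v + v) + v * v"
      using v(1) by (simp add: algebra_simps)
    also have "\<dots> = complex_of_real (1/t) *\<^sub>C y"
      unfolding v(4) by (simp add: x_def)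
    finally have "w * w = complex_of_real (sqrt t * sqrt t * (1/t)) *\<^sub>C y"
      by (simp only: w_def mult_cscale_left mult_cscale_right cscale_cscale of_real_mult mult.assoc)
    then have ww: "w * w = y"
      using t0 by simp
    have "sc (sqrt t) - w = complex_of_real (sqrt t) *\<^sub>C v"
      by (simp add: w_def sc_def cscale_simps)
    then have "N (sc (sqrt t) - w) \<le> sqrt t"
      using v t0 by (simp add: N_cscale mult_left_le)
    then have "pos w" using v by (intro posI[of _ "sqrt t"]) (auto simp: w_def)
    moreover have "z * w = w * z" if "z \<in> S" "z * y = y * z" for z
      using vc[of z] that by (simp add: w_def x_def algebra_simps)
    ultimately show ?thesis using that ww by blast
  qed
qed

text \<open>For \<open>N b \<le> 1\<close> let \<open>e - v\<close> be a root of
  \<open>e - b * b\<close>. It commutes with \<open>b\<close> and the two squares add up to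
  \<open>e\<close>, so \<open>N_square_le_sum_squares\<close> gives
  \<open>N (e - v) \<le> 1\<close>. Hence \<open>N (e - b * b) \<le> 1\<close>, which is positivity
  of \<open>b * b\<close> with radius 1. The general case is scaling.\<close>

lemma pos_square [intro]:
  assumes b: "b \<in> S" "adj b = b"
  shows "pos (b * b)"
proof -
  have *: "pos (b * b)" if b: "b \<in> S" "adj b = b" "N b \<le> 1" for b
  proof -
    have "N (b * b) \<le> 2 * 1 - 1\<^sup>2"
      using that N_mult[of b b] mult_mono[of "N b" 1 "N b" 1] by simp
    with exists_sqrt_complement[of "b * b" 1] b obtain v
      where v: "v \<in> S" "adj v = v" "v + v = b * b + v * v"
        and vc: "\<And>z. z \<in> S \<Longrightarrow> z * (b * b) = (b * b) * z \<Longrightarrow> z * v = v * z" by (metis adj_mult mult_mem zero_le_one order_refl)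
    have bv: "b * v = v * b" using vc b by (simp add: mult.assoc)
    have "(e - v) * (e - v) = e - (v + v) + v * v"
      using v(1) by (simp add: algebra_simps)
    also have "\<dots> = e - b * b"
      unfolding v(3) by simp
    finally have sq: "(e - v) * (e - v) = e - b * b" .
    have "(N (e - v))\<^sup>2 \<le> N ((e - v) * (e - v) + b * b)"
      using v b bv by (intro N_square_le_sum_squares) (auto simp: algebra_simps)
    then have "N (e - b * b) \<le> 1"
      using sq N_self_adjoint_square[of "e - v"] v N_e_le_1 by simp
    then show ?thesis using b by (intro posI[of _ 1]) (auto simp: sc_1)
  qed
  define r where "r = N b + 1"
  have r: "r > 0" "N b \<le> r" using b N_nonneg[of b] unfolding r_def by linarith+
  have "N (complex_of_real (1/r) *\<^sub>C b) \<le> 1"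
    using r b by (simp add: N_cscale norm_divide)
  then have "pos ((complex_of_real (1/r) *\<^sub>C b) * (complex_of_real (1/r) *\<^sub>C b))"
    using b by (intro *) auto
  from pos_cscale[OF this, of "r * r"] show ?thesis
    using r by (simp add: cscale_simps)
qed

lemma pos_mult:
  assumes "pos x" "pos y" "x * y = y * x"
  shows "pos (x * y)"
proof -
  obtain v where v: "pos v" "v * v = x" "\<And>z. z \<in> S \<Longrightarrow> z * x = x * z \<Longrightarrow> z * v = v * z"
    using pos_sqrt[OF assms(1)] by blast
  obtain w where w: "pos w" "w * w = y" "\<And>z. z \<in> S \<Longrightarrow> z * y = y * z \<Longrightarrow> z * w = w * z"
    using pos_sqrt[OF assms(2)] by blast
  have "y * v = v * y" using v(3) assms by simp
  then have vw: "v * w = w * v" using w(3) v(1) by simp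
  have "pos ((v * w) * (v * w))" using v(1) w(1) vw by (intro pos_square) auto
  also have "(v * w) * (v * w) = (v * v) * (w * w)" by (metis vw mult.assoc)
  finally show ?thesis using v(2) w(2) by simp
qed

text \<open>The positive factors \<open>sc s - x\<close> and \<open>sc s + x\<close> commute, so
  their product \<open>s^2 - x^2\<close> is a square \<open>w * w\<close>. Then
  \<open>(N x)^2 \<le> N (x * x + w * w)\<close>, and the right side is the norm of a
  scalar.\<close>

lemma N_le_if_pos:
  assumes "pos (sc s - x)" "pos (sc s + x)" "0 \<le> s"
  shows "N x \<le> s"
proof -
  have "sc s + x - sc s = x" by simp
  then have "x \<in> S" using assms(2) by (metis diff_mem pos_mem sc_mem)
  moreover have "adj x = x" using pos_adj[OF assms(2)] by simp
  ultimately have x: "x \<in> S" "adj x = x" by auto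
  have "pos ((sc s - x) * (sc s + x))"
    using x assms by (intro pos_mult) (simp_all add: algebra_simps)
  also have "(sc s - x) * (sc s + x) = sc (s * s) - x * x"
    using x by (simp add: algebra_simps cscale_sc)
  finally obtain w where w: "pos w" "w * w = sc (s * s) - x * x"
    "\<And>z. z \<in> S \<Longrightarrow> z * (sc (s * s) - x * x) = (sc (s * s) - x * x) * z \<Longrightarrow> z * w = w * z"
    using pos_sqrt by blast
  have "x * w = w * x" using x by (intro w(3)) (auto simp: algebra_simps)
  then have "(N x)\<^sup>2 \<le> N (x * x + w * w)" using x w(1) by (intro N_square_le_sum_squares) auto
  also have "\<dots> \<le> s\<^sup>2" using w(2) N_sc_le[of "s * s"] by (simp add: power2_eq_square)
  finally show ?thesis using assms(3) by (rule power2_le_imp_le)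
qed

text \<open>The radius in the definition of \<open>pos\<close> can be any bound on the norm, not
  just the one that witnessed positivity.\<close>

lemma pos_N_le:
  assumes "pos z" "N z \<le> t"
  shows "N (sc t - z) \<le> t"
proof (rule N_le_if_pos)
  show "pos (sc t + (sc t - z))"
    using assms order_trans[OF N_nonneg assms(2)] by (intro pos_add pos_sc pos_sc_diff) auto
  show "0 \<le> t" using assms order_trans[OF N_nonneg assms(2)] by auto
qed (use assms in auto)

text \<open>Roots of \<open>y\<close> and \<open>- y\<close> commute and their squares add up to 0,
  so \<open>N_square_le_sum_squares\<close> makes the root of \<open>y\<close> vanish.\<close>

lemma pos_antisym:
  assumes "pos y" "pos (- y)"
  shows "y = 0"
proof -
  obtain v where v: "pos v" "v * v = y" "\<And>z. z \<in> S \<Longrightarrow> z * y = y * z \<Longrightarrow> z * v = v * z"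
    using pos_sqrt[OF assms(1)] by blast
  obtain w where w: "pos w" "w * w = - y" "\<And>z. z \<in> S \<Longrightarrow> z * - y = - y * z \<Longrightarrow> z * w = w * z"
    using pos_sqrt[OF assms(2)] by blast
  have "y * v = v * y" using v(3)[of y] assms(1) by simp
  then have "v * w = w * v" using w(3) v(1) by simp
  then have "(N v)\<^sup>2 \<le> N (v * v + w * w)" using v(1) w(1) by (intro N_square_le_sum_squares) auto
  then have "v = 0" using v(1,2) w(2) N_eq_0_iff[of v] by simp
  then show ?thesis using v(2) by simp
qed

text \<open>Conjugation by a unitary fixes the centre \<open>sc t\<close> and does not increase
  norms, so it preserves the ball in \<open>pos\<close>. Conjugation by arbitrary elements would
  need positivity of \<open>adj x * x\<close>.\<close>

lemma pos_conjugate_unitary: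
  assumes "pos y" "v \<in> S" "adj v * v = e" "v * adj v = e"
  shows "pos (v * y * adj v)"
proof -
  obtain t where t: "0 \<le> t" "N (sc t - y) \<le> t" using assms(1) unfolding pos_def by blast
  have "(N v)\<^sup>2 \<le> 1" using N_adj_mult[OF assms(2)] assms(3) N_e_le_1 by simp
  then have Nv: "N v \<le> 1" using power2_le_imp_le[of "N v" 1] by simp
  have "sc t - v * y * adj v = v * (sc t - y) * adj v"
    using assms by (simp add: algebra_simps) (simp add: sc_def)
  also have "N \<dots> \<le> N v * N (sc t - y) * N v"
    using N_mult[of "v * (sc t - y)" "adj v"] N_mult[of v "sc t - y"] assms(1,2)
      mult_right_mono[of "N (v * (sc t - y))" "N v * N (sc t - y)" "N v"] by simp
  also have "\<dots> \<le> 1 * t * 1"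
    using assms(1,2) t Nv by (intro mult_mono) auto
  finally show ?thesis using assms t by (intro posI[of _ t]) (auto simp: mult.assoc)
qed

text \<open>For \<open>\<delta> = s - \<rho>\<^sup>2\<close> one has \<open>(\<rho> \<delta>)\<^sup>2 + s \<delta>\<^sup>2 = 0\<close>, which forces \<open>\<delta> = 0\<close>.\<close>

lemma pos_root_of_scalar:
  assumes "\<rho> \<in> S" "adj \<rho> = \<rho>" "(\<rho> * \<rho>) * (\<rho> * \<rho>) = sc (s * s)" "s > 0"
  shows "\<rho> * \<rho> = sc s"
proof -
  define \<delta> where "\<delta> = sc s - \<rho> * \<rho>"
  have \<delta>: "\<delta> \<in> S" "adj \<delta> = \<delta>" "\<rho> * \<delta> = \<delta> * \<rho>"
    using assms by (simp_all add: \<delta>_def algebra_simps)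
  let ?r = "complex_of_real (sqrt s)"
  have "(\<rho> * \<rho>) * \<delta> = - (complex_of_real s *\<^sub>C \<delta>)"
    using assms by (simp add: \<delta>_def algebra_simps cscale_sc)
  then have "(\<rho> * \<delta>) * (\<rho> * \<delta>) = - (complex_of_real s *\<^sub>C \<delta>) * \<delta>"
    using \<delta>(3) by (metis mult.assoc)
  moreover have "(?r *\<^sub>C \<delta>) * (?r *\<^sub>C \<delta>) = (complex_of_real s *\<^sub>C \<delta>) * \<delta>"
    using assms(4) by (simp add: cscale_simps) (simp flip: of_real_mult)
  moreover have "(N (?r *\<^sub>C \<delta>))\<^sup>2 \<le> N ((?r *\<^sub>C \<delta>) * (?r *\<^sub>C \<delta>) + (\<rho> * \<delta>) * (\<rho> * \<delta>))"
    using \<delta> assms by (intro N_square_le_sum_squares) (auto, metis mult.assoc)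
  ultimately have "(N (?r *\<^sub>C \<delta>))\<^sup>2 \<le> 0" using \<delta>(1) by (simp only:) simp
  then have "N (?r *\<^sub>C \<delta>) = 0" by simp
  then have "\<delta> = 0" using \<delta>(1) assms(4) by (simp add: N_cscale N_eq_0_iff)
  then show ?thesis by (simp add: \<delta>_def)
qed

end

subsection \<open>Suprema and spectral projections\<close>

text \<open>\<open>cluster_point\<close> is Banach-Alaoglu reduced to closed balls. As
  \<open>pos\<close> is a ball condition, order relations between the terms and fixed elements pass
  on to \<open>x\<close>.\<close>

locale wstar_unital = cstar_unital S N e
  for S :: "'a::star_algebra set" and N :: "'a \<Rightarrow> real" and e +
  assumes cluster_point: "\<And>u :: nat \<Rightarrow> 'a. \<And>C. (\<And>n. u n \<in> S) \<Longrightarrow> (\<And>n. N (u n) \<le> C) \<Longrightarrow>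
    \<exists>x\<in>S. \<forall>y\<in>S. \<forall>r. (\<forall>\<^sub>F n in sequentially. N (u n - y) \<le> r) \<longrightarrow> N (x - y) \<le> r"
begin

lemma increasing_sequence_sup:
  fixes u :: "nat \<Rightarrow> 'a"
  assumes u0: "\<And>n. pos (u n)" and u1: "\<And>n. pos (e - u n)" and inc: "\<And>n. pos (u (Suc n) - u n)"
  obtains x where "\<And>n. pos (x - u n)"
    "\<And>y. y \<in> S \<Longrightarrow> adj y = y \<Longrightarrow> (\<And>n. pos (y - u n)) \<Longrightarrow> pos (y - x)"
proof -
  have S [simp]: "u n \<in> S" "adj (u n) = u n" for n using u0 by simp_all
  have inc': "pos (u (n + k) - u n)" for n k
  proof (induction k)
    case (Suc k)
    then show ?case using pos_add[OF Suc inc[of "n + k"]] by simp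
  qed simp
  have N1: "N (u n) \<le> 1" for n
    using u0 u1 by (intro N_le_if_pos) (auto simp: sc_1)
  obtain x' where x': "x' \<in> S" and ball: "\<And>y r. y \<in> S \<Longrightarrow> \<forall>\<^sub>F n in sequentially. N (u n - y) \<le> r \<Longrightarrow> N (x' - y) \<le> r"
    using cluster_point[of u, OF S(1) N1] by blast
  \<comment> \<open>The cluster point need not be self-adjoint; its real part lies in the same balls
    with self-adjoint centre.\<close>
  define x where "x = (1/2) *\<^sub>C (x' + adj x')"
  have x: "x \<in> S" "adj x = x" using x' by (simp_all add: x_def add.commute)
  have N_x: "N (x - y) \<le> N (x' - y)" if y: "y \<in> S" "adj y = y" for y
  proof -
    have "y = (1/2) *\<^sub>C (y + y)" using cscale.scale_left_distrib[of "1/2" "1/2" y]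
      by (simp add: cscale_simps)
    then have "x - y = (1/2) *\<^sub>C ((x' + adj x') - (y + y))"
      unfolding x_def by (simp only: cscale.scale_right_diff_distrib)
    also have "(x' + adj x') - (y + y) = (x' - y) + adj (x' - y)" using y by simp
    finally have "N (x - y) = N ((x' - y) + adj (x' - y)) / 2"
      using x' y by (simp only: N_cscale add_mem diff_mem adj_mem) simp
    also have "\<dots> \<le> N (x' - y)" using N_triangle[of "x' - y" "adj (x' - y)"] x' y
      by (simp only: N_adj add_mem diff_mem adj_mem) simp
    finally show ?thesis .
  qed
  show ?thesis
  proof
    fix n
    \<comment> \<open>For \<open>m \<ge> n\<close> the difference \<open>u m - u n\<close> lies
      between 0 and \<open>e\<close>, hence within distance 1 of \<open>e\<close>. So the ball of
      radius 1 about \<open>e + u n\<close> contains a tail of the sequence, and for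
      \<open>x\<close> it reads \<open>x \<ge> u n\<close>.\<close>
    have "\<forall>\<^sub>F m in sequentially. N (u m - (e + u n)) \<le> 1"
    proof (rule eventually_sequentiallyI)
      fix m assume "n \<le> m"
      then have p: "pos (u m - u n)" using inc'[of n "m - n"] by simp
      have "pos (e - u m + u n)" using pos_add[OF u1[of m] u0[of n]] .
      then have "pos (e + (e - u m + u n))" by (rule pos_add[OF pos_e])
      then have "pos (e + (e - (u m - u n)))" by (simp add: algebra_simps)
      then have "N (e - (u m - u n)) \<le> 1"
        using p by (intro N_le_if_pos) (auto simp: sc_1)
      then show "N (u m - (e + u n)) \<le> 1"
        using N_diff_commute[of "u m" "e + u n"] by (simp add: algebra_simps)
    qed
    then have "N (x - (e + u n)) \<le> 1"
      using ball[of "e + u n" 1] N_x[of "e + u n"] by simp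
    then have "N (sc 1 - (x - u n)) \<le> 1"
      using N_diff_commute[of x "e + u n"] x by (simp add: sc_1 algebra_simps)
    then show "pos (x - u n)" using x by (intro posI) auto
  next
    fix y assume y: "y \<in> S" "adj y = y" and up: "\<And>n. pos (y - u n)"
    \<comment> \<open>\<open>t\<close> bounds \<open>N (y - u n)\<close> for every \<open>n\<close>,
      so one ball about \<open>y - sc t\<close> contains the whole sequence and encodes
      \<open>u n \<le> y\<close>.\<close>
    define t where "t = N y + 1"
    have "N (u n - (y - sc t)) \<le> t" for n
    proof -
      have "N (y - u n) \<le> t" using N_diff_triangle[of y "u n"] N1[of n] y by (simp add: t_def)
      from pos_N_le[OF up this] show ?thesis by (simp add: algebra_simps)
    qed
    then have "N (x - (y - sc t)) \<le> t"
      using ball[of "y - sc t" t] N_x[of "y - sc t"] y by simp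
    then have "N (sc t - (y - x)) \<le> t" by (simp add: algebra_simps)
    then show "pos (y - x)" using x y by (intro posI) auto
  qed
qed

text \<open>Suprema are unique, hence fixed by unitaries commuting with the sequence; every self-adjoint
  contraction is the real part of the unitary \<open>b + i (1 - b\<^sup>2)\<^sup>1\<^sup>/\<^sup>2\<close>.\<close>

lemma sup_commute:
  assumes x: "x \<in> S" "adj x = x" and upper: "\<And>n. pos (x - u n)"
    and least: "\<And>y. y \<in> S \<Longrightarrow> adj y = y \<Longrightarrow> (\<And>n. pos (y - u n)) \<Longrightarrow> pos (y - x)"
    and u: "\<And>n. u n \<in> S"
    and b: "b \<in> S" "adj b = b" and comm: "\<And>n. b * u n = u n * b"
  shows "b * x = x * b"
proof -
  define r where "r = N b + 1"
  have r: "r > 0" "N b \<le> r" using N_nonneg[OF b(1)] unfolding r_def by linarith+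
  define c where "c = complex_of_real (1/r) *\<^sub>C b"
  have c: "c \<in> S" "adj c = c" "\<And>n. c * u n = u n * c" using b comm by (simp_all add: c_def)
  have "N c \<le> 1" using r b by (simp add: c_def N_cscale norm_divide)
  then have "N (c * c) \<le> 1" using N_mult[of c c] c mult_mono[of "N c" 1 "N c" 1] by simp
  then have "pos (e - c * c)" using c by (intro pos_sc_diff[of _ 1, unfolded sc_1]) auto
  then obtain w where w: "pos w" "w * w = e - c * c"
    and wc: "\<And>z. z \<in> S \<Longrightarrow> z * (e - c * c) = (e - c * c) * z \<Longrightarrow> z * w = w * z"
    using pos_sqrt by blast
  have cw: "c * w = w * c" using c by (intro wc) (auto simp: algebra_simps)
  have wu: "w * u n = u n * w" for n
  proof -
    have "u n * (c * c) = c * c * u n" using c(3) by (metis mult.assoc)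
    then have "u n * w = w * u n" using u[of n] c(1) by (intro wc) (auto simp: algebra_simps)
    then show ?thesis by simp
  qed
  define v where "v = c + \<i> *\<^sub>C w"
  have va: "adj v = c - \<i> *\<^sub>C w" using c w by (simp add: v_def)
  have v: "v \<in> S" using c w by (simp add: v_def)
  have v1: "adj v * v = e" "v * adj v = e"
    unfolding va by (simp_all add: v_def algebra_simps cscale_simps cw w(2))
  have inv: "pos (v * x * adj v - x)" if v: "v \<in> S" "adj v * v = e" "v * adj v = e"
    and vu: "\<And>n. v * u n = u n * v" for v
  proof (rule least)
    fix n
    have "v * (x - u n) * adj v = v * x * adj v - u n * (v * adj v)"
      by (simp only: left_diff_distrib right_diff_distrib vu mult.assoc)
    then show "pos (v * x * adj v - u n)"
      using pos_conjugate_unitary[OF upper v, of n] u v(3) by simp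
  qed (use v x in \<open>auto simp: mult.assoc\<close>)
  have vu: "v * u n = u n * v" "adj v * u n = u n * adj v" for n
    unfolding va by (simp_all add: v_def algebra_simps c(3) wu)
  \<comment> \<open>Leastness is used for \<open>v\<close> and for \<open>adj v\<close>. Conjugating
    the second inequality by \<open>v\<close> reverses the first one, and antisymmetry makes
    \<open>v\<close> commute with \<open>x\<close>.\<close>
  have 1: "pos (v * x * adj v - x)" using inv v v1 vu by simp
  have "pos (adj v * x * v - x)" using inv[of "adj v"] v v1 vu by simp
  from pos_conjugate_unitary[OF this v v1]
  have "pos (v * (adj v * x * v) * adj v - v * x * adj v)" by (simp add: algebra_simps)
  also have "v * (adj v * x * v) * adj v = (v * adj v) * x * (v * adj v)" by (simp add: mult.assoc)
  also have "\<dots> = x" using v1 x by simp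
  finally have "v * x * adj v - x = 0" using pos_antisym[OF 1] by simp
  then have "v * x * (adj v * v) = x * v" by (simp add: mult.assoc[symmetric])
  then have vx: "v * x = x * v" using v1 x v by (simp add: mult.assoc)
  have "adj v * x = x * adj v" using arg_cong[OF vx, of adj] x by simp
  with vx have "(v + adj v) * x = x * (v + adj v)" by (simp add: algebra_simps)
  moreover have "b = complex_of_real (r / 2) *\<^sub>C (v + adj v)"
  proof -
    have "v + adj v = 2 *\<^sub>C c" unfolding va using cscale.scale_left_distrib[of 1 1 c] by (simp add: v_def)
    then show ?thesis using r by (simp add: c_def cscale_simps)
  qed
  ultimately show ?thesis by simp
qed

text \<open>The projection \<open>x\<close> is the supremum of the polynomials \<open>1 - (1 - h)\<^sup>n\<close>, which increase to the
  support of \<open>h\<close>.\<close>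

lemma separating_projection:
  assumes h: "pos h" "pos (e - h)" and k: "pos k" "pos (e - k)" and hk: "h * k = 0"
  obtains x where "x \<in> S" "adj x = x" "x * x = x" "x * h = h" "x * k = 0"
proof -
  have hS [simp]: "h \<in> S" "adj h = h" "k \<in> S" "adj k = k" using h k by simp_all
  have kh: "k * h = 0" using arg_cong[OF hk, of adj] by simp
  \<comment> \<open>\<open>r n\<close> is \<open>(e - h)^n\<close>, written by recursion because its
    zeroth power is the unit of the carrier, not of the type.\<close>
  define r where "r = rec_nat e (\<lambda>_ g. (e - h) * g)"
  have r [simp]: "r 0 = e" "r (Suc n) = (e - h) * r n" for n by (simp_all add: r_def)
  have rS [simp]: "r n \<in> S" for n by (induction n) auto
  have rc: "z * r n = r n * z" if "z \<in> S" "z * h = h * z" for z n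
  proof (induction n)
    case (Suc n)
    have "z * ((e - h) * r n) = ((e - h) * z) * r n"
      using that by (simp add: algebra_simps flip: mult.assoc)
    then show ?case using Suc by (simp add: mult.assoc)
  qed (use that in simp)
  have rpos: "pos (r n)" for n
  proof (induction n)
    case (Suc n)
    have "(e - h) * r n = r n * (e - h)" by (rule rc) (auto simp: algebra_simps)
    then show ?case using Suc h by (auto intro: pos_mult)
  qed auto
  have hr: "h * r n = r n * h" for n by (rule rc) auto
  have hrpos: "pos (h * r n)" for n using h rpos hr by (intro pos_mult) auto
  have rdiff: "r n - r (Suc n) = h * r n" for n by (simp add: algebra_simps)
  define u where "u n = e - r n" for n
  have upos: "pos (u n)" for n
  proof (induction n)
    case (Suc n)
    have "u (Suc n) = u n + h * r n" by (simp add: u_def algebra_simps)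
    then show ?case using Suc hrpos by auto
  qed (simp add: u_def)
  obtain x where xu: "\<And>n. pos (x - u n)"
    and least: "\<And>y. y \<in> S \<Longrightarrow> adj y = y \<Longrightarrow> (\<And>n. pos (y - u n)) \<Longrightarrow> pos (y - x)"
  proof (rule increasing_sequence_sup[of u])
    show "pos (u (Suc n) - u n)" for n using hrpos[of n] by (simp add: u_def algebra_simps)
  qed (use upos rpos u_def in auto)
  have xpos: "pos x" using xu[of 0] by (simp add: u_def)
  have xS [simp]: "x \<in> S" "adj x = x" using xpos by simp_all
  have uS [simp]: "u n \<in> S" for n by (simp add: u_def)
  have xc: "b * x = x * b" if "b \<in> S" "adj b = b" "b * h = h * b" for b
    by (rule sup_commute[OF xS xu least]) (use that rc in \<open>auto simp: u_def algebra_simps\<close>)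
  have hx: "h * x = x * h" by (rule xc) auto
  have kx: "k * x = x * k" by (rule xc) (auto simp: hk kh)
  have xux: "u n * x = x * u n" for n
  proof (rule xc)
    show "adj (u n) = u n" using upos by simp
    show "u n * h = h * u n" using hr[of n] by (simp add: u_def algebra_simps)
  qed simp
  have ex: "pos (e - x)" by (rule least) (use rpos in \<open>auto simp: u_def\<close>)
  \<comment> \<open>The terms of \<open>e - (e - h)^n = (\<Sum>k<n. h (e - h)^k)\<close> decrease,
    so \<open>n h (e - h)^n \<le> e - (e - h)^n \<le> e\<close>. The induction proves the first
    inequality without forming the sum.\<close>
  have decay: "real n * N (h * r n) \<le> 1" for n
  proof -
    have "pos (e - r n - complex_of_real (real n) *\<^sub>C (h * r n))"
    proof (induction n)
      case (Suc n)
      have "e - r (Suc n) - complex_of_real (real (Suc n)) *\<^sub>C (h * r (Suc n)) =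
        (e - r n - complex_of_real (real n) *\<^sub>C (h * r n)) +
        complex_of_real (real (Suc n)) *\<^sub>C (h * (r n - r (Suc n)))"
        by (simp add: algebra_simps cscale_simps)
      also have "pos \<dots>"
      proof (intro pos_add pos_cscale Suc)
        show "pos (h * (r n - r (Suc n)))"
          unfolding rdiff using arg_cong[OF hr[of n], of "\<lambda>z. h * z"]
          by (intro pos_mult[OF h(1) hrpos]) (simp add: mult.assoc)
      qed simp
      finally show ?case .
    qed simp
    from pos_add[OF this rpos[of n]]
    have "pos (sc 1 - complex_of_real (real n) *\<^sub>C (h * r n))" by (simp add: sc_1 algebra_simps)
    moreover have "pos (complex_of_real (real n) *\<^sub>C (h * r n))"
      using hrpos by (intro pos_cscale) auto
    then have "pos (sc 1 + complex_of_real (real n) *\<^sub>C (h * r n))"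
      by (intro pos_add) (auto simp: sc_1)
    ultimately have "N (complex_of_real (real n) *\<^sub>C (h * r n)) \<le> 1" by (intro N_le_if_pos) auto
    then show ?thesis by (simp add: N_cscale)
  qed
  \<comment> \<open>With \<open>w^2 = e - x\<close> and \<open>z^2 = x - u n\<close>, the commuting
    self-adjoint elements \<open>w h\<close> and \<open>z h\<close> have squares adding up to
    \<open>h (e - u n) h = h (h r n)\<close>, which tends to 0 by \<open>decay\<close>. So
    \<open>w h = 0\<close>, and \<open>(e - x) h = w (w h) = 0\<close>.\<close>
  have xh: "x * h = h"
  proof -
    obtain w where w: "pos w" "w * w = e - x" "\<And>z. z \<in> S \<Longrightarrow> z * (e - x) = (e - x) * z \<Longrightarrow> z * w = w * z"
      using pos_sqrt[OF ex] by blast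
    have wh: "h * w = w * h" using w(3)[of h] hx by (simp add: algebra_simps)
    have wS: "w \<in> S" "adj w = w" using w(1) by simp_all
    have small: "(N (w * h))\<^sup>2 \<le> N h * N (h * r n)" for n
    proof -
      obtain z where z: "pos z" "z * z = x - u n"
        "\<And>y. y \<in> S \<Longrightarrow> y * (x - u n) = (x - u n) * y \<Longrightarrow> y * z = z * y"
        using pos_sqrt[OF xu[of n]] by blast
      have hz: "h * z = z * h" using z(3)[of h] hx hr[of n] by (simp add: u_def algebra_simps)
      have "u n * w = w * u n" using w(3)[of "u n"] xux[of n] by (simp add: algebra_simps)
      moreover have "x * w = w * x" using w(3)[of x] by (simp add: algebra_simps)
      ultimately have wz: "w * z = z * w" using z(3)[of w] wS by (simp add: algebra_simps)
      have zS: "z \<in> S" "adj z = z" using z(1) by simp_all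
      have "(w * h) * (z * h) = (z * h) * (w * h)" by (metis hz wh wz mult.assoc)
      then have "(N (w * h))\<^sup>2 \<le> N ((w * h) * (w * h) + (z * h) * (z * h))"
        using wS zS wh hz by (intro N_square_le_sum_squares) auto
      also have "(w * h) * (w * h) = h * (w * w) * h" by (metis wh mult.assoc)
      also have "(z * h) * (z * h) = h * (z * z) * h" by (metis hz mult.assoc)
      also have "h * (w * w) * h + h * (z * z) * h = h * (h * r n)"
        unfolding w(2) z(2)
        using arg_cong[OF hr[of n], of "\<lambda>z. z * h"] arg_cong[OF hr[of n], of "\<lambda>z. h * z"]
        by (simp add: u_def algebra_simps)
      also have "N \<dots> \<le> N h * N (h * r n)" by (rule N_mult) auto
      finally show ?thesis .
    qed
    have "(w * h) * (w * h) = 0"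
    proof (rule eq_zero_if_N_small)
      fix n
      have "N ((w * h) * (w * h)) = (N (w * h))\<^sup>2"
        using wS wh by (intro N_self_adjoint_square) auto
      also have "\<dots> \<le> N h * N (h * r (Suc n))" by (rule small)
      also have "\<dots> \<le> N h * (1 / real (Suc n))"
        using decay[of "Suc n"] by (intro mult_left_mono) (auto simp: field_simps simp del: r)
      finally show "N ((w * h) * (w * h)) \<le> N h * (1 / real (Suc n))" .
      show "(\<lambda>n. N h * (1 / real (Suc n))) \<longlonglongrightarrow> 0"
        using tendsto_mult_left[OF LIMSEQ_inverse_real_of_nat, of "N h"] by (simp add: inverse_eq_divide)
    qed (use wS in auto)
    then have "(N (w * h))\<^sup>2 = 0"
      using N_self_adjoint_square[of "w * h"] wS wh by simp
    then have "w * h = 0" using N_eq_0_iff[of "w * h"] wS by simp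
    then have "(w * w) * h = 0" by (simp add: mult.assoc)
    then show ?thesis by (simp add: w(2) algebra_simps)
  qed
  have xu_eq: "x * u n = u n" for n
  proof (induction n)
    case (Suc n)
    have uSuc: "u (Suc n) = u n + h - h * u n" by (simp add: u_def algebra_simps)
    then have "x * u (Suc n) = x * u n + x * h - x * h * u n"
      by (simp only: distrib_left right_diff_distrib mult.assoc)
    then show ?case using Suc xh uSuc by simp
  qed (simp add: u_def)
  \<comment> \<open>\<open>x * x\<close> is an upper bound because \<open>x * u n = u n\<close>, so
    \<open>x \<le> x * x\<close>; the reverse comes from \<open>0 \<le> x \<le> e\<close>.\<close>
  have xx: "x * x = x"
  proof -
    have "pos (x * x - x)"
    proof (rule least)
      fix n
      have "pos (x * (x - u n))" using xpos xu xux by (intro pos_mult) (auto simp: algebra_simps)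
      then show "pos (x * x - u n)" by (simp add: algebra_simps xu_eq)
    qed auto
    moreover have "pos (x * (e - x))" using xpos ex by (intro pos_mult) (auto simp: algebra_simps)
    ultimately have "x * x - x = 0" by (intro pos_antisym) (auto simp: algebra_simps)
    then show ?thesis by simp
  qed
  \<comment> \<open>\<open>e - k\<close> is an upper bound: \<open>k * h = 0\<close> gives
    \<open>k * r n = k\<close>, so \<open>e - k - u n = (e - k) * r n\<close>. Multiplying
    \<open>x \<le> e - k\<close> by \<open>x\<close> then leaves
    \<open>- (x * k) \<ge> 0\<close>.\<close>
  have "pos (e - k - x)"
  proof (rule least)
    fix n
    have "k * r n = k"
    proof (induction n)
      case (Suc n)
      have "k * r (Suc n) = (k - k * h) * r n" by (simp add: algebra_simps)
      then show ?case using Suc kh by simp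
    qed simp
    then have "(e - k) * r n = e - k - u n" by (simp add: u_def algebra_simps)
    moreover have "pos ((e - k) * r n)"
    proof (intro pos_mult k rpos)
      show "(e - k) * r n = r n * (e - k)" by (rule rc) (auto simp: algebra_simps hk kh)
    qed
    ultimately show "pos (e - k - u n)" by simp
  qed (auto simp: algebra_simps)
  then have "pos (x * (e - k - x))"
    using xpos kx by (intro pos_mult) (auto simp: algebra_simps)
  then have "pos (- (x * k))" using xx by (simp add: algebra_simps)
  moreover have "pos (x * k)" using xpos k kx by (intro pos_mult) auto
  ultimately have "x * k = 0" by (intro pos_antisym)
  then show ?thesis using that xx xh xS by blast
qed

end

section \<open>Star-homomorphisms between carriers, and spectral cuts over the unit\<close>

definition star_hom_on :: "'a::star_algebra set \<Rightarrow> 'b::star_algebra set \<Rightarrow> ('a \<Rightarrow> 'b) \<Rightarrow> bool" where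
  "star_hom_on S T f \<longleftrightarrow> (\<forall>x\<in>S. f x \<in> T \<and> f (adj x) = adj (f x) \<and> (\<forall>c. f (c *\<^sub>C x) = c *\<^sub>C f x) \<and>
     (\<forall>y\<in>S. f (x + y) = f x + f y \<and> f (x * y) = f x * f y))"

context cstar_set
begin

lemma star_hom_on_simps:
  assumes "star_hom_on S T f" "x \<in> S"
  shows "f x \<in> T" "f (adj x) = adj (f x)" "f (c *\<^sub>C x) = c *\<^sub>C f x"
    "y \<in> S \<Longrightarrow> f (x + y) = f x + f y" "y \<in> S \<Longrightarrow> f (x * y) = f x * f y"
    "y \<in> S \<Longrightarrow> f (x - y) = f x - f y"
proof -
  show *: "f x \<in> T" "f (adj x) = adj (f x)" "f (c *\<^sub>C x) = c *\<^sub>C f x"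
    "y \<in> S \<Longrightarrow> f (x + y) = f x + f y" "y \<in> S \<Longrightarrow> f (x * y) = f x * f y" for c y
    using assms by (auto simp: star_hom_on_def)
  show "f (x - y) = f x - f y" if "y \<in> S"
  proof -
    have "f (x + (-1) *\<^sub>C y) = f x + (-1) *\<^sub>C f y"
      using assms that unfolding star_hom_on_def by (metis cscale_mem)
    then show ?thesis by simp
  qed
qed

lemma star_hom_on_sum:
  assumes "star_hom_on S T f" "finite I" "\<And>i. i \<in> I \<Longrightarrow> x i \<in> S"
  shows "f (\<Sum>i\<in>I. x i) = (\<Sum>i\<in>I. f (x i))"
  using assms(2,3)
proof (induction I rule: finite_induct)
  case empty
  then show ?case using star_hom_on_simps(6)[OF assms(1) zero_mem, of 0] by simp
qed (use star_hom_on_simps[OF assms(1)] in auto)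

end

context wstar_unital
begin

text \<open>Reduced to the positive contractions \<open>r h^2\<close> and \<open>s k^2\<close>,
  which are still orthogonal. The C*-identity returns from \<open>x h^2 = h^2\<close> to
  \<open>x h = h\<close> and from \<open>x k^2 = 0\<close> to \<open>x k = 0\<close>.\<close>

lemma separating_projection_self_adjoint:
  assumes h: "h \<in> S" "adj h = h" and k: "k \<in> S" "adj k = k" and hk: "h * k = 0"
  obtains x where "x \<in> S" "adj x = x" "x * x = x" "x * h = h" "x * k = 0"
proof -
  have scaled: "\<exists>r>0. pos (complex_of_real r *\<^sub>C (y * y)) \<and> pos (e - complex_of_real r *\<^sub>C (y * y))"
    if y: "y \<in> S" "adj y = y" for y
  proof -
    define r where "r = 1 / (N (y * y) + 1)"
    have "0 < N (y * y) + 1" using N_nonneg[OF mult_mem[OF y(1) y(1)]] by linarith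
    then have r: "r > 0" "r * N (y * y) \<le> 1" by (simp_all add: r_def divide_le_eq)
    then have "pos (e - complex_of_real r *\<^sub>C (y * y))"
      using y by (intro pos_sc_diff[of _ 1, unfolded sc_1]) (auto simp: N_cscale)
    then show ?thesis using r y by (auto intro!: exI[of _ r])
  qed
  obtain r where r: "r > 0" "pos (complex_of_real r *\<^sub>C (h * h))" "pos (e - complex_of_real r *\<^sub>C (h * h))"
    using scaled[OF h] by blast
  obtain s where s: "s > 0" "pos (complex_of_real s *\<^sub>C (k * k))" "pos (e - complex_of_real s *\<^sub>C (k * k))"
    using scaled[OF k] by blast
  have "h * (h * (k * k)) = h * ((h * k) * k)" by (simp only: mult.assoc)
  then have "(complex_of_real r *\<^sub>C (h * h)) * (complex_of_real s *\<^sub>C (k * k)) = 0"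
    by (simp add: hk mult.assoc)
  from separating_projection[OF r(2,3) s(2,3) this] obtain x
    where x: "x \<in> S" "adj x = x" "x * x = x"
    and xr: "x * (complex_of_real r *\<^sub>C (h * h)) = complex_of_real r *\<^sub>C (h * h)"
    and xs: "x * (complex_of_real s *\<^sub>C (k * k)) = 0" by blast
  have xhh: "x * (h * h) = h * h"
    using xr r(1) cscale.scale_cancel_left[of "complex_of_real r" "x * (h * h)" "h * h"] by simp
  have xkk: "x * (k * k) = 0"
    using xs s(1) cscale.scale_eq_0_iff[of "complex_of_real s" "x * (k * k)"] by simp
  have "(x * h - h) * adj (x * h - h) = (x * (h * h)) * x - x * (h * h) - (h * h) * x + h * h"
    using x h by (simp add: algebra_simps)
  also have "(h * h) * x = h * h" using arg_cong[OF xhh, of adj] x h by (simp add: mult.assoc)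
  finally have "(x * h - h) * adj (x * h - h) = 0" using xhh \<open>(h * h) * x = h * h\<close> by simp
  then have 1: "x * h = h" using N_mult_adj[of "x * h - h"] N_eq_0_iff[of "x * h - h"] x h by simp
  have "(x * k) * adj (x * k) = (x * (k * k)) * x" using x k by (simp add: mult.assoc)
  then have "x * k = 0" using xkk N_mult_adj[of "x * k"] N_eq_0_iff[of "x * k"] x k by simp
  then show ?thesis using that x 1 by blast
qed

text \<open>\<open>P\<close> is the spectral projection of \<open>a\<close> for \<open>(1/2, \<infinity>)\<close>; there \<open>a\<close> agrees with the invertible
  element \<open>b = 1/2 + (a - 1/2)\<^sub>+\<close>, and \<open>g = P b\<^sup>-\<^sup>1\<^sup>/\<^sup>2\<close>.\<close>

lemma spectral_cut:
  fixes \<pi> :: "'a \<Rightarrow> 'b::star_algebra"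
  assumes M: "cstar_unital S' N' \<epsilon>" and hom: "star_hom_on S S' \<pi>" and \<pi>e: "\<pi> e = \<epsilon>"
    and a: "a \<in> S" "adj a = a" "\<pi> a = \<epsilon>"
  obtains P g where "P \<in> S" "adj P = P" "P * P = P" "g \<in> S" "adj g = g" "P * g = g" "g * P = g"
    "g * a * g = P" "\<pi> P = \<epsilon>" "\<pi> g = \<epsilon>"
proof -
  interpret M: cstar_unital S' N' \<epsilon> by (rule M)
  note hs = star_hom_on_simps[OF hom]
  have \<pi>sc: "\<pi> (sc r) = M.sc r" for r by (simp add: sc_def M.sc_def hs \<pi>e)
  \<comment> \<open>\<open>pos\<close> is a norm condition and does not evidently pass through
    \<open>\<pi>\<close>. A self-adjoint root \<open>\<rho>\<close> of \<open>y\<close> does pass,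
    and \<open>pos_root_of_scalar\<close> then singles out the positive root \<open>s\<close> of
    \<open>s * s\<close>.\<close>
  have \<pi>_root: "\<pi> y = M.sc s" if y: "pos y" and yy: "\<pi> (y * y) = M.sc (s * s)" and s: "s > 0" for y s
  proof -
    obtain \<rho> where \<rho>: "pos \<rho>" "\<rho> * \<rho> = y" using pos_sqrt[OF y] by blast
    have \<rho>S: "\<rho> \<in> S" "adj \<rho> = \<rho>" using \<rho>(1) by simp_all
    have \<pi>y: "\<pi> \<rho> * \<pi> \<rho> = \<pi> y" using \<rho>S \<rho>(2) by (metis hs(5))
    have "\<pi> \<rho> * \<pi> \<rho> = M.sc s"
    proof (rule M.pos_root_of_scalar[OF _ _ _ s])
      show "\<pi> \<rho> \<in> S'" by (rule hs(1)[OF \<rho>S(1)])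
      show "adj (\<pi> \<rho>) = \<pi> \<rho>" using hs(2)[OF \<rho>S(1)] \<rho>S(2) by simp
      show "\<pi> \<rho> * \<pi> \<rho> * (\<pi> \<rho> * \<pi> \<rho>) = M.sc (s * s)"
        unfolding \<pi>y using hs(5)[OF pos_mem[OF y] pos_mem[OF y]] yy by simp
    qed
    then show ?thesis using \<pi>y by simp
  qed
  define c where "c = a - sc (1/2)"
  have c: "c \<in> S" "adj c = c" using a by (simp_all add: c_def)
  have \<pi>c: "\<pi> c = M.sc (1/2)" using a M.sc_diff[of 1 "1/2"] by (simp add: c_def hs \<pi>sc M.sc_1)
  \<comment> \<open>\<open>q\<close> is the modulus of \<open>c = a - 1/2\<close>; \<open>h\<close>
    and \<open>k\<close> below are the positive and negative parts of \<open>c\<close>, which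
    \<open>P\<close> separates.\<close>
  obtain q where q: "pos q" "q * q = c * c" and qcomm: "\<And>z. z \<in> S \<Longrightarrow> z * (c * c) = (c * c) * z \<Longrightarrow> z * q = q * z"
    using pos_sqrt[OF pos_square[OF c]] by blast
  have cq: "c * q = q * c" using qcomm[OF c(1)] by (simp add: mult.assoc)
  have qS: "q \<in> S" "adj q = q" using q(1) by simp_all
  have "\<pi> (q * q) = M.sc (1/2 * (1/2))"
    unfolding q(2) hs(5)[OF c(1) c(1)] \<pi>c by (simp only: M.sc_mult_left M.sc_mem M.cscale_sc)
  then have \<pi>q: "\<pi> q = M.sc (1/2)" by (rule \<pi>_root[OF q(1)]) simp
  define h k where "h = (1/2) *\<^sub>C (q + c)" and "k = (1/2) *\<^sub>C (q - c)"
  have hkS: "h \<in> S" "adj h = h" "k \<in> S" "adj k = k" using qS c by (simp_all add: h_def k_def)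
  have "h * k = 0" by (simp add: h_def k_def algebra_simps q cq)
  from separating_projection_self_adjoint[OF hkS this] obtain P
    where P: "P \<in> S" "adj P = P" "P * P = P" "P * h = h" "P * k = 0" by blast
  have hP: "h * P = h" "k * P = 0" using adj_mult[of P h] adj_mult[of P k] P(2,4,5) hkS
    by (metis, metis adj_zero)
  have hk_sum: "h + k = q" "h - k = c"
    by (simp_all add: h_def k_def cscale_simps flip: cscale.scale_left_distrib)
  have qP: "q * P = h" "P * q = h" by (simp_all add: hk_sum(1)[symmetric] algebra_simps hP P)
  have "pos (q * P)" using q(1) pos_square[OF P(1,2)] by (intro pos_mult) (simp_all add: P(3) qP)
  then have hpos: "pos h" by (simp add: qP)
  have \<pi>h: "\<pi> h = M.sc (1/2)"
  proof -
    have "\<pi> h = (1/2) *\<^sub>C (M.sc (1/2) + M.sc (1/2))" using qS c by (simp add: h_def hs \<pi>q \<pi>c)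
    then show ?thesis by (simp add: cscale_simps flip: cscale.scale_left_distrib)
  qed
  have \<pi>P: "\<pi> P = \<epsilon>"
  proof -
    have "\<pi> P * \<pi> h = \<pi> h" using P hkS by (metis hs(5))
    then have "(1/2) *\<^sub>C \<pi> P = (1/2) *\<^sub>C \<epsilon>" using hs(1)[OF P(1)] by (simp add: \<pi>h M.sc_def)
    then show ?thesis by simp
  qed
  define b where "b = h + sc (1/2)"
  have b: "b \<in> S" "adj b = b" using hkS by (simp_all add: b_def)
  have aP: "a * P = b * P"
  proof -
    have a_eq: "a = h - k + sc (1/2)" by (simp add: hk_sum c_def)
    show ?thesis by (subst a_eq) (simp add: b_def distrib_right left_diff_distrib hP)
  qed
  \<comment> \<open>\<open>t\<close> dominates \<open>b = h + 1/2\<close>, so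
    \<open>x = e - b / t\<close> has norm at most \<open>N h / t\<close>, strictly below 1 thanks to
    the summand 1/2. \<open>\<beta>\<close> below is the smaller root of
    \<open>2 \<beta> - \<beta>^2 = N h / t\<close>; that \<open>\<beta> < 1\<close> makes
    \<open>e - y\<close> invertible.\<close>
  define t where "t = N h + 1/2"
  have t: "t > 0" using N_nonneg[OF hkS(1)] by (simp add: t_def)
  define x where "x = complex_of_real (1/t) *\<^sub>C (sc (N h) - h)"
  have x: "x \<in> S" "adj x = x" using hkS by (simp_all add: x_def)
  have tx: "complex_of_real t *\<^sub>C (e - x) = b"
    using t by (simp add: x_def cscale_simps b_def) (simp add: t_def sc_def cscale_simps)
  define \<beta> where "\<beta> = 1 - sqrt (1 - N h / t)"
  have frac: "0 \<le> N h / t" "N h / t < 1" using t N_nonneg[OF hkS(1)] by (simp_all add: t_def)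
  have \<beta>: "0 \<le> \<beta>" "\<beta> < 1" using frac by (simp_all add: \<beta>_def)
  have "N x \<le> N h / t"
    using pos_N_le[OF hpos order_refl] t hkS by (simp add: x_def N_cscale norm_divide divide_right_mono)
  also have "\<dots> = 2 * \<beta> - \<beta>\<^sup>2"
  proof -
    have "(1 - \<beta>)\<^sup>2 = 1 - N h / t" using frac by (simp add: \<beta>_def)
    then show ?thesis by (simp add: power2_eq_square algebra_simps)
  qed
  finally have "N x \<le> 2 * \<beta> - \<beta>\<^sup>2" .
  from exists_sqrt_complement[OF x \<beta>(1) less_imp_le[OF \<beta>(2)] this] obtain y
    where y: "y \<in> S" "adj y = y" "N y \<le> \<beta>" "y + y = x + y * y"
      and ycomm: "\<And>z. z \<in> S \<Longrightarrow> z * x = x * z \<Longrightarrow> z * y = y * z" by blast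
  have "N y < 1" using y(3) \<beta> by simp
  from neumann_series[OF e_mem _ _ y(1,2) adj_e this] y obtain g
    where g: "g \<in> S" "adj g = g" "g = e + y * g"
      and gcomm': "\<And>z. z \<in> S \<Longrightarrow> z * e = e * z \<Longrightarrow> z * y = y * z \<Longrightarrow> z * g = g * z"
    by (metis e_left e_right)
  have gcomm: "z * g = g * z" if "z \<in> S" "z * x = x * z" for z
    using gcomm'[of z] ycomm[of z] that by simp
  have gy: "(e - y) * g = e" using g(3) g(1) by (simp add: algebra_simps)
  have yg: "g * (e - y) = e" using arg_cong[OF gy, of adj] g y by simp
  have "(e - y) * (e - y) = e - (y + y) + y * y" using y(1) by (simp add: algebra_simps)
  also have "\<dots> = e - x" unfolding y(4) by simp
  finally have yy: "(e - y) * (e - y) = e - x" .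
  have "g * b * g = complex_of_real t *\<^sub>C (g * (e - x) * g)"
    unfolding tx[symmetric] by simp
  also have "g * (e - x) * g = (g * (e - y)) * ((e - y) * g)" unfolding yy[symmetric] by (simp only: mult.assoc)
  finally have gbg: "g * b * g = sc t" by (simp add: gy yg sc_def)
  have Px: "P * x = x * P" using P by (simp add: x_def algebra_simps hP)
  have Pg: "P * g = g * P" by (rule gcomm[OF P(1) Px])
  \<comment> \<open>\<open>w\<close> is a positive root of \<open>b\<close>. As
    \<open>\<pi> b = \<epsilon>\<close>, also \<open>\<pi> w = \<epsilon>\<close>, and then
    \<open>g * w = sc (sqrt t)\<close> determines \<open>\<pi> g\<close>.\<close>
  define w where "w = complex_of_real (sqrt t) *\<^sub>C (e - y)"
  have wS: "w \<in> S" "adj w = w" using y by (simp_all add: w_def)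
  have wpos: "pos w"
  proof (rule posI[OF wS])
    have "sc (sqrt t) - w = complex_of_real (sqrt t) *\<^sub>C y"
      by (simp add: w_def sc_def cscale_simps)
    then show "N (sc (sqrt t) - w) \<le> sqrt t"
      using y t \<beta> by (simp add: N_cscale mult_left_le)
  qed
  have ww: "w * w = b"
  proof -
    have "w * w = complex_of_real (sqrt t * sqrt t) *\<^sub>C (e - x)"
      unfolding yy[symmetric] by (simp only: w_def mult_cscale_left mult_cscale_right cscale_cscale of_real_mult)
    then show ?thesis using t tx by simp
  qed
  have \<pi>w: "\<pi> w = \<epsilon>"
    using \<pi>_root[OF wpos, of 1] M.sc_add[of "1/2" "1/2"] hkS by (simp add: ww b_def hs \<pi>h \<pi>sc M.sc_1)
  have gw: "g * w = sc (sqrt t)" using yg by (simp add: w_def sc_def)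
  have \<pi>g: "\<pi> g = M.sc (sqrt t)"
  proof -
    have "\<pi> g * \<pi> w = M.sc (sqrt t)" using gw g(1) wS(1) by (metis hs(5) \<pi>sc)
    then show ?thesis using \<pi>w hs(1)[OF g(1)] by simp
  qed
  \<comment> \<open>Since \<open>b = t (e - y)^2\<close> and \<open>g\<close> inverts
    \<open>e - y\<close>, one has \<open>g * b * g = sc t\<close>. The factor normalises this to the
    unit, and cutting by \<open>P\<close> replaces \<open>b\<close> by \<open>a\<close>.\<close>
  define G where "G = complex_of_real (1 / sqrt t) *\<^sub>C (P * g)"
  show ?thesis
  proof (rule that[of P G])
    show "G \<in> S" using P g by (simp add: G_def)
    show "adj G = G" using P g Pg by (simp add: G_def)
    show "P * G = G" using P by (simp add: G_def flip: mult.assoc)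
    have PgP: "P * g * P = P * g" using P(3) by (simp add: Pg mult.assoc)
    then show "G * P = G" by (simp add: G_def)
    have "(P * g) * a * (P * g) = P * g * (a * P) * g" by (simp only: mult.assoc)
    also have "\<dots> = P * g * b * (P * g)" unfolding aP by (simp only: mult.assoc)
    also have "\<dots> = P * (g * b * g) * P" by (subst (2) Pg) (simp only: mult.assoc)
    also have "\<dots> = complex_of_real t *\<^sub>C P" using P by (simp add: gbg)
    finally have "(P * g) * a * (P * g) = complex_of_real t *\<^sub>C P" .
    then have "G * a * G = complex_of_real ((1 / sqrt t) * ((1 / sqrt t) * t)) *\<^sub>C P"
      by (simp only: G_def mult_cscale_left mult_cscale_right cscale_cscale of_real_mult)
    also have "(1 / sqrt t) * ((1 / sqrt t) * t) = 1" using t by (simp add: field_simps)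
    finally show "G * a * G = P" by simp
    have "\<pi> G = complex_of_real (1 / sqrt t) *\<^sub>C (\<pi> P * \<pi> g)" using P(1) g(1) by (simp add: G_def hs)
    also have "\<dots> = M.sc (1 / sqrt t * sqrt t)"
      by (simp only: \<pi>P \<pi>g M.e_left M.sc_mem M.cscale_sc)
    also have "1 / sqrt t * sqrt t = 1" using t by simp
    finally show "\<pi> G = \<epsilon>" by (simp add: M.sc_1)
  qed (use P \<pi>P in auto)
qed

end

section \<open>Corners cut by a projection\<close>

lemma (in cstar_set) corner_cstar_unital:
  assumes p: "p \<in> S" "p * p = p" "adj p = p"
  shows "cstar_unital {x \<in> S. p * x = x \<and> x * p = x} N p"
proof unfold_locales
  fix f :: "nat \<Rightarrow> 'a"
  assume f: "\<And>k. f k \<in> {x \<in> S. p * x = x \<and> x * p = x}"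
    and "\<And>e. e > 0 \<Longrightarrow> \<exists>M. \<forall>m\<ge>M. \<forall>k\<ge>M. N (f m - f k) < e"
  then obtain x where x: "x \<in> S" and lim: "(\<lambda>k. N (f k - x)) \<longlonglongrightarrow> 0"
    using complete[of f] by blast
  have fS: "f k \<in> S" "p * f k = f k" "f k * p = f k" for k using f by auto
  have "p * x = x"
    using limit_unique[of f "p * x" x] limit_mult_left[OF fS(1) x p(1) lim] x lim p by (simp add: fS)
  moreover have "x * p = x"
    using limit_unique[of f "x * p" x] limit_mult_right[OF fS(1) x p(1) lim] x lim p by (simp add: fS)
  ultimately show "\<exists>x\<in>{x \<in> S. p * x = x \<and> x * p = x}. (\<lambda>k. N (f k - x)) \<longlonglongrightarrow> 0"
    using x lim by blast
next
  fix x assume "x \<in> {x \<in> S. p * x = x \<and> x * p = x}"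
  then have x: "x \<in> S" "p * x = x" "x * p = x" by auto
  then have "adj x * p = adj x" "p * adj x = adj x"
    by (metis adj_mult p(3), metis adj_mult p(3))
  then show "adj x \<in> {x \<in> S. p * x = x \<and> x * p = x}" using x by simp
next
  fix x y assume "x \<in> {x \<in> S. p * x = x \<and> x * p = x}" "y \<in> {x \<in> S. p * x = x \<and> x * p = x}"
  then have x: "x \<in> S" "p * x = x" "x * p = x" and y: "y \<in> S" "p * y = y" "y * p = y" by auto
  then show "x * y \<in> {x \<in> S. p * x = x \<and> x * p = x}"
    by (simp add: mult.assoc) (metis mult.assoc)
qed (auto simp: p distrib_left distrib_right N_eq_0_iff N_triangle N_cscale N_mult N_adj_mult)

text \<open>The estimate behind the closedness of corners in the weak* topology: orthogonal summands obey
  Pythagoras' inequality, whereas \<open>x + t (x - p x)\<close> has \<open>(1 - p)\<close>-part \<open>(1 + t) (x - p x)\<close>.\<close>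

context cstar_set
begin

lemma N_pythagoras:
  assumes "p \<in> S" "adj p = p" "y \<in> S" "z \<in> S" "p * y = y" "p * z = 0"
  shows "(N (y + z))\<^sup>2 \<le> (N y)\<^sup>2 + (N z)\<^sup>2"
proof -
  have "adj y * p = adj y" by (metis adj_mult assms(2,5))
  then have "adj y * z = 0" by (metis assms(6) mult.assoc mult_zero_right)
  moreover from arg_cong[OF this, of adj] have "adj z * y = 0" by simp
  ultimately have "adj (y + z) * (y + z) = adj y * y + adj z * z" by (simp add: algebra_simps)
  then have "(N (y + z))\<^sup>2 = N (adj y * y + adj z * z)" using N_adj_mult[of "y + z"] assms by simp
  also have "\<dots> \<le> N (adj y * y) + N (adj z * z)" using assms by (intro N_triangle) auto
  finally show ?thesis using assms by (simp add: N_adj_mult)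
qed

text \<open>For \<open>z = y - p * y\<close> one has \<open>adj z * z = adj y * z\<close>, so the
  C*-identity bounds \<open>(N z)^2\<close> by \<open>N y * N z\<close>. This stands in for
  \<open>N (1 - p) \<le> 1\<close> when the carrier has no unit.\<close>

lemma N_complement_le:
  assumes "p \<in> S" "adj p = p" "p * p = p" "y \<in> S"
  shows "N (y - p * y) \<le> N y"
proof -
  let ?z = "y - p * y"
  have "adj ?z * ?z = adj y * ?z"
    using assms by (simp add: algebra_simps) (metis assms(3) mult.assoc)
  then have "(N ?z)\<^sup>2 = N (adj y * ?z)" using N_adj_mult[of ?z] assms by simp
  also have "\<dots> \<le> N y * N ?z" using N_mult[of "adj y" ?z] assms by simp
  finally have le: "N ?z * N ?z \<le> N y * N ?z" by (simp add: power2_eq_square)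
  have "0 \<le> N ?z" "0 \<le> N y" using assms by (auto intro!: N_nonneg)
  then show ?thesis using mult_right_le_imp_le[OF le] by (cases "N ?z = 0") auto
qed

lemma complement_zero_if_pythagoras:
  assumes p: "p \<in> S" "adj p = p" "p * p = p" and x: "x \<in> S"
    and bound: "\<And>t. t \<ge> 0 \<Longrightarrow>
      (N (x + complex_of_real t *\<^sub>C (x - p * x)))\<^sup>2 \<le> K + t\<^sup>2 * (N (x - p * x))\<^sup>2"
  shows "p * x = x"
proof -
  let ?d = "x - p * x"
  have dS: "?d \<in> S" using p x by simp
  have pd: "p * ?d = 0" using p by (simp add: algebra_simps flip: mult.assoc)
  have le: "2 * t * (N ?d)\<^sup>2 \<le> K" if t: "t \<ge> 0" for t
  proof -
    let ?y = "x + complex_of_real t *\<^sub>C ?d"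
    have "?y - p * ?y = ?d + complex_of_real t *\<^sub>C ?d" by (simp add: distrib_left pd)
    also have "\<dots> = complex_of_real (1 + t) *\<^sub>C ?d" by (simp add: cscale.scale_left_distrib)
    finally have "(1 + t) * N ?d = N (?y - p * ?y)" using dS t by (simp add: N_cscale del: of_real_add)
    also have "\<dots> \<le> N ?y" using p x by (intro N_complement_le) auto
    finally have "((1 + t) * N ?d)\<^sup>2 \<le> (N ?y)\<^sup>2" using t dS by (intro power_mono) auto
    then have "((1 + t) * N ?d)\<^sup>2 \<le> K + t\<^sup>2 * (N ?d)\<^sup>2" using bound[OF t] by simp
    moreover have "((1 + t) * N ?d)\<^sup>2 = (N ?d)\<^sup>2 + 2 * t * (N ?d)\<^sup>2 + t\<^sup>2 * (N ?d)\<^sup>2"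
      by (simp add: power2_eq_square algebra_simps)
    moreover have "0 \<le> (N ?d)\<^sup>2" by simp
    ultimately show ?thesis by linarith
  qed
  have "N ?d = 0"
  proof (rule ccontr)
    assume "N ?d \<noteq> 0"
    then have D: "(N ?d)\<^sup>2 > 0" by simp
    have K: "K \<ge> 0" using le[of 0] by simp
    \<comment> \<open>The estimate \<open>2 t (N ?d)^2 \<le> K\<close> holds for all
      \<open>t \<ge> 0\<close>; the chosen \<open>t\<close> turns its left side into
      \<open>2 (K + 1)\<close>.\<close>
    have "2 * (K + 1) = 2 * ((K + 1) / (N ?d)\<^sup>2) * (N ?d)\<^sup>2" using D by simp
    also have "\<dots> \<le> K" using K D by (intro le) simp
    finally show False using K by simp
  qed
  then show ?thesis using N_eq_0_iff[OF dS] by simp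
qed

end

subsection \<open>The ambient product of all C*-algebras on a type\<close>

lemma czero_mem: "cstar_algebra B \<Longrightarrow> czero B \<in> cset B"
  by (simp add: cstar_algebra_def)

text \<open>All C*-algebras on a type \<open>'a\<close> are embedded as coordinates of a single type, their product.
  Algebraic identities in any of them can then be proved by type class reasoning.\<close>

typedef 'a ambient = "{F :: 'a calg \<Rightarrow> 'a. \<forall>B. if cstar_algebra B then F B \<in> cset B else F B = undefined}"
  morphisms coord Ambient
proof
  show "(\<lambda>B. if cstar_algebra B then czero B else undefined) \<in>
    {F. \<forall>B. if cstar_algebra B then F B \<in> cset B else F B = undefined}"
    by (simp add: czero_mem)
qed

setup_lifting type_definition_ambient

lemma coord_mem: "cstar_algebra B \<Longrightarrow> coord F B \<in> cset B"
  using coord[of F] by auto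

lemma ambient_eqI:
  assumes "\<And>B. cstar_algebra B \<Longrightarrow> coord F B = coord G B"
  shows "F = G"
proof -
  have "coord F B = coord G B" for B
    using assms coord[of F] coord[of G] by (cases "cstar_algebra B") auto
  then show ?thesis by (simp add: coord_inject[symmetric] fun_eq_iff)
qed

lemma cset_closed:
  assumes "cstar_algebra B"
  shows "czero B \<in> cset B" "x \<in> cset B \<Longrightarrow> csmult B c x \<in> cset B"
    "x \<in> cset B \<Longrightarrow> cstar B x \<in> cset B"
    "x \<in> cset B \<Longrightarrow> y \<in> cset B \<Longrightarrow> cadd B x y \<in> cset B"
    "x \<in> cset B \<Longrightarrow> y \<in> cset B \<Longrightarrow> cmult B x y \<in> cset B"
  using assms by (simp_all add: cstar_algebra_def)

lemma cstar_algebra_add: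
  assumes "cstar_algebra B" "x \<in> cset B" "y \<in> cset B" "z \<in> cset B"
  shows "cadd B (cadd B x y) z = cadd B x (cadd B y z)" "cadd B x y = cadd B y x"
    "cadd B (czero B) x = x" "csmult B 1 x = x" "csmult B 0 x = czero B"
    "csmult B a (csmult B b x) = csmult B (a * b) x"
    "csmult B (a + b) x = cadd B (csmult B a x) (csmult B b x)"
    "csmult B a (cadd B x y) = cadd B (csmult B a x) (csmult B a y)"
  using assms(1) unfolding cstar_algebra_def by (elim conjE, metis assms(2-))+

lemma cstar_algebra_mult:
  assumes "cstar_algebra B" "x \<in> cset B" "y \<in> cset B" "z \<in> cset B"
  shows "cmult B (cmult B x y) z = cmult B x (cmult B y z)"
    "cmult B (cadd B x y) z = cadd B (cmult B x z) (cmult B y z)"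
    "cmult B x (cadd B y z) = cadd B (cmult B x y) (cmult B x z)"
    "cmult B (csmult B a x) y = csmult B a (cmult B x y)"
    "cmult B x (csmult B a y) = csmult B a (cmult B x y)"
    "cstar B (cstar B x) = x" "cstar B (cadd B x y) = cadd B (cstar B x) (cstar B y)"
    "cstar B (csmult B a x) = csmult B (cnj a) (cstar B x)"
    "cstar B (cmult B x y) = cmult B (cstar B y) (cstar B x)"
  using assms(1) unfolding cstar_algebra_def by (elim conjE, metis assms(2-))+

lemma cstar_algebra_norm:
  assumes "cstar_algebra B" "x \<in> cset B" "y \<in> cset B"
  shows "cnorm B x = 0 \<longleftrightarrow> x = czero B" "cnorm B (cadd B x y) \<le> cnorm B x + cnorm B y"
    "cnorm B (csmult B a x) = cmod a * cnorm B x" "cnorm B (cmult B x y) \<le> cnorm B x * cnorm B y"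
    "cnorm B (cmult B (cstar B x) x) = (cnorm B x)\<^sup>2"
  using assms(1) unfolding cstar_algebra_def by (elim conjE, metis assms(2-))+

lemma cstar_algebra_complete:
  assumes "cstar_algebra B" "\<And>k. f k \<in> cset B"
    "\<And>e. e > 0 \<Longrightarrow> \<exists>N. \<forall>m\<ge>N. \<forall>k\<ge>N. cnorm B (csub B (f m) (f k)) < e"
  shows "\<exists>x\<in>cset B. (\<lambda>k. cnorm B (csub B (f k) x)) \<longlonglongrightarrow> 0"
  using assms(2-) assms(1)[unfolded cstar_algebra_def] by metis

instantiation ambient :: (type) star_algebra
begin

lift_definition zero_ambient :: "'a ambient" is
  "\<lambda>B. if cstar_algebra B then czero B else undefined"
  by (auto intro: cset_closed)

lift_definition plus_ambient :: "'a ambient \<Rightarrow> 'a ambient \<Rightarrow> 'a ambient" is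
  "\<lambda>F G B. if cstar_algebra B then cadd B (F B) (G B) else undefined"
  by (auto intro: cset_closed)

lift_definition times_ambient :: "'a ambient \<Rightarrow> 'a ambient \<Rightarrow> 'a ambient" is
  "\<lambda>F G B. if cstar_algebra B then cmult B (F B) (G B) else undefined"
  by (auto intro: cset_closed)

lift_definition cscale_ambient :: "complex \<Rightarrow> 'a ambient \<Rightarrow> 'a ambient" is
  "\<lambda>c F B. if cstar_algebra B then csmult B c (F B) else undefined"
  by (auto intro: cset_closed)

lift_definition adj_ambient :: "'a ambient \<Rightarrow> 'a ambient" is
  "\<lambda>F B. if cstar_algebra B then cstar B (F B) else undefined"
  by (auto intro: cset_closed)

definition uminus_ambient :: "'a ambient \<Rightarrow> 'a ambient" where
  "uminus_ambient F = (-1) *\<^sub>C F"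

definition minus_ambient :: "'a ambient \<Rightarrow> 'a ambient \<Rightarrow> 'a ambient" where
  "minus_ambient F G = F + (-1) *\<^sub>C G"

lemma coord_simps:
  assumes "cstar_algebra B"
  shows "coord 0 B = czero B" "coord (F + G) B = cadd B (coord F B) (coord G B)"
    "coord (F * G) B = cmult B (coord F B) (coord G B)"
    "coord (c *\<^sub>C F) B = csmult B c (coord F B)" "coord (adj F) B = cstar B (coord F B)"
  using assms by (transfer; simp)+

instance
proof
  fix F G H :: "'a ambient" and c d :: complex
  note [simp] = coord_simps coord_mem and [intro] = ambient_eqI
  have add_comm: "F + G = G + F" for F G :: "'a ambient"
    by (rule ambient_eqI) (simp add: cstar_algebra_add(2)[OF _ coord_mem coord_mem coord_mem])
  show "F + G + H = F + (G + H)"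
    by (rule ambient_eqI) (simp add: cstar_algebra_add(1)[OF _ coord_mem coord_mem coord_mem])
  show "F + G = G + F" by (rule add_comm)
  show "0 + F = F"
    by (rule ambient_eqI) (simp add: cstar_algebra_add(3)[OF _ coord_mem coord_mem coord_mem])
  show one: "1 *\<^sub>C F = F" for F :: "'a ambient"
    by (rule ambient_eqI) (simp add: cstar_algebra_add(4)[OF _ coord_mem coord_mem coord_mem])
  show add_left: "(c + d) *\<^sub>C F = c *\<^sub>C F + d *\<^sub>C F" for c d and F :: "'a ambient"
    by (rule ambient_eqI) (simp add: cstar_algebra_add(7)[OF _ coord_mem coord_mem coord_mem])
  have zero: "0 *\<^sub>C F = 0"
    by (rule ambient_eqI) (simp add: cstar_algebra_add(5)[OF _ coord_mem coord_mem coord_mem])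
  show "- F + F = 0"
    using add_left[of "-1" 1 F] by (simp add: uminus_ambient_def zero one)
  show "F - G = F + - G" by (simp add: minus_ambient_def uminus_ambient_def)
  show "F * G * H = F * (G * H)"
    by (rule ambient_eqI) (simp add: cstar_algebra_mult(1)[OF _ coord_mem coord_mem coord_mem])
  show "(F + G) * H = F * H + G * H"
    by (rule ambient_eqI) (simp add: cstar_algebra_mult(2)[OF _ coord_mem coord_mem coord_mem])
  show "F * (G + H) = F * G + F * H"
    by (rule ambient_eqI) (simp add: cstar_algebra_mult(3)[OF _ coord_mem coord_mem coord_mem])
  show "c *\<^sub>C (F + G) = c *\<^sub>C F + c *\<^sub>C G"
    by (rule ambient_eqI) (simp add: cstar_algebra_add(8)[OF _ coord_mem coord_mem coord_mem])
  show "c *\<^sub>C d *\<^sub>C F = (c * d) *\<^sub>C F"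
    by (rule ambient_eqI) (simp add: cstar_algebra_add(6)[OF _ coord_mem coord_mem coord_mem])
  show "(c *\<^sub>C F) * G = c *\<^sub>C (F * G)"
    by (rule ambient_eqI) (simp add: cstar_algebra_mult(4)[OF _ coord_mem coord_mem coord_mem])
  show "F * (c *\<^sub>C G) = c *\<^sub>C (F * G)"
    by (rule ambient_eqI) (simp add: cstar_algebra_mult(5)[OF _ coord_mem coord_mem coord_mem])
  show "adj (adj F) = F"
    by (rule ambient_eqI) (simp add: cstar_algebra_mult(6)[OF _ coord_mem coord_mem coord_mem])
  show "adj (F + G) = adj F + adj G"
    by (rule ambient_eqI) (simp add: cstar_algebra_mult(7)[OF _ coord_mem coord_mem coord_mem])
  show "adj (c *\<^sub>C F) = cnj c *\<^sub>C adj F"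
    by (rule ambient_eqI) (simp add: cstar_algebra_mult(8)[OF _ coord_mem coord_mem coord_mem])
  show "adj (F * G) = adj G * adj F"
    by (rule ambient_eqI) (simp add: cstar_algebra_mult(9)[OF _ coord_mem coord_mem coord_mem])
qed

end

text \<open>With 0 in all coordinates other than \<open>B\<close>, sums, products and adjoints are
  respected, and \<open>B\<close> becomes one factor of the product. Arguments outside the carrier
  go to 0 so that the result is always a legitimate family.\<close>

lift_definition emb :: "'a calg \<Rightarrow> 'a \<Rightarrow> 'a ambient" is
  "\<lambda>B x C. if cstar_algebra C then (if C = B \<and> x \<in> cset B then x else czero C) else undefined"
  by (auto intro: cset_closed)

definition carrier_of :: "'a calg \<Rightarrow> 'a ambient set" where
  "carrier_of B = emb B ` cset B"

definition norm_of :: "'a calg \<Rightarrow> 'a ambient \<Rightarrow> real" where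
  "norm_of B F = cnorm B (coord F B)"

locale cstar_record =
  fixes B :: "'a calg"
  assumes cstar: "cstar_algebra B"
begin

lemma coord_emb [simp]: "x \<in> cset B \<Longrightarrow> coord (emb B x) B = x"
  using cstar by transfer simp

lemma coord_emb_other: "cstar_algebra C \<Longrightarrow> C \<noteq> B \<Longrightarrow> coord (emb B x) C = czero C"
  by transfer simp

lemma cset_mem [simp]: "czero B \<in> cset B" "x \<in> cset B \<Longrightarrow> csmult B c x \<in> cset B"
    "x \<in> cset B \<Longrightarrow> cstar B x \<in> cset B"
    "x \<in> cset B \<Longrightarrow> y \<in> cset B \<Longrightarrow> cadd B x y \<in> cset B"
    "x \<in> cset B \<Longrightarrow> y \<in> cset B \<Longrightarrow> cmult B x y \<in> cset B"
    "x \<in> cset B \<Longrightarrow> y \<in> cset B \<Longrightarrow> csub B x y \<in> cset B"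
  using cset_closed[OF cstar] by (simp_all add: csub_def)

lemma emb_mem [simp]: "x \<in> cset B \<Longrightarrow> emb B x \<in> carrier_of B"
  by (simp add: carrier_of_def)

lemma coord_in_cset [simp]: "coord F B \<in> cset B"
  using coord_mem[OF cstar] .

lemma emb_coord [simp]: "F \<in> carrier_of B \<Longrightarrow> emb B (coord F B) = F"
  by (auto simp: carrier_of_def)

lemma emb_inject: "x \<in> cset B \<Longrightarrow> y \<in> cset B \<Longrightarrow> emb B x = emb B y \<longleftrightarrow> x = y"
  using coord_emb by metis

lemma norm_of_emb [simp]: "x \<in> cset B \<Longrightarrow> norm_of B (emb B x) = cnorm B x"
  by (simp add: norm_of_def)

lemma emb_simps:
  "emb B (czero B) = 0"
  "x \<in> cset B \<Longrightarrow> emb B (csmult B c x) = c *\<^sub>C emb B x"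
  "x \<in> cset B \<Longrightarrow> emb B (cstar B x) = adj (emb B x)"
  "x \<in> cset B \<Longrightarrow> y \<in> cset B \<Longrightarrow> emb B (cadd B x y) = emb B x + emb B y"
  "x \<in> cset B \<Longrightarrow> y \<in> cset B \<Longrightarrow> emb B (cmult B x y) = emb B x * emb B y"
proof -
  have zero: "csmult C c (czero C) = czero C" "cstar C (czero C) = czero C"
    "cadd C (czero C) (czero C) = czero C" "cmult C (czero C) (czero C) = czero C"
    if C: "cstar_algebra C" for C :: "'a calg" and c
  proof -
    have z: "czero C = csmult C 0 (czero C)" using cstar_algebra_add(5)[OF C] cset_closed[OF C] by metis
    have m: "czero C \<in> cset C" using cset_closed[OF C] by simp
    show "csmult C c (czero C) = czero C" using cstar_algebra_add(6)[OF C m m m, of c 0] z by simp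
    show "cstar C (czero C) = czero C"
      using cstar_algebra_mult(8)[OF C m m m, of 0] cstar_algebra_add(5)[OF C _ m m, of "cstar C (czero C)"]
        z cset_closed(3)[OF C m] by simp
    show "cadd C (czero C) (czero C) = czero C" using cstar_algebra_add(3)[OF C m m m] .
    show "cmult C (czero C) (czero C) = czero C"
      using cstar_algebra_mult(4)[OF C m m m, of 0] cstar_algebra_add(5)[OF C _ m m, of "cmult C (czero C) (czero C)"]
        z cset_closed(5)[OF C m m] by simp
  qed
  have *: "F = G" if "coord F B = coord G B" "\<And>C. cstar_algebra C \<Longrightarrow> C \<noteq> B \<Longrightarrow> coord F C = coord G C"
    for F G :: "'a ambient" using that by (metis ambient_eqI)
  show "emb B (czero B) = 0"
    by (rule *) (auto simp: coord_simps cstar coord_emb_other zero)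
  show "x \<in> cset B \<Longrightarrow> emb B (csmult B c x) = c *\<^sub>C emb B x"
    by (rule *) (auto simp: coord_simps cstar coord_emb_other zero)
  show "x \<in> cset B \<Longrightarrow> emb B (cstar B x) = adj (emb B x)"
    by (rule *) (auto simp: coord_simps cstar coord_emb_other zero)
  show "x \<in> cset B \<Longrightarrow> y \<in> cset B \<Longrightarrow> emb B (cadd B x y) = emb B x + emb B y"
    by (rule *) (auto simp: coord_simps cstar coord_emb_other zero)
  show "x \<in> cset B \<Longrightarrow> y \<in> cset B \<Longrightarrow> emb B (cmult B x y) = emb B x * emb B y"
    by (rule *) (auto simp: coord_simps cstar coord_emb_other zero)
qed

lemma emb_csub: "x \<in> cset B \<Longrightarrow> y \<in> cset B \<Longrightarrow> emb B (csub B x y) = emb B x - emb B y"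
  by (simp add: csub_def emb_simps)

lemma emb_csum:
  assumes "\<And>k. k < n \<Longrightarrow> f k \<in> cset B"
  shows "csum B f n \<in> cset B \<and> emb B (csum B f n) = (\<Sum>k<n. emb B (f k))"
  using assms by (induction n) (auto simp: emb_simps)

sublocale cstar_set "carrier_of B" "norm_of B"
proof unfold_locales
  fix f :: "nat \<Rightarrow> 'a ambient"
  assume f: "\<And>k. f k \<in> carrier_of B"
    and cauchy: "\<And>e. e > 0 \<Longrightarrow> \<exists>M. \<forall>m\<ge>M. \<forall>k\<ge>M. norm_of B (f m - f k) < e"
  define g where "g k = coord (f k) B" for k
  have g: "g k \<in> cset B" "f k = emb B (g k)" for k using f by (simp_all add: g_def)
  have sub: "norm_of B (f m - emb B x) = cnorm B (csub B (g m) x)" if "x \<in> cset B" for m x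
    using that g(1) by (simp add: g(2) emb_csub[symmetric])
  have "norm_of B (f m - f k) = cnorm B (csub B (g m) (g k))" for m k
    by (subst g(2)[of k]) (rule sub[OF g(1)])
  with cauchy have "\<exists>M. \<forall>m\<ge>M. \<forall>k\<ge>M. cnorm B (csub B (g m) (g k)) < e" if "e > 0" for e
    using that by simp
  then obtain x where "x \<in> cset B" "(\<lambda>k. cnorm B (csub B (g k) x)) \<longlonglongrightarrow> 0"
    using cstar_algebra_complete[OF cstar, of g] g(1) by blast
  then show "\<exists>x\<in>carrier_of B. (\<lambda>k. norm_of B (f k - x)) \<longlonglongrightarrow> 0"
    using sub by (intro bexI[of _ "emb B x"]) auto
next
  show "0 \<in> carrier_of B" using emb_mem[of "czero B"] by (simp add: emb_simps)
qed (auto simp: carrier_of_def emb_simps[symmetric] cstar_algebra_norm[OF cstar]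
    cstar_algebra_norm(1)[OF cstar cset_mem(1) cset_mem(1)] emb_inject)

end

subsection \<open>Preduals and corners of W*-algebras\<close>

text \<open>Ball-intersection form of weak* compactness; it is all that is used of weak* limits.\<close>

definition (in cstar_set) has_cluster_points :: bool where
  "has_cluster_points \<longleftrightarrow> (\<forall>u :: nat \<Rightarrow> 'a. \<forall>C. (\<forall>n. u n \<in> S \<and> N (u n) \<le> C) \<longrightarrow>
    (\<exists>x\<in>S. \<forall>y\<in>S. \<forall>r. (\<forall>\<^sub>F n in sequentially. N (u n - y) \<le> r) \<longrightarrow> N (x - y) \<le> r))"

text \<open>The point is that a cluster point \<open>x\<close> of a sequence in the corner can be
  found in the corner. By Pythagoras all \<open>u n + t (x - p x)\<close> obey one norm bound, a
  ball condition that \<open>x\<close> inherits, and \<open>complement_zero_if_pythagoras\<close>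
  gives \<open>p x = x\<close>. The other side follows by passing to adjoints.\<close>

lemma (in cstar_set) corner_wstar_unital:
  assumes cl: has_cluster_points and p: "p \<in> S" "p * p = p" "adj p = p"
  shows "wstar_unital {x \<in> S. p * x = x \<and> x * p = x} N p"
proof -
  let ?S = "{x \<in> S. p * x = x \<and> x * p = x}"
  have "\<exists>x\<in>?S. \<forall>y\<in>?S. \<forall>r. (\<forall>\<^sub>F n in sequentially. N (u n - y) \<le> r) \<longrightarrow> N (x - y) \<le> r"
    if u: "\<And>n. u n \<in> ?S" and C: "\<And>n. N (u n) \<le> C" for u :: "nat \<Rightarrow> 'a" and C
  proof -
    have u': "u n \<in> S" "p * u n = u n" "u n * p = u n" for n using u[of n] by auto
    obtain x where x: "x \<in> S"
      and ball: "\<And>y r. y \<in> S \<Longrightarrow> \<forall>\<^sub>F n in sequentially. N (u n - y) \<le> r \<Longrightarrow> N (x - y) \<le> r"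
      using cl u'(1) C unfolding has_cluster_points_def by metis
    have C0: "0 \<le> C" using N_nonneg[OF u'(1)] C by (rule order_trans)
    have ball': "(N (x + z))\<^sup>2 \<le> r" if z: "z \<in> S" and r: "\<And>n. (N (u n + z))\<^sup>2 \<le> r" for z r
    proof -
      have "N (u n - (- z)) \<le> sqrt r" for n using real_le_rsqrt[OF r] by simp
      then have "N (x - (- z)) \<le> sqrt r" using z by (intro ball) auto
      moreover have "0 \<le> r" using r[of 0] zero_le_power2 order_trans by blast
      ultimately show ?thesis
        using power_mono[of "N (x + z)" "sqrt r" 2] x z by simp
    qed
    have CC: "(N (u n))\<^sup>2 \<le> C\<^sup>2" for n using C u'(1) by (intro power_mono) auto
    have px: "p * x = x"
    proof (rule complement_zero_if_pythagoras[OF p(1,3,2) x])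
      fix t :: real
      let ?z = "complex_of_real t *\<^sub>C (x - p * x)"
      have "p * (x - p * x) = 0" using p by (simp add: algebra_simps flip: mult.assoc)
      then have "(N (u n + ?z))\<^sup>2 \<le> (N (u n))\<^sup>2 + (N ?z)\<^sup>2" for n
        using p x u' by (intro N_pythagoras[of p]) auto
      then have "(N (u n + ?z))\<^sup>2 \<le> C\<^sup>2 + t\<^sup>2 * (N (x - p * x))\<^sup>2" for n
        using CC[of n] x p by (fastforce simp: N_cscale power_mult_distrib intro: order_trans)
      then show "(N (x + ?z))\<^sup>2 \<le> C\<^sup>2 + t\<^sup>2 * (N (x - p * x))\<^sup>2" using x p by (intro ball') auto
    qed
    have "p * adj x = adj x"
    proof (rule complement_zero_if_pythagoras[OF p(1,3,2) adj_mem[OF x]])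
      fix t :: real
      let ?d = "adj x - p * adj x"
      let ?z = "complex_of_real t *\<^sub>C ?d"
      have "p * ?d = 0" using p by (simp add: algebra_simps flip: mult.assoc)
      moreover have "p * adj (u n) = adj (u n)" for n
        using arg_cong[OF u'(3), of adj] p by simp
      ultimately have "(N (adj (u n) + ?z))\<^sup>2 \<le> (N (adj (u n)))\<^sup>2 + (N ?z)\<^sup>2" for n
        using p x u' by (intro N_pythagoras[of p]) auto
      moreover have "N (adj (u n) + ?z) = N (u n + adj ?z)" for n
        using N_adj[of "adj (u n) + ?z"] x p u' by simp
      ultimately have "(N (u n + adj ?z))\<^sup>2 \<le> C\<^sup>2 + t\<^sup>2 * (N ?d)\<^sup>2" for n
        using CC[of n] x p u'(1)[of n] by (fastforce simp: N_cscale power_mult_distrib intro: order_trans)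
      then have "(N (x + adj ?z))\<^sup>2 \<le> C\<^sup>2 + t\<^sup>2 * (N ?d)\<^sup>2" using x p by (intro ball') auto
      then show "(N (adj x + ?z))\<^sup>2 \<le> C\<^sup>2 + t\<^sup>2 * (N ?d)\<^sup>2"
        using N_adj[of "adj x + ?z"] x p by simp
    qed
    then have "x * p = x" using adj_mult[of p "adj x"] p by simp
    then show ?thesis using x px ball by (intro bexI[of _ x]) auto
  qed
  then show ?thesis
    using corner_cstar_unital[OF p] unfolding wstar_unital_def wstar_unital_axioms_def by blast
qed

text \<open>Phrased with filters because the product space it is applied to is in general not
  metrizable, so no convergent subsequence can be expected.\<close>

lemma compact_sequence_cluster_point:
  fixes g :: "nat \<Rightarrow> 'x::topological_space"
  assumes "compact K" "\<And>n. g n \<in> K"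
  obtains l where "l \<in> K" "\<And>T. closed T \<Longrightarrow> \<forall>\<^sub>F n in sequentially. g n \<in> T \<Longrightarrow> l \<in> T"
proof -
  have "filtermap g sequentially \<noteq> bot" by (simp add: filtermap_bot_iff)
  moreover have "\<forall>\<^sub>F x in filtermap g sequentially. x \<in> K" using assms(2) by (simp add: eventually_filtermap)
  ultimately obtain l where l: "l \<in> K" "inf (nhds l) (filtermap g sequentially) \<noteq> bot"
    using assms(1) unfolding compact_filter by blast
  have "l \<in> T" if "closed T" "\<forall>\<^sub>F n in sequentially. g n \<in> T" for T
  proof (rule ccontr)
    assume "l \<notin> T"
    then have "\<forall>\<^sub>F x in nhds l. x \<notin> T"
      using that(1) eventually_nhds_in_open[of "- T" l] by (simp add: open_Compl)
    moreover have "\<forall>\<^sub>F x in filtermap g sequentially. x \<in> T" using that(2) by (simp add: eventually_filtermap)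
    ultimately have "\<forall>\<^sub>F x in inf (nhds l) (filtermap g sequentially). False"
      unfolding eventually_inf by blast
    then show False using l(2) by (simp add: eventually_False)
  qed
  then show ?thesis using that l(1) by blast
qed

definition predual :: "'a calg \<Rightarrow> ('a \<Rightarrow> complex) set \<Rightarrow> bool" where
  "predual A F \<longleftrightarrow> F \<subseteq> dual_space A \<and> (\<lambda>_. 0) \<in> F \<and>
        (\<forall>f\<in>F. \<forall>g\<in>F. (\<lambda>x. f x + g x) \<in> F) \<and>
        (\<forall>c. \<forall>f\<in>F. (\<lambda>x. c * f x) \<in> F) \<and>
        (\<forall>s :: nat \<Rightarrow> 'a \<Rightarrow> complex. \<forall>f\<in>dual_space A. (\<forall>k. s k \<in> F) \<longrightarrow>
            (\<lambda>k. dual_norm A (\<lambda>x. s k x - f x)) \<longlonglongrightarrow> 0 \<longrightarrow> f \<in> F) \<and>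
        (\<forall>x\<in>cset A. cnorm A x = (SUP f\<in>{f\<in>F. dual_norm A f \<le> 1}. cmod (f x))) \<and>
        (\<forall>g :: ('a \<Rightarrow> complex) \<Rightarrow> complex.
            (\<forall>f\<in>F. \<forall>h\<in>F. g (\<lambda>x. f x + h x) = g f + g h) \<longrightarrow>
            (\<forall>c. \<forall>f\<in>F. g (\<lambda>x. c * f x) = c * g f) \<longrightarrow>
            (\<exists>K. \<forall>f\<in>F. cmod (g f) \<le> K * dual_norm A f) \<longrightarrow>
            (\<exists>!x\<in>cset A. \<forall>f\<in>F. g f = f x))"

lemma predual_represents:
  assumes "predual A F"
    and "\<And>f h. f \<in> F \<Longrightarrow> h \<in> F \<Longrightarrow> g (\<lambda>x. f x + h x) = g f + g h"
    and "\<And>c f. f \<in> F \<Longrightarrow> g (\<lambda>x. c * f x) = c * g f"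
    and "\<And>f. f \<in> F \<Longrightarrow> cmod (g f) \<le> K * dual_norm A f"
  shows "\<exists>!x\<in>cset A. \<forall>f\<in>F. g f = f x"
  using assms unfolding predual_def by blast

lemma wstar_algebra_iff_predual: "wstar_algebra A \<longleftrightarrow> cstar_algebra A \<and> (\<exists>F. predual A F)"
  unfolding wstar_algebra_def predual_def ..

context cstar_record
begin

lemma dual_spaceD:
  assumes "f \<in> dual_space B"
  shows "x \<in> cset B \<Longrightarrow> y \<in> cset B \<Longrightarrow> f (cadd B x y) = f x + f y"
    "x \<in> cset B \<Longrightarrow> f (csmult B c x) = c * f x"
    "x \<notin> cset B \<Longrightarrow> f x = 0"
    "x \<in> cset B \<Longrightarrow> y \<in> cset B \<Longrightarrow> f (csub B x y) = f x - f y"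
  using assms by (auto simp: dual_space_def csub_def)

lemma cnorm_nonneg [simp]: "x \<in> cset B \<Longrightarrow> 0 \<le> cnorm B x"
  using N_nonneg[of "emb B x"] by simp

lemma cnorm_czero [simp]: "cnorm B (czero B) = 0"
  using cstar_algebra_norm(1)[OF cstar cset_mem(1) cset_mem(1)] by simp

lemma cnorm_csmult: "x \<in> cset B \<Longrightarrow> cnorm B (csmult B c x) = cmod c * cnorm B x"
  using cstar_algebra_norm(3)[OF cstar] by blast

lemma dual_norm_le:
  assumes "\<And>x. x \<in> cset B \<Longrightarrow> cnorm B x \<le> 1 \<Longrightarrow> cmod (f x) \<le> C"
  shows "dual_norm B f \<le> C"
  unfolding dual_norm_def
proof (rule cSUP_least)
  show "{x \<in> cset B. cnorm B x \<le> 1} \<noteq> {}" using cset_mem(1) by fastforce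
qed (use assms in auto)

lemma cmod_le_dual_norm_unit:
  assumes f: "f \<in> dual_space B" and x: "x \<in> cset B" "cnorm B x \<le> 1"
  shows "cmod (f x) \<le> dual_norm B f"
proof -
  obtain K where K: "\<And>x. x \<in> cset B \<Longrightarrow> cmod (f x) \<le> K * cnorm B x"
    using f unfolding dual_space_def by blast
  have "cmod (f y) \<le> \<bar>K\<bar>" if "y \<in> cset B" "cnorm B y \<le> 1" for y
  proof -
    have "K * cnorm B y \<le> \<bar>K\<bar> * 1" using that by (intro mult_mono) auto
    then show ?thesis using K[OF that(1)] by simp
  qed
  then have "bdd_above ((\<lambda>x. cmod (f x)) ` {x \<in> cset B. cnorm B x \<le> 1})" by (intro bdd_aboveI2) auto
  then show ?thesis unfolding dual_norm_def using x by (intro cSUP_upper) auto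
qed

lemma dual_norm_nonneg: "f \<in> dual_space B \<Longrightarrow> 0 \<le> dual_norm B f"
  using cmod_le_dual_norm_unit[of f "czero B"] order_trans[OF norm_ge_zero] by auto

lemma cmod_le_dual_norm:
  assumes f: "f \<in> dual_space B" and x: "x \<in> cset B"
  shows "cmod (f x) \<le> dual_norm B f * cnorm B x"
proof (cases "cnorm B x = 0")
  case True
  then have "x = czero B" using cstar_algebra_norm(1)[OF cstar x x] by simp
  moreover have "csmult B 0 x = czero B" using cstar_algebra_add(5)[OF cstar x x x] .
  ultimately have "f x = 0" using dual_spaceD(2)[OF f x, of 0] by simp
  then show ?thesis using True by simp
next
  case False
  then have n: "cnorm B x > 0" using x cnorm_nonneg by (simp add: order_less_le)
  let ?y = "csmult B (complex_of_real (1 / cnorm B x)) x"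
  have "cmod (f ?y) \<le> dual_norm B f"
    using x n by (intro cmod_le_dual_norm_unit f) (simp_all add: cnorm_csmult norm_divide)
  moreover have "cmod (f ?y) = cmod (f x) / cnorm B x"
    using n dual_spaceD(2)[OF f x] by (simp add: norm_mult norm_divide)
  ultimately show ?thesis using n by (metis pos_divide_le_eq)
qed

lemma dual_space_add:
  assumes f: "f \<in> dual_space B" and g: "g \<in> dual_space B"
  shows "(\<lambda>x. f x + g x) \<in> dual_space B"
proof -
  have "cmod (f x + g x) \<le> (dual_norm B f + dual_norm B g) * cnorm B x" if "x \<in> cset B" for x
    using cmod_le_dual_norm[OF f that] cmod_le_dual_norm[OF g that] norm_triangle_ineq[of "f x" "g x"]
    by (simp add: distrib_right)
  then show ?thesis
    unfolding dual_space_def mem_Collect_eq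
    by (intro conjI ballI allI impI exI[of _ "dual_norm B f + dual_norm B g"])
      (simp_all add: dual_spaceD(1-3)[OF f] dual_spaceD(1-3)[OF g] distrib_left add_ac)
qed

lemma dual_space_scale:
  assumes f: "f \<in> dual_space B"
  shows "(\<lambda>x. c * f x) \<in> dual_space B"
proof -
  have "cmod (c * f x) \<le> (cmod c * dual_norm B f) * cnorm B x" if "x \<in> cset B" for x
    using cmod_le_dual_norm[OF f that] by (simp add: norm_mult mult.assoc mult_left_mono)
  then show ?thesis
    unfolding dual_space_def mem_Collect_eq
    by (intro conjI ballI allI impI exI[of _ "cmod c * dual_norm B f"])
      (simp_all add: dual_spaceD(1-3)[OF f] distrib_left mult_ac)
qed

lemma dual_space_diff:
  assumes "f \<in> dual_space B" "g \<in> dual_space B"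
  shows "(\<lambda>x. f x - g x) \<in> dual_space B"
  using dual_space_add[OF assms(1) dual_space_scale[OF assms(2), of "-1"]] by simp

lemma dual_norm_zero: "dual_norm B (\<lambda>_. 0) \<le> 0"
  by (rule dual_norm_le) simp

lemma dual_norm_add:
  assumes f: "f \<in> dual_space B" and g: "g \<in> dual_space B"
  shows "dual_norm B (\<lambda>x. f x + g x) \<le> dual_norm B f + dual_norm B g"
proof (rule dual_norm_le)
  fix x assume x: "x \<in> cset B" "cnorm B x \<le> 1"
  show "cmod (f x + g x) \<le> dual_norm B f + dual_norm B g"
    using cmod_le_dual_norm_unit[OF f x] cmod_le_dual_norm_unit[OF g x] norm_triangle_ineq[of "f x" "g x"] by simp
qed

lemma dual_norm_scale:
  assumes f: "f \<in> dual_space B"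
  shows "dual_norm B (\<lambda>x. c * f x) \<le> cmod c * dual_norm B f"
proof (rule dual_norm_le)
  fix x assume x: "x \<in> cset B" "cnorm B x \<le> 1"
  show "cmod (c * f x) \<le> cmod c * dual_norm B f"
    using cmod_le_dual_norm_unit[OF f x] by (simp add: norm_mult mult_left_mono)
qed

lemma cnorm_le_if_predual:
  assumes F: "predual B F" and x: "x \<in> cset B"
    and le: "\<And>f. f \<in> F \<Longrightarrow> dual_norm B f \<le> 1 \<Longrightarrow> cmod (f x) \<le> r"
  shows "cnorm B x \<le> r"
proof -
  have "cnorm B x = (SUP f\<in>{f\<in>F. dual_norm B f \<le> 1}. cmod (f x))"
    using F x by (simp add: predual_def)
  also have "\<dots> \<le> r"
  proof (rule cSUP_least)
    have "(\<lambda>_. 0) \<in> {f \<in> F. dual_norm B f \<le> 1}" using F dual_norm_zero by (auto simp: predual_def)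
    then show "{f \<in> F. dual_norm B f \<le> 1} \<noteq> {}" by blast
  qed (use le in auto)
  finally show ?thesis .
qed

text \<open>Banach-Alaoglu: evaluation at \<open>u n\<close> is a point of a product of discs of
  radius \<open>C * dual_norm B f\<close>, compact by Tychonoff. Linearity and the bounds
  \<open>|l f - f y| \<le> r\<close> are closed conditions, so a cluster point \<open>l\<close> is a
  bounded linear functional on \<open>F\<close>, and the element representing it has the ball
  property.\<close>

lemma has_cluster_points_if_wstar:
  assumes "wstar_algebra B"
  shows has_cluster_points
proof -
  obtain F where F: "predual B F" using assms by (auto simp: wstar_algebra_iff_predual)
  have FD: "f \<in> dual_space B" if "f \<in> F" for f using F that by (auto simp: predual_def)
  have Fadd: "(\<lambda>x. f x + h x) \<in> F" if "f \<in> F" "h \<in> F" for f h using F that by (simp add: predual_def)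
  have Fsc: "(\<lambda>x. c * f x) \<in> F" if "f \<in> F" for f c using F that by (simp add: predual_def)
  have record_level: "\<exists>x\<in>cset B. \<forall>y\<in>cset B. \<forall>r. (\<forall>\<^sub>F n in sequentially. cnorm B (csub B (u n) y) \<le> r) \<longrightarrow> cnorm B (csub B x y) \<le> r"
    if u: "\<And>n. u n \<in> cset B" and C: "\<And>n. cnorm B (u n) \<le> C" for u :: "nat \<Rightarrow> 'a" and C
  proof -
    \<comment> \<open>The factor \<open>{0}\<close> off \<open>F\<close> keeps the product compact
      over the whole function type; \<open>g n\<close> takes the matching value 0 there.\<close>
    define K :: "('a \<Rightarrow> complex) \<Rightarrow> complex set" where "K = (\<lambda>f. if f \<in> F then cball (0::complex) (C * dual_norm B f) else {0})"
    define g where "g n = (\<lambda>f. if f \<in> F then f (u n) else 0)" for n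
    have "compactin (product_topology (\<lambda>_. euclidean) UNIV) (PiE UNIV K)"
      by (subst compactin_PiE) (auto simp: K_def)
    then have cK: "compact (PiE UNIV K)" by (simp add: euclidean_product_topology)
    have gK: "g n \<in> PiE UNIV K" for n
    proof -
      have "cmod (f (u n)) \<le> C * dual_norm B f" if "f \<in> F" for f
        using cmod_le_dual_norm[OF FD[OF that] u[of n]]
          mult_left_mono[OF C[of n] dual_norm_nonneg[OF FD[OF that]]] by (simp add: mult.commute)
      then show ?thesis by (auto simp: g_def K_def PiE_def)
    qed
    obtain l where l: "l \<in> PiE UNIV K"
      and lT: "\<And>T. closed T \<Longrightarrow> \<forall>\<^sub>F n in sequentially. g n \<in> T \<Longrightarrow> l \<in> T"
      using compact_sequence_cluster_point[of "PiE UNIV K" g, OF cK gK] by blast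
    have "l (\<lambda>x. f x + h x) = l f + l h" if fh: "f \<in> F" "h \<in> F" for f h
    proof -
      have "closed {l :: ('a \<Rightarrow> complex) \<Rightarrow> complex. l (\<lambda>x. f x + h x) = l f + l h}"
        by (intro closed_Collect_eq continuous_intros continuous_on_product_coordinates)
      moreover have "g n \<in> {l :: ('a \<Rightarrow> complex) \<Rightarrow> complex. l (\<lambda>x. f x + h x) = l f + l h}" for n
        using fh Fadd by (simp add: g_def)
      ultimately have "l \<in> {l :: ('a \<Rightarrow> complex) \<Rightarrow> complex. l (\<lambda>x. f x + h x) = l f + l h}" by (intro lT) simp_all
      then show ?thesis by simp
    qed
    moreover have "l (\<lambda>x. c * f x) = c * l f" if f: "f \<in> F" for f c
    proof -
      have "closed {l :: ('a \<Rightarrow> complex) \<Rightarrow> complex. l (\<lambda>x. c * f x) = c * l f}"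
        by (intro closed_Collect_eq continuous_intros continuous_on_product_coordinates)
      moreover have "g n \<in> {l :: ('a \<Rightarrow> complex) \<Rightarrow> complex. l (\<lambda>x. c * f x) = c * l f}" for n using f Fsc by (simp add: g_def)
      ultimately have "l \<in> {l :: ('a \<Rightarrow> complex) \<Rightarrow> complex. l (\<lambda>x. c * f x) = c * l f}" by (intro lT) simp_all
      then show ?thesis by simp
    qed
    moreover have "cmod (l f) \<le> C * dual_norm B f" if f: "f \<in> F" for f
    proof -
      have "l f \<in> K f" using l by auto
      then show ?thesis using f by (simp add: K_def)
    qed
    ultimately have "\<exists>!x\<in>cset B. \<forall>f\<in>F. l f = f x"
      using F unfolding predual_def by blast
    then obtain x where x: "x \<in> cset B" "\<And>f. f \<in> F \<Longrightarrow> l f = f x" by blast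
    show ?thesis
    proof (intro bexI[OF _ x(1)] ballI allI impI)
      fix y r assume y: "y \<in> cset B" and ev: "\<forall>\<^sub>F n in sequentially. cnorm B (csub B (u n) y) \<le> r"
      show "cnorm B (csub B x y) \<le> r"
      proof (rule cnorm_le_if_predual[OF F])
        fix f assume f: "f \<in> F" "dual_norm B f \<le> 1"
        have "closed {l :: ('a \<Rightarrow> complex) \<Rightarrow> complex. cmod (l f - f y) \<le> r}"
          by (intro closed_Collect_le continuous_intros continuous_on_product_coordinates)
        moreover have "\<forall>\<^sub>F n in sequentially. g n \<in> {l :: ('a \<Rightarrow> complex) \<Rightarrow> complex. cmod (l f - f y) \<le> r}"
          using ev
        proof eventually_elim
          case (elim n)
          have "cmod (f (csub B (u n) y)) \<le> dual_norm B f * cnorm B (csub B (u n) y)"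
            using u y by (intro cmod_le_dual_norm FD f) auto
          also have "\<dots> \<le> 1 * r" using f elim u y by (intro mult_mono) auto
          finally show ?case using f u y dual_spaceD(4)[OF FD[OF f(1)]] by (simp add: g_def)
        qed
        ultimately have "l \<in> {l :: ('a \<Rightarrow> complex) \<Rightarrow> complex. cmod (l f - f y) \<le> r}" by (rule lT)
        then show "cmod (f (csub B x y)) \<le> r" using f x y dual_spaceD(4)[OF FD[OF f(1)]] by simp
      qed (use x y in auto)
    qed
  qed
  show ?thesis
    unfolding has_cluster_points_def
  proof (intro allI impI)
    fix u :: "nat \<Rightarrow> 'a ambient" and C
    assume u: "\<forall>n. u n \<in> carrier_of B \<and> norm_of B (u n) \<le> C"
    have sub: "norm_of B (z - y) = cnorm B (csub B (coord z B) (coord y B))"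
      if "z \<in> carrier_of B" "y \<in> carrier_of B" for y z
    proof -
      have "emb B (csub B (coord z B) (coord y B)) = z - y" using that by (simp add: emb_csub)
      then show ?thesis by (metis coord_in_cset cset_mem(6) norm_of_emb)
    qed
    obtain x where x: "x \<in> cset B" and ball: "\<And>y r. y \<in> cset B \<Longrightarrow>
      \<forall>\<^sub>F n in sequentially. cnorm B (csub B (coord (u n) B) y) \<le> r \<Longrightarrow> cnorm B (csub B x y) \<le> r"
      using record_level[of "\<lambda>n. coord (u n) B" C] u by (auto simp: norm_of_def)
    show "\<exists>x\<in>carrier_of B. \<forall>y\<in>carrier_of B. \<forall>r. (\<forall>\<^sub>F n in sequentially. norm_of B (u n - y) \<le> r) \<longrightarrow> norm_of B (x - y) \<le> r"
      using ball x u by (intro bexI[of _ "emb B x"]) (auto simp: sub)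
  qed
qed

end

text \<open>The type is unchanged, so that projectivity over the fixed types \<open>'b\<close> and
  \<open>'m\<close> applies to corners of \<open>B\<close> and \<open>M\<close>.\<close>

definition corner :: "'a calg \<Rightarrow> 'a \<Rightarrow> 'a calg" where
  "corner B p = B\<lparr>cset := {x \<in> cset B. cmult B p x = x \<and> cmult B x p = x}\<rparr>"

lemma corner_simps [simp]:
  "cset (corner B p) = {x \<in> cset B. cmult B p x = x \<and> cmult B x p = x}"
  "czero (corner B p) = czero B" "cadd (corner B p) = cadd B" "csmult (corner B p) = csmult B"
  "cmult (corner B p) = cmult B" "cstar (corner B p) = cstar B" "cnorm (corner B p) = cnorm B"
  "csub (corner B p) = csub B"
  by (simp_all add: corner_def csub_def fun_eq_iff)

locale projection_record = cstar_record B for B :: "'a calg" +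
  fixes p :: 'a
  assumes p_mem [simp]: "p \<in> cset B" and p_idem: "cmult B p p = p" and p_adj: "cstar B p = p"
begin

lemma emb_p: "emb B p \<in> carrier_of B" "emb B p * emb B p = emb B p" "adj (emb B p) = emb B p"
  using p_idem p_adj emb_simps(5)[OF p_mem p_mem] emb_simps(3)[OF p_mem] by simp_all

lemma mem_corner_iff:
  "x \<in> cset (corner B p) \<longleftrightarrow> x \<in> cset B \<and> emb B p * emb B x = emb B x \<and> emb B x * emb B p = emb B x"
  by (auto simp: emb_simps[symmetric] emb_inject)

lemma corner_cstar: "cstar_algebra (corner B p)"
proof -
  define U where "U = {x \<in> carrier_of B. emb B p * x = x \<and> x * emb B p = x}"
  interpret U: cstar_unital U "norm_of B" "emb B p"
    unfolding U_def by (rule corner_cstar_unital[OF emb_p])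
  define K where "K = cset (corner B p)"
  have mem: "x \<in> K \<longleftrightarrow> x \<in> cset B \<and> emb B x \<in> U" for x
    unfolding K_def mem_corner_iff U_def by auto
  have sub: "x \<in> K \<Longrightarrow> x \<in> cset B" for x by (simp add: mem)
  have closed: "czero B \<in> K" "x \<in> K \<Longrightarrow> csmult B c x \<in> K" "x \<in> K \<Longrightarrow> cstar B x \<in> K"
    "x \<in> K \<Longrightarrow> y \<in> K \<Longrightarrow> cadd B x y \<in> K" "x \<in> K \<Longrightarrow> y \<in> K \<Longrightarrow> cmult B x y \<in> K" for x y c
    by (simp_all add: mem emb_simps)
  have complete: "\<forall>f :: nat \<Rightarrow> 'a. (\<forall>k. f k \<in> K) \<longrightarrow>
        (\<forall>e>0. \<exists>N. \<forall>m\<ge>N. \<forall>k\<ge>N. cnorm B (csub B (f m) (f k)) < e) \<longrightarrow>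
        (\<exists>x\<in>K. (\<lambda>k. cnorm B (csub B (f k) x)) \<longlonglongrightarrow> 0)"
  proof (intro allI impI)
    fix f :: "nat \<Rightarrow> 'a"
    assume f: "\<forall>k. f k \<in> K"
      and cauchy: "\<forall>e>0. \<exists>N. \<forall>m\<ge>N. \<forall>k\<ge>N. cnorm B (csub B (f m) (f k)) < e"
    have fB: "f k \<in> cset B" "emb B (f k) \<in> U" for k using f unfolding mem by auto
    have dist: "norm_of B (emb B (f m) - emb B x) = cnorm B (csub B (f m) x)" if "x \<in> cset B" for m x
      using that fB(1)[of m] emb_csub[of "f m" x] norm_of_emb[of "csub B (f m) x"] by simp
    have "\<exists>x\<in>U. (\<lambda>k. norm_of B (emb B (f k) - x)) \<longlonglongrightarrow> 0"
    proof (rule U.complete)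
      show "\<exists>M. \<forall>m\<ge>M. \<forall>k\<ge>M. norm_of B (emb B (f m) - emb B (f k)) < \<epsilon>" if "\<epsilon> > 0" for \<epsilon>
        using cauchy that unfolding dist[OF fB(1)] by blast
    qed (rule fB)
    then obtain x where x: "x \<in> U" "(\<lambda>k. norm_of B (emb B (f k) - x)) \<longlonglongrightarrow> 0" by blast
    have "x \<in> carrier_of B" using x(1) unfolding U_def by blast
    then have ex: "emb B (coord x B) = x" by (rule emb_coord)
    then have "coord x B \<in> K" unfolding mem using x(1) coord_in_cset by metis
    moreover have "(\<lambda>k. cnorm B (csub B (f k) (coord x B))) \<longlonglongrightarrow> 0"
      using x(2) unfolding dist[OF coord_in_cset[of x], unfolded ex] .
    ultimately show "\<exists>x\<in>K. (\<lambda>k. cnorm B (csub B (f k) x)) \<longlonglongrightarrow> 0" by blast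
  qed
  show ?thesis
    unfolding cstar_algebra_def corner_simps(2-8) K_def[symmetric]
    by (intro conjI complete; (intro ballI allI)?;
      (assumption | rule closed cstar_algebra_add[OF cstar] cstar_algebra_mult[OF cstar]
        cstar_algebra_norm[OF cstar] sub)+)
qed

interpretation C: cstar_record "corner B p"
  by unfold_locales (rule corner_cstar)

text \<open>The value 0 off the corner is forced, since \<open>dual_space\<close> demands it of
  functionals outside their carrier.\<close>

definition restr :: "('a \<Rightarrow> complex) \<Rightarrow> 'a \<Rightarrow> complex" where
  "restr f = (\<lambda>x. if x \<in> cset (corner B p) then f x else 0)"

lemma restr_apply [simp]: "x \<in> cset (corner B p) \<Longrightarrow> restr f x = f x"
  by (simp add: restr_def)

lemma corner_sub: "x \<in> cset (corner B p) \<Longrightarrow> x \<in> cset B"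
  by simp

lemma restr_mem:
  assumes "f \<in> dual_space B"
  shows "restr f \<in> dual_space (corner B p)"
proof -
  have "cmod (restr f x) \<le> dual_norm B f * cnorm B x" if "x \<in> cset (corner B p)" for x
    using cmod_le_dual_norm[OF assms corner_sub[OF that]] that by (simp del: corner_simps(1))
  moreover have "restr f (cadd B x y) = restr f x + restr f y"
    if "x \<in> cset (corner B p)" "y \<in> cset (corner B p)" for x y
    using C.cset_mem(4)[OF that] that dual_spaceD(1)[OF assms corner_sub corner_sub]
    by (simp del: corner_simps(1))
  moreover have "restr f (csmult B c x) = c * restr f x" if "x \<in> cset (corner B p)" for x c
    using C.cset_mem(2)[OF that] that dual_spaceD(2)[OF assms corner_sub]
    by (simp del: corner_simps(1))
  ultimately show ?thesis
    unfolding dual_space_def by (auto simp: restr_def simp del: corner_simps(1) simp: corner_simps(2-8))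
qed

lemma dual_norm_restr_le:
  assumes "f \<in> dual_space B"
  shows "dual_norm (corner B p) (restr f) \<le> dual_norm B f"
  by (rule C.dual_norm_le) (use cmod_le_dual_norm_unit[OF assms corner_sub] in
      \<open>simp del: corner_simps(1)\<close>)

lemma restr_add: "restr (\<lambda>x. f x + g x) = (\<lambda>x. restr f x + restr g x)"
  and restr_scale: "restr (\<lambda>x. c * f x) = (\<lambda>x. c * restr f x)"
  and restr_zero: "restr (\<lambda>_. 0) = (\<lambda>_. 0)"
  by (auto simp: restr_def)

text \<open>A functional estimate \<open>|f x| \<le> K \<parallel>f|C\<parallel>\<close> on the predual replaces ``\<open>x\<close> is a weak* limit of elements
  of norm at most \<open>K\<close> of the corner \<open>C\<close>''. Choosing phases so that \<open>K |f a| + t |f d|\<close> is a value of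
  \<open>f\<close> transfers Pythagoras' inequality from the corner to \<open>x\<close>.\<close>

lemma pythagoras_transfer:
  assumes F: "predual B F" and x: "x \<in> cset B" and d: "d \<in> cset B" and K: "K > 0"
    and le: "\<And>f. f \<in> F \<Longrightarrow> cmod (f x) \<le> K * dual_norm (corner B p) (restr f)"
    and pyth: "\<And>a s. a \<in> cset (corner B p) \<Longrightarrow>
      (cnorm B (cadd B a (csmult B s d)))\<^sup>2 \<le> (cnorm B a)\<^sup>2 + (cmod s * cnorm B d)\<^sup>2"
    and t: "t \<ge> 0"
  shows "(cnorm B (cadd B x (csmult B (complex_of_real t) d)))\<^sup>2 \<le> K\<^sup>2 + t\<^sup>2 * (cnorm B d)\<^sup>2"
proof -
  define R where "R = sqrt (K\<^sup>2 + t\<^sup>2 * (cnorm B d)\<^sup>2)"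
  have "cnorm B (cadd B x (csmult B (complex_of_real t) d)) \<le> R"
  proof (rule cnorm_le_if_predual[OF F])
    fix f assume f: "f \<in> F" "dual_norm B f \<le> 1"
    have fD: "f \<in> dual_space B" using F f(1) by (auto simp: predual_def)
    have phase: "\<exists>\<alpha>. cmod \<alpha> \<le> 1 \<and> \<alpha> * z = complex_of_real (cmod z)" for z
    proof (cases "z = 0")
      case False
      then show ?thesis
        by (intro exI[of _ "cnj z / complex_of_real (cmod z)"])
          (auto simp: norm_divide complex_norm_square power2_eq_square mult.commute[of "cnj z"]
            simp flip: complex_norm_square)
    qed (auto intro: exI[of _ 0])
    have "dual_norm (corner B p) (restr f) \<le> (R - t * cmod (f d)) / K"
    proof (rule C.dual_norm_le)
      fix a assume a: "a \<in> cset (corner B p)" "cnorm (corner B p) a \<le> 1"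
      obtain \<alpha> where \<alpha>: "cmod \<alpha> \<le> 1" "\<alpha> * f a = complex_of_real (cmod (f a))" using phase by blast
      obtain \<beta> where \<beta>: "cmod \<beta> \<le> 1" "\<beta> * f d = complex_of_real (cmod (f d))" using phase by blast
      \<comment> \<open>With these coefficients \<open>f\<close> takes the value
        \<open>K |f a| + t |f d|\<close> at \<open>?a + ?s d\<close>, while Pythagoras and
        \<open>dual_norm B f \<le> 1\<close> bound that value by \<open>R\<close>.\<close>
      let ?a = "csmult B (complex_of_real K * \<alpha>) a" and ?s = "complex_of_real t * \<beta>"
      have aB: "a \<in> cset B" using a by simp
      have na: "cnorm B a \<le> 1" using a(2) by simp
      have "f (cadd B ?a (csmult B ?s d)) = complex_of_real K * (\<alpha> * f a) + complex_of_real t * (\<beta> * f d)"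
        using aB d by (simp add: dual_spaceD[OF fD] mult.assoc)
      also have "\<dots> = complex_of_real (K * cmod (f a) + t * cmod (f d))" by (simp add: \<alpha> \<beta>)
      finally have "cmod (f (cadd B ?a (csmult B ?s d))) = K * cmod (f a) + t * cmod (f d)"
        using K t by (simp add: norm_of_real del: of_real_add of_real_mult)
      then have "K * cmod (f a) + t * cmod (f d) \<le> dual_norm B f * cnorm B (cadd B ?a (csmult B ?s d))"
        using cmod_le_dual_norm[OF fD, of "cadd B ?a (csmult B ?s d)"] aB d by simp
      also have "\<dots> \<le> 1 * cnorm B (cadd B ?a (csmult B ?s d))"
        using f aB d by (intro mult_right_mono) auto
      also have "\<dots> \<le> R"
      proof -
        have "(cnorm B (cadd B ?a (csmult B ?s d)))\<^sup>2 \<le> (cnorm B ?a)\<^sup>2 + (cmod ?s * cnorm B d)\<^sup>2"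
          using C.cset_mem(2)[OF a(1)] by (intro pyth) (simp only: corner_simps(4))
        also have "cnorm B ?a \<le> K"
        proof -
          have "cmod \<alpha> * cnorm B a \<le> 1 * 1" using \<alpha>(1) na aB by (intro mult_mono) auto
          then show ?thesis using K aB by (simp add: cnorm_csmult norm_mult mult.assoc)
        qed
        then have "(cnorm B ?a)\<^sup>2 \<le> K\<^sup>2" using aB by (intro power_mono) auto
        also have "cmod ?s * cnorm B d \<le> t * cnorm B d"
          using \<beta>(1) t d by (intro mult_right_mono) (auto simp: norm_mult mult_left_le)
        then have "(cmod ?s * cnorm B d)\<^sup>2 \<le> (t * cnorm B d)\<^sup>2" using d by (intro power_mono) auto
        finally show ?thesis unfolding R_def by (intro real_le_rsqrt) (simp add: power_mult_distrib)
      qed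
      finally show "cmod (restr f a) \<le> (R - t * cmod (f d)) / K"
        using a(1) K by (simp add: pos_le_divide_eq mult.commute del: corner_simps(1))
    qed
    then have "K * dual_norm (corner B p) (restr f) \<le> R - t * cmod (f d)"
      using K by (simp add: pos_le_divide_eq mult.commute)
    then have "cmod (f x) + t * cmod (f d) \<le> R" using le[OF f(1)] by simp
    moreover have "cmod (f (cadd B x (csmult B (complex_of_real t) d))) \<le> cmod (f x) + t * cmod (f d)"
      using x d t norm_triangle_ineq[of "f x" "complex_of_real t * f d"]
      by (simp add: dual_spaceD[OF fD] norm_mult)
    ultimately show "cmod (f (cadd B x (csmult B (complex_of_real t) d))) \<le> R" by simp
  qed (use x d in auto)
  then have "(cnorm B (cadd B x (csmult B (complex_of_real t) d)))\<^sup>2 \<le> R\<^sup>2"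
    using x d by (intro power_mono) auto
  then show ?thesis by (simp add: R_def)
qed

text \<open>\<open>pythagoras_transfer\<close> with \<open>d = x - p x\<close> supplies the bound
  that \<open>complement_zero_if_pythagoras\<close> asks for. For the other side it is used with
  \<open>d = x - x p\<close>, and the bound is read for the adjoints, which have the same
  norms.\<close>

lemma mem_corner_if_bounded:
  assumes F: "predual B F" and x: "x \<in> cset B"
    and le: "\<And>f. f \<in> F \<Longrightarrow> cmod (f x) \<le> K * dual_norm (corner B p) (restr f)"
  shows "x \<in> cset (corner B p)"
proof -
  let ?p = "emb B p"
  \<comment> \<open>\<open>pythagoras_transfer\<close> divides by its constant, which has to be
    strictly positive.\<close>
  define L where "L = max K 1"
  have L: "L > 0" by (simp add: L_def)
  have leL: "cmod (f x) \<le> L * dual_norm (corner B p) (restr f)" if "f \<in> F" for f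
  proof -
    have "f \<in> dual_space B" using F that by (auto simp: predual_def)
    then have "K * dual_norm (corner B p) (restr f) \<le> L * dual_norm (corner B p) (restr f)"
      using C.dual_norm_nonneg[OF restr_mem] by (intro mult_right_mono) (auto simp: L_def)
    then show ?thesis using le[OF that] by simp
  qed
  have ax: "emb B x \<in> carrier_of B" using x by simp
  have 1: "?p * emb B x = emb B x"
  proof (rule complement_zero_if_pythagoras[OF emb_p(1,3,2) ax])
    fix t :: real assume t: "t \<ge> 0"
    define d where "d = csub B x (cmult B p x)"
    have d: "d \<in> cset B" and ed: "emb B d = emb B x - ?p * emb B x"
      using x by (simp_all add: d_def emb_csub emb_simps)
    have pd: "?p * emb B d = 0" using emb_p by (simp add: ed algebra_simps flip: mult.assoc)
    have "(cnorm B (cadd B x (csmult B (complex_of_real t) d)))\<^sup>2 \<le> L\<^sup>2 + t\<^sup>2 * (cnorm B d)\<^sup>2"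
    proof (rule pythagoras_transfer[OF F x d L leL _ t])
      fix a s assume "a \<in> cset (corner B p)"
      then have a: "a \<in> cset B" "?p * emb B a = emb B a" unfolding mem_corner_iff by auto
      have "(norm_of B (emb B a + s *\<^sub>C emb B d))\<^sup>2 \<le> (norm_of B (emb B a))\<^sup>2 + (norm_of B (s *\<^sub>C emb B d))\<^sup>2"
        using a d pd emb_p by (intro N_pythagoras[of ?p]) auto
      then show "(cnorm B (cadd B a (csmult B s d)))\<^sup>2 \<le> (cnorm B a)\<^sup>2 + (cmod s * cnorm B d)\<^sup>2"
        using a(1) d by (simp add: cnorm_csmult flip: emb_simps)
    qed
    then show "(norm_of B (emb B x + complex_of_real t *\<^sub>C (emb B x - ?p * emb B x)))\<^sup>2
        \<le> L\<^sup>2 + t\<^sup>2 * (norm_of B (emb B x - ?p * emb B x))\<^sup>2"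
      unfolding ed[symmetric] using x d by (simp flip: emb_simps)
  qed
  have "?p * adj (emb B x) = adj (emb B x)"
  proof (rule complement_zero_if_pythagoras[OF emb_p(1,3,2) adj_mem[OF ax]])
    fix t :: real assume t: "t \<ge> 0"
    define d where "d = csub B x (cmult B x p)"
    have d: "d \<in> cset B" and ed: "emb B d = emb B x - emb B x * ?p"
      using x by (simp_all add: d_def emb_csub emb_simps)
    have ead: "adj (emb B d) = adj (emb B x) - ?p * adj (emb B x)" by (simp add: ed emb_p)
    have pd: "?p * adj (emb B d) = 0" using emb_p by (simp add: ead algebra_simps flip: mult.assoc)
    have "(cnorm B (cadd B x (csmult B (complex_of_real t) d)))\<^sup>2 \<le> L\<^sup>2 + t\<^sup>2 * (cnorm B d)\<^sup>2"
    proof (rule pythagoras_transfer[OF F x d L leL _ t])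
      fix a s assume "a \<in> cset (corner B p)"
      then have a: "a \<in> cset B" "emb B a * ?p = emb B a" unfolding mem_corner_iff by auto
      have "?p * adj (emb B a) = adj (emb B a)" by (metis a(2) adj_mult emb_p(3))
      then have "(norm_of B (adj (emb B a) + cnj s *\<^sub>C adj (emb B d)))\<^sup>2
          \<le> (norm_of B (adj (emb B a)))\<^sup>2 + (norm_of B (cnj s *\<^sub>C adj (emb B d)))\<^sup>2"
        using a d pd emb_p by (intro N_pythagoras[of ?p]) auto
      moreover have "norm_of B (adj (emb B a) + cnj s *\<^sub>C adj (emb B d)) = norm_of B (emb B a + s *\<^sub>C emb B d)"
        using N_adj[of "emb B a + s *\<^sub>C emb B d"] a d by simp
      ultimately have "(norm_of B (emb B a + s *\<^sub>C emb B d))\<^sup>2 \<le> (cnorm B a)\<^sup>2 + (cmod s * cnorm B d)\<^sup>2"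
        using a d by (simp add: N_cscale)
      then show "(cnorm B (cadd B a (csmult B s d)))\<^sup>2 \<le> (cnorm B a)\<^sup>2 + (cmod s * cnorm B d)\<^sup>2"
        using a(1) d by (simp flip: emb_simps)
    qed
    moreover have "norm_of B (adj (emb B x) + complex_of_real t *\<^sub>C adj (emb B d))
        = norm_of B (emb B x + complex_of_real t *\<^sub>C emb B d)"
      using N_adj[of "emb B x + complex_of_real t *\<^sub>C emb B d"] x d by simp
    moreover have "norm_of B (emb B x + complex_of_real t *\<^sub>C emb B d) =
        cnorm B (cadd B x (csmult B (complex_of_real t) d))"
      using x d by (simp flip: emb_simps)
    ultimately show "(norm_of B (adj (emb B x) + complex_of_real t *\<^sub>C (adj (emb B x) - ?p * adj (emb B x))))\<^sup>2
        \<le> L\<^sup>2 + t\<^sup>2 * (norm_of B (adj (emb B x) - ?p * adj (emb B x)))\<^sup>2"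
      unfolding ead[symmetric] using d by simp
  qed
  then have "emb B x * ?p = emb B x" by (metis adj_adj adj_mult emb_p(3))
  then show ?thesis using 1 x unfolding mem_corner_iff by blast
qed

text \<open>Taking the functionals \<open>f (p x p)\<close> with \<open>f\<close> in
  \<open>F\<close> as predual would rest on weak* continuity of multiplication. Instead
  \<open>G\<close> is the norm closure of the restrictions \<open>restr f\<close>. A bounded
  functional on \<open>G\<close> pulls back to \<open>F\<close>, where some \<open>x\<close> in
  \<open>B\<close> represents it; its bound in terms of \<open>restr f\<close> puts \<open>x\<close>
  into the corner by \<open>mem_corner_if_bounded\<close>, and density extends the representation to
  \<open>G\<close>.\<close>

lemma corner_wstar:
  assumes "wstar_algebra B"
  shows "wstar_algebra (corner B p)"
proof -
  let ?C = "corner B p"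
  note del = corner_simps(1) [simp del]
  obtain F where F: "predual B F" using assms by (auto simp: wstar_algebra_iff_predual)
  have FD: "f \<in> dual_space B" if "f \<in> F" for f using F that by (auto simp: predual_def)
  have F0: "(\<lambda>_. 0) \<in> F" using F by (simp add: predual_def)
  have Fadd: "(\<lambda>x. f x + h x) \<in> F" if "f \<in> F" "h \<in> F" for f h using F that by (simp add: predual_def)
  have Fsc: "(\<lambda>x. c * f x) \<in> F" if "f \<in> F" for f c using F that by (simp add: predual_def)
  define G where "G = {g \<in> dual_space ?C. \<forall>\<epsilon>>0. \<exists>f\<in>F. dual_norm ?C (\<lambda>x. restr f x - g x) < \<epsilon>}"
  have GD: "g \<in> dual_space ?C" if "g \<in> G" for g using that by (simp add: G_def)
  have restr_G: "restr f \<in> G" if "f \<in> F" for f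
  proof -
    have "dual_norm ?C (\<lambda>x. restr f x - restr f x) < \<epsilon>" if "\<epsilon> > 0" for \<epsilon>
      using C.dual_norm_zero that by simp
    then show ?thesis
      unfolding G_def using that restr_mem[OF FD]
      by (intro CollectI conjI allI impI bexI[of _ f]) auto
  qed
  have Gapprox: "\<exists>f\<in>F. dual_norm ?C (\<lambda>x. restr f x - g x) < \<epsilon>" if "g \<in> G" "\<epsilon> > 0" for g \<epsilon>
    using that by (simp add: G_def)
  have RD: "restr f \<in> dual_space ?C" if "f \<in> F" for f using restr_mem[OF FD[OF that]] .
  have Gadd: "(\<lambda>x. g x + h x) \<in> G" if gh: "g \<in> G" "h \<in> G" for g h
    unfolding G_def
  proof (intro CollectI conjI allI impI)
    fix \<epsilon> :: real assume "\<epsilon> > 0"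
    then obtain f1 f2 where f: "f1 \<in> F" "f2 \<in> F" "dual_norm ?C (\<lambda>x. restr f1 x - g x) < \<epsilon> / 2"
      "dual_norm ?C (\<lambda>x. restr f2 x - h x) < \<epsilon> / 2"
      using Gapprox[OF gh(1), of "\<epsilon> / 2"] Gapprox[OF gh(2), of "\<epsilon> / 2"] by auto
    have "dual_norm ?C (\<lambda>x. (restr f1 x - g x) + (restr f2 x - h x)) < \<epsilon>"
      using C.dual_norm_add[OF C.dual_space_diff[OF RD[OF f(1)] GD[OF gh(1)]]
          C.dual_space_diff[OF RD[OF f(2)] GD[OF gh(2)]]] f(3,4) by simp
    then show "\<exists>f\<in>F. dual_norm ?C (\<lambda>x. restr f x - (g x + h x)) < \<epsilon>"
      using Fadd[OF f(1,2)] by (intro bexI[of _ "\<lambda>x. f1 x + f2 x"]) (simp_all add: restr_add algebra_simps)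
  qed (use C.dual_space_add GD gh in auto)
  have Gsc: "(\<lambda>x. c * g x) \<in> G" if g: "g \<in> G" for c g
    unfolding G_def
  proof (intro CollectI conjI allI impI)
    fix \<epsilon> :: real assume \<epsilon>: "\<epsilon> > 0"
    have pos: "0 < cmod c + 1" using norm_ge_zero[of c] by linarith
    then obtain f where f: "f \<in> F" "dual_norm ?C (\<lambda>x. restr f x - g x) < \<epsilon> / (cmod c + 1)"
      using Gapprox[OF g, of "\<epsilon> / (cmod c + 1)"] \<epsilon> by auto
    let ?n = "dual_norm ?C (\<lambda>x. restr f x - g x)"
    have n0: "0 \<le> ?n" using C.dual_norm_nonneg[OF C.dual_space_diff[OF RD[OF f(1)] GD[OF g]]] .
    have "dual_norm ?C (\<lambda>x. c * (restr f x - g x)) \<le> cmod c * ?n"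
      by (rule C.dual_norm_scale[OF C.dual_space_diff[OF RD[OF f(1)] GD[OF g]]])
    also have "\<dots> \<le> (cmod c + 1) * ?n" using n0 by (intro mult_right_mono) auto
    also have "\<dots> < \<epsilon>" using f(2) pos by (simp add: pos_less_divide_eq mult.commute)
    finally show "\<exists>f\<in>F. dual_norm ?C (\<lambda>x. restr f x - c * g x) < \<epsilon>"
      using Fsc[OF f(1), of c]
      by (intro bexI[of _ "\<lambda>x. c * f x"]) (simp_all add: restr_scale right_diff_distrib)
  qed (use C.dual_space_scale GD g in auto)
  have "predual ?C G"
    unfolding predual_def
  proof (intro conjI ballI allI impI)
    show "G \<subseteq> dual_space ?C" by (auto simp: G_def)
    show "(\<lambda>_. 0) \<in> G" using restr_G[OF F0] by (simp add: restr_zero)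
    show "(\<lambda>x. g x + h x) \<in> G" if "g \<in> G" "h \<in> G" for g h using Gadd that .
    show "(\<lambda>x. c * g x) \<in> G" if "g \<in> G" for c g using Gsc that .
  next
    fix s :: "nat \<Rightarrow> 'a \<Rightarrow> complex" and g
    assume g: "g \<in> dual_space ?C" and s: "\<forall>k. s k \<in> G"
      and lim: "(\<lambda>k. dual_norm ?C (\<lambda>x. s k x - g x)) \<longlonglongrightarrow> 0"
    show "g \<in> G"
      unfolding G_def
    proof (intro CollectI conjI allI impI g)
      fix \<epsilon> :: real assume \<epsilon>: "\<epsilon> > 0"
      then have "\<forall>\<^sub>F k in sequentially. dual_norm ?C (\<lambda>x. s k x - g x) < \<epsilon> / 2"
        using lim by (intro order_tendstoD) auto
      then obtain k where k: "dual_norm ?C (\<lambda>x. s k x - g x) < \<epsilon> / 2"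
        by (auto simp: eventually_sequentially)
      obtain f where f: "f \<in> F" "dual_norm ?C (\<lambda>x. restr f x - s k x) < \<epsilon> / 2"
        using Gapprox[of "s k" "\<epsilon> / 2"] s \<epsilon> by auto
      have sk: "s k \<in> dual_space ?C" using s GD by blast
      have "dual_norm ?C (\<lambda>x. (restr f x - s k x) + (s k x - g x)) < \<epsilon>"
        using C.dual_norm_add[OF C.dual_space_diff[OF RD[OF f(1)] sk] C.dual_space_diff[OF sk g]] k f(2) by simp
      then show "\<exists>f\<in>F. dual_norm ?C (\<lambda>x. restr f x - g x) < \<epsilon>" using f(1) by auto
    qed
  next
    fix x assume x: "x \<in> cset ?C"
    let ?I = "{f \<in> G. dual_norm ?C f \<le> 1}"
    have up: "cmod (f x) \<le> cnorm ?C x" if "f \<in> ?I" for f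
    proof -
      have "cmod (f x) \<le> dual_norm ?C f * cnorm ?C x" using that GD x by (intro C.cmod_le_dual_norm) auto
      also have "\<dots> \<le> 1 * cnorm ?C x" using that C.cnorm_nonneg[OF x] by (intro mult_right_mono) auto
      finally show ?thesis by simp
    qed
    show "cnorm ?C x = (SUP f\<in>?I. cmod (f x))"
    proof (rule antisym)
      have "cnorm B x \<le> (SUP f\<in>?I. cmod (f x))"
      proof (rule cnorm_le_if_predual[OF F corner_sub[OF x]])
        fix f assume f: "f \<in> F" "dual_norm B f \<le> 1"
        then have "restr f \<in> ?I" using restr_G dual_norm_restr_le[OF FD[OF f(1)]] by simp
        moreover have "bdd_above ((\<lambda>f. cmod (f x)) ` ?I)" using up by (intro bdd_aboveI2)
        ultimately have "cmod (restr f x) \<le> (SUP f\<in>?I. cmod (f x))" by (intro cSUP_upper)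
        then show "cmod (f x) \<le> (SUP f\<in>?I. cmod (f x))" using x by simp
      qed
      then show "cnorm ?C x \<le> (SUP f\<in>?I. cmod (f x))" by simp
      have "(\<lambda>_. 0) \<in> ?I" using restr_G[OF F0] C.dual_norm_zero by (simp add: restr_zero)
      then show "(SUP f\<in>?I. cmod (f x)) \<le> cnorm ?C x" using up by (intro cSUP_least) auto
    qed
  next
    fix g :: "('a \<Rightarrow> complex) \<Rightarrow> complex"
    assume gadd: "\<forall>f\<in>G. \<forall>h\<in>G. g (\<lambda>x. f x + h x) = g f + g h"
      and gsc: "\<forall>c. \<forall>f\<in>G. g (\<lambda>x. c * f x) = c * g f"
      and "\<exists>K. \<forall>f\<in>G. cmod (g f) \<le> K * dual_norm ?C f"
    then obtain K where K: "\<And>f. f \<in> G \<Longrightarrow> cmod (g f) \<le> K * dual_norm ?C f" by blast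
    define L where "L = max K 0"
    have L: "cmod (g f) \<le> L * dual_norm ?C f" if "f \<in> G" for f
    proof -
      have "K * dual_norm ?C f \<le> L * dual_norm ?C f"
        using C.dual_norm_nonneg[OF GD[OF that]] by (intro mult_right_mono) (auto simp: L_def)
      then show ?thesis using K[OF that] by simp
    qed
    have L0: "L \<ge> 0" by (simp add: L_def)
    let ?g = "\<lambda>f. g (restr f)"
    have ex1: "\<exists>!x\<in>cset B. \<forall>f\<in>F. ?g f = f x"
    proof (rule predual_represents[OF F])
      show "?g (\<lambda>x. f x + h x) = ?g f + ?g h" if "f \<in> F" "h \<in> F" for f h
        using gadd restr_G that by (simp add: restr_add)
      show "?g (\<lambda>x. c * f x) = c * ?g f" if "f \<in> F" for c f
        using gsc restr_G that by (simp add: restr_scale)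
      show "cmod (?g f) \<le> L * dual_norm B f" if "f \<in> F" for f
        using L[OF restr_G[OF that]] mult_left_mono[OF dual_norm_restr_le[OF FD[OF that]] L0] by simp
    qed
    then obtain x where xB: "x \<in> cset B" and gx: "\<And>f. f \<in> F \<Longrightarrow> ?g f = f x" by blast
    have x: "x \<in> cset ?C"
    proof (rule mem_corner_if_bounded[OF F xB])
      show "cmod (f x) \<le> L * dual_norm ?C (restr f)" if "f \<in> F" for f
        using L[OF restr_G[OF that]] gx[OF that] by simp
    qed
    have g_eq: "g h = h x" if h: "h \<in> G" for h
    proof -
      have "cmod (g h - h x) \<le> 0"
      proof (rule field_le_epsilon)
        fix \<epsilon> :: real assume \<epsilon>: "\<epsilon> > 0"
        \<comment> \<open>\<open>L\<close> and \<open>cnorm ?C x\<close> are the two Lipschitz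
          constants in the estimate below; the summand 1 allows division by
          \<open>r\<close>.\<close>
        define r where "r = L + cnorm ?C x + 1"
        have r: "r > 0" using L0 C.cnorm_nonneg[OF x] by (simp add: r_def)
        obtain f where f: "f \<in> F" "dual_norm ?C (\<lambda>x. restr f x - h x) < \<epsilon> / r"
          using Gapprox[OF h, of "\<epsilon> / r"] \<epsilon> r by auto
        let ?d = "\<lambda>x. restr f x - h x"
        have dD: "?d \<in> dual_space ?C" by (rule C.dual_space_diff[OF RD[OF f(1)] GD[OF h]])
        have hm: "(\<lambda>x. (-1) * h x) \<in> G" by (rule Gsc[OF h])
        have dG: "?d \<in> G" using Gadd[OF restr_G[OF f(1)] hm] by simp
        have "g ?d = g (restr f) - g h"
        proof -
          have "g (\<lambda>x. restr f x + (-1) * h x) = g (restr f) + g (\<lambda>x. (-1) * h x)"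
            using gadd[rule_format, OF restr_G[OF f(1)] hm] .
          moreover have "g (\<lambda>x. (-1) * h x) = (-1) * g h" using gsc[rule_format, OF h, of "-1"] .
          ultimately show ?thesis by simp
        qed
        then have "g h - h x = ?d x - g ?d" using gx[OF f(1)] x by simp
        then have "cmod (g h - h x) \<le> cmod (?d x) + cmod (g ?d)" by (metis norm_triangle_ineq4)
        also have "\<dots> \<le> dual_norm ?C ?d * cnorm ?C x + L * dual_norm ?C ?d"
          using C.cmod_le_dual_norm[OF dD x] L[OF dG] by (rule add_mono)
        also have "\<dots> \<le> r * dual_norm ?C ?d"
          using C.dual_norm_nonneg[OF dD] by (simp add: r_def algebra_simps)
        also have "\<dots> \<le> \<epsilon>" using f(2) r by (simp add: pos_less_divide_eq mult.commute)
        finally show "cmod (g h - h x) \<le> 0 + \<epsilon>" by simp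
      qed
      then show ?thesis by simp
    qed
    show "\<exists>!x\<in>cset ?C. \<forall>f\<in>G. g f = f x"
    proof (rule ex1I[of _ x])
      show "x \<in> cset ?C \<and> (\<forall>f\<in>G. g f = f x)" using x g_eq by blast
      fix y assume y: "y \<in> cset ?C \<and> (\<forall>f\<in>G. g f = f y)"
      have "\<forall>f\<in>F. ?g f = f y"
        using y restr_G by auto
      then show "y = x"
        using ex1 gx xB corner_sub y by blast
    qed
  qed
  then show ?thesis using corner_cstar by (auto simp: wstar_algebra_iff_predual)
qed

end

subsection \<open>Lifting matrix units\<close>

context cstar_set
begin

text \<open>This is \<open>spectral_cut\<close> for \<open>adj x * x\<close> in the corner of
  \<open>p\<close>, whose unit \<open>p\<close> lies over the unit \<open>\<pi> p\<close> of the
  target corner. The outcome makes \<open>x * g\<close> a partial isometry with source projection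
  \<open>P\<close> and the same image under \<open>\<pi>\<close> as \<open>x\<close>.\<close>

lemma polar_cut:
  fixes \<pi> :: "'a \<Rightarrow> 'b::star_algebra"
  assumes cl: has_cluster_points and M: "cstar_set S' N'" and hom: "star_hom_on S S' \<pi>"
    and p: "p \<in> S" "p * p = p" "adj p = p" and x: "x \<in> S" "x * p = x" "\<pi> (adj x * x) = \<pi> p"
  obtains P g where "P \<in> S" "P * P = P" "adj P = P" "p * P = P" "g \<in> S" "adj g = g"
    "g * P = g" "g * (adj x * x) * g = P" "\<pi> P = \<pi> p" "\<pi> g = \<pi> p"
proof -
  interpret M: cstar_set S' N' by (rule M)
  note hs = star_hom_on_simps[OF hom]
  define C where "C = {x \<in> S. p * x = x \<and> x * p = x}"
  have memC: "y \<in> C \<longleftrightarrow> y \<in> S \<and> p * y = y \<and> y * p = y" for y by (simp add: C_def)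
  interpret C: wstar_unital C N p unfolding C_def by (rule corner_wstar_unital[OF cl p])
  have \<pi>p: "\<pi> p \<in> S'" "\<pi> p * \<pi> p = \<pi> p" "adj (\<pi> p) = \<pi> p"
    by (rule hs(1)[OF p(1)], metis hs(5)[OF p(1) p(1)] p(2), metis hs(2)[OF p(1)] p(3))
  define D where "D = {x \<in> S'. \<pi> p * x = x \<and> x * \<pi> p = x}"
  have D: "cstar_unital D N' (\<pi> p)" unfolding D_def by (rule M.corner_cstar_unital[OF \<pi>p])
  have inD: "\<pi> y \<in> D" if "y \<in> C" for y
  proof -
    have y: "y \<in> S" "p * y = y" "y * p = y" using that unfolding memC by blast+
    have "\<pi> p * \<pi> y = \<pi> y" "\<pi> y * \<pi> p = \<pi> y"
      by (metis hs(5)[OF p(1) y(1)] y(2), metis hs(5)[OF y(1) p(1)] y(3))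
    then show ?thesis using hs(1)[OF y(1)] unfolding D_def by blast
  qed
  have homD: "star_hom_on C D \<pi>"
    using hom inD memC unfolding star_hom_on_def by blast
  have px: "p * adj x = adj x" by (metis adj_mult p(3) x(2))
  have "p * (adj x * x) = adj x * x" "(adj x * x) * p = adj x * x"
    by (metis px mult.assoc, metis x(2) mult.assoc)
  then have aC: "adj x * x \<in> C" unfolding memC using x(1) mult_mem[OF adj_mem] by blast
  have a: "adj (adj x * x) = adj x * x" by simp
  from C.spectral_cut[OF D homD refl aC a x(3)] obtain P g
    where P: "P \<in> C" "adj P = P" "P * P = P" and g: "g \<in> C" "adj g = g" "g * P = g"
      "g * (adj x * x) * g = P" "\<pi> P = \<pi> p" "\<pi> g = \<pi> p" by blast
  show ?thesis
    by (rule that[of P g]) (use P g memC in blast)+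
qed

text \<open>The column \<open>f\<close> is lifted one entry at a time. A lift of the next entry is made orthogonal to
  the previous entries by subtracting its projection, and the polar cut then shrinks the common
  source projection of all entries.\<close>

lemma lift_column_of_partial_isometries:
  fixes \<pi> :: "'a \<Rightarrow> 'b::star_algebra" and n :: nat
  assumes cl: has_cluster_points and M: "cstar_set S' N'" and hom: "star_hom_on S S' \<pi>"
    and surj: "\<pi> ` S = S'"
    and p: "p \<in> S" "p * p = p" "adj p = p"
    and f: "\<And>i. i < n \<Longrightarrow> f i \<in> S'" "\<And>i. i < n \<Longrightarrow> f i * \<pi> p = f i"
      "\<And>i j. i < n \<Longrightarrow> j < n \<Longrightarrow> adj (f i) * f j = (if i = j then \<pi> p else 0)"
  shows "\<exists>P v. P \<in> S \<and> P * P = P \<and> adj P = P \<and> \<pi> P = \<pi> p \<and>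
    (\<forall>i<n. v i \<in> S \<and> v i * P = v i \<and> \<pi> (v i) = f i) \<and>
    (\<forall>i<n. \<forall>j<n. adj (v i) * v j = (if i = j then P else 0))"
  using f
proof (induction n)
  case 0
  then show ?case using p by auto
next
  case (Suc m)
  note hs = star_hom_on_simps[OF hom]
  from Suc.IH[OF Suc.prems(1)[OF less_SucI] Suc.prems(2)[OF less_SucI]
      Suc.prems(3)[OF less_SucI less_SucI]]
  obtain P v where P: "P \<in> S" "P * P = P" "adj P = P" "\<pi> P = \<pi> p"
    and v_all: "\<forall>i<m. v i \<in> S \<and> v i * P = v i \<and> \<pi> (v i) = f i"
    and vv_all: "\<forall>i<m. \<forall>j<m. adj (v i) * v j = (if i = j then P else 0)"
    by blast
  have v: "v i \<in> S" "v i * P = v i" "\<pi> (v i) = f i" if "i < m" for i using v_all that by auto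
  have vv: "adj (v i) * v j = (if i = j then P else 0)" if "i < m" "j < m" for i j
    using vv_all that by auto
  have "f m \<in> S'" using Suc.prems by simp
  then obtain x0 where x0: "x0 \<in> S" "\<pi> x0 = f m" using surj by (metis imageE)
  define q where "q = (\<Sum>k<m. v k * adj (v k))"
  have q: "q \<in> S" unfolding q_def using v by (intro sum_mem mult_mem adj_mem) auto
  have vq: "adj (v i) * q = adj (v i)" if "i < m" for i
  proof -
    have "adj (v i) * q = (\<Sum>k<m. if i = k then P * adj (v k) else 0)"
      unfolding q_def sum_distrib_left using that vv
      by (intro sum.cong refl) (simp flip: mult.assoc)
    also have "\<dots> = P * adj (v i)" using that by simp
    also have "\<dots> = adj (v i)" using arg_cong[OF v(2)[OF that], of adj] P(3) by (metis adj_mult)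
    finally show ?thesis .
  qed
  have \<pi>q: "\<pi> q * f m = 0"
  proof -
    have "\<pi> q = (\<Sum>k<m. f k * adj (f k))"
      unfolding q_def using v by (subst star_hom_on_sum[OF hom]) (auto intro!: sum.cong simp: hs)
    then have "\<pi> q * f m = (\<Sum>k<m. f k * (adj (f k) * f m))"
      by (simp add: sum_distrib_right mult.assoc)
    also have "\<dots> = 0" using Suc.prems(3) by (intro sum.neutral) auto
    finally show ?thesis .
  qed
  \<comment> \<open>\<open>q\<close> is the range projection of the previous entries. Because
    \<open>\<pi> q * f m = 0\<close> and \<open>f m * \<pi> p = f m\<close>, neither correction of
    \<open>x0\<close> changes its image.\<close>
  define x where "x = (x0 - q * x0) * P"
  have x: "x \<in> S" "x * P = x" using x0 q P by (simp_all add: x_def mult.assoc)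
  have "\<pi> x = (f m - \<pi> q * f m) * \<pi> p" using x0 q P by (simp add: x_def hs)
  then have \<pi>x: "\<pi> x = f m" using \<pi>q Suc.prems(2)[of m] by simp
  have vx: "adj (v i) * x = 0" if "i < m" for i
  proof -
    have "adj (v i) * x = (adj (v i) * x0 - (adj (v i) * q) * x0) * P"
      by (simp add: x_def algebra_simps)
    then show ?thesis using vq[OF that] by simp
  qed
  have "\<pi> (adj x * x) = \<pi> P" using x(1) \<pi>x P(4) Suc.prems(3)[of m m] by (simp add: hs)
  from polar_cut[OF cl M hom P(1,2,3) x this] obtain Q g
    where Q: "Q \<in> S" "Q * Q = Q" "adj Q = Q" "P * Q = Q" and g: "g \<in> S" "adj g = g" "g * Q = g"
      "g * (adj x * x) * g = Q" and \<pi>Q: "\<pi> Q = \<pi> p" "\<pi> g = \<pi> p"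
    using P(4) by metis
  define w where "w i = (if i < m then v i * Q else x * g)" for i
  have "w i \<in> S \<and> w i * Q = w i \<and> \<pi> (w i) = f i" if "i < Suc m" for i
  proof (cases "i < m")
    case True
    then show ?thesis using v Q \<pi>Q Suc.prems(2)[of i] by (simp add: w_def hs mult.assoc)
  next
    case False
    then have "i = m" using that by simp
    then show ?thesis using x g Q \<pi>Q \<pi>x Suc.prems(2)[of m] by (simp add: w_def hs mult.assoc)
  qed
  moreover have "adj (w i) * w j = (if i = j then Q else 0)" if ij: "i < Suc m" "j < Suc m" for i j
  proof -
    have 1: "adj (v i * Q) * (v j * Q) = (if i = j then Q else 0)" if "i < m" "j < m" for i j
    proof -
      have "adj (v i * Q) * (v j * Q) = Q * (adj (v i) * v j) * Q" by (simp add: Q mult.assoc)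
      then show ?thesis using vv that Q by (simp add: mult.assoc)
    qed
    have 2: "adj (v i * Q) * (x * g) = 0" if "i < m" for i
    proof -
      have "adj (v i * Q) * (x * g) = adj Q * (adj (v i) * x) * g" by (simp add: mult.assoc)
      then show ?thesis using vx[OF that] by simp
    qed
    have 3: "adj (x * g) * (v i * Q) = 0" if "i < m" for i
      using arg_cong[OF 2[OF that], of adj] by simp
    have 4: "adj (x * g) * (x * g) = Q" using g by (simp add: mult.assoc)
    show ?thesis using ij 1 2 3 4 by (auto simp: w_def less_Suc_eq simp del: adj_mult)
  qed
  ultimately show ?case using Q \<pi>Q by blast
qed

end

section \<open>Star-homomorphisms of records, and elementary matrices\<close>

lemma star_homD:
  assumes "star_hom A B f"
  shows "x \<in> cset A \<Longrightarrow> f x \<in> cset B"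
    "x \<in> cset A \<Longrightarrow> y \<in> cset A \<Longrightarrow> f (cadd A x y) = cadd B (f x) (f y)"
    "x \<in> cset A \<Longrightarrow> f (csmult A c x) = csmult B c (f x)"
    "x \<in> cset A \<Longrightarrow> y \<in> cset A \<Longrightarrow> f (cmult A x y) = cmult B (f x) (f y)"
    "x \<in> cset A \<Longrightarrow> f (cstar A x) = cstar B (f x)"
  using assms by (auto simp: star_hom_def)

lemma star_hom_czero:
  assumes "cstar_algebra A" "cstar_algebra B" "star_hom A B f"
  shows "f (czero A) = czero B"
proof -
  have z: "czero A \<in> cset A" using assms(1) by (rule czero_mem)
  have "f (czero A) = f (csmult A 0 (czero A))" using cstar_algebra_add(5)[OF assms(1) z z z] by simp
  also have "\<dots> = csmult B 0 (f (czero A))" by (rule star_homD(3)[OF assms(3) z])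
  also have "\<dots> = czero B" using cstar_algebra_add(5)[OF assms(2)] star_homD(1)[OF assms(3) z] by blast
  finally show ?thesis .
qed

lemma emb_star_hom_csum:
  fixes A :: "'a calg" and B :: "'b calg"
  assumes "cstar_algebra A" "cstar_algebra B" "star_hom A B f" "\<And>k. k < n \<Longrightarrow> g k \<in> cset A"
  shows "csum A g n \<in> cset A \<and> emb B (f (csum A g n)) = (\<Sum>k<n. emb B (f (g k)))"
proof -
  interpret A: cstar_record A by unfold_locales (rule assms(1))
  interpret B: cstar_record B by unfold_locales (rule assms(2))
  show ?thesis
    using assms(4)
  proof (induction n)
    case 0
    then show ?case using star_hom_czero[OF assms(1-3)] by (simp add: B.emb_simps)
  next
    case (Suc n)
    then show ?case by (simp add: star_homD[OF assms(3)] B.emb_simps)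
  qed
qed

lemma star_hom_on_emb:
  assumes "cstar_algebra B" "cstar_algebra M" "star_hom B M \<pi>"
  shows "star_hom_on (carrier_of B) (carrier_of M) (\<lambda>F. emb M (\<pi> (coord F B)))"
proof -
  interpret B: cstar_record B by unfold_locales (rule assms(1))
  interpret M: cstar_record M by unfold_locales (rule assms(2))
  show ?thesis
    unfolding star_hom_on_def
    by (simp add: coord_simps[OF assms(1)] star_homD[OF assms(3)] M.emb_simps)
qed

text \<open>For surjectivity, a preimage \<open>x\<close> of \<open>y\<close> is compressed to
  \<open>P x P\<close>, whose image is still \<open>y\<close> because \<open>y\<close> lies in the
  corner.\<close>

lemma star_hom_corner:
  assumes B: "cstar_algebra B" and M: "cstar_algebra M" and hom: "star_hom B M \<pi>"
    and surj: "\<pi> ` cset B = cset M"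
    and P: "P \<in> cset B" "cmult B P P = P"
  shows "star_hom (corner B P) (corner M (\<pi> P)) \<pi>" "\<pi> ` cset (corner B P) = cset (corner M (\<pi> P))"
proof -
  note h = star_homD[OF hom]
  have in_corner: "\<pi> x \<in> cset (corner M (\<pi> P))" if "x \<in> cset (corner B P)" for x
  proof -
    have x: "x \<in> cset B" "cmult B P x = x" "cmult B x P = x" using that by auto
    have "cmult M (\<pi> P) (\<pi> x) = \<pi> x" "cmult M (\<pi> x) (\<pi> P) = \<pi> x"
      by (metis h(4)[OF P(1) x(1)] x(2), metis h(4)[OF x(1) P(1)] x(3))
    then show ?thesis using h(1)[OF x(1)] by simp
  qed
  then show "star_hom (corner B P) (corner M (\<pi> P)) \<pi>"
    using h unfolding star_hom_def by (simp add: h)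
  have "y \<in> \<pi> ` cset (corner B P)" if y: "y \<in> cset (corner M (\<pi> P))" for y
  proof -
    obtain x where x: "x \<in> cset B" "y = \<pi> x" using y surj by auto
    interpret B: cstar_record B by unfold_locales (rule B)
    let ?z = "cmult B (cmult B P x) P"
    have z: "?z \<in> cset B" using x P by simp
    have "emb B P * emb B P = emb B P" using P by (simp flip: B.emb_simps)
    then have "emb B (cmult B P ?z) = emb B ?z" "emb B (cmult B ?z P) = emb B ?z"
      using x P z by (simp_all add: B.emb_simps mult.assoc) (simp flip: mult.assoc)
    then have "?z \<in> cset (corner B P)" using x P z by (simp add: B.emb_inject)
    moreover have "\<pi> ?z = y"
    proof -
      have "\<pi> ?z = cmult M (cmult M (\<pi> P) y) (\<pi> P)"
        unfolding x(2) using h(4)[OF P(1) x(1)] h(4)[OF B.cset_mem(5)[OF P(1) x(1)] P(1)] by simp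
      then show ?thesis using y by simp
    qed
    ultimately show ?thesis by blast
  qed
  then show "\<pi> ` cset (corner B P) = cset (corner M (\<pi> P))" using in_corner by blast
qed

lemma Mn_simps:
  "cset (Mn n A) = {X. (\<forall>i j. i < n \<and> j < n \<longrightarrow> X i j \<in> cset A) \<and>
                (\<forall>i j. \<not> (i < n \<and> j < n) \<longrightarrow> X i j = czero A)}"
  "cadd (Mn n A) = (\<lambda>X Y i j. if i < n \<and> j < n then cadd A (X i j) (Y i j) else czero A)"
  "csmult (Mn n A) = (\<lambda>c X i j. if i < n \<and> j < n then csmult A c (X i j) else czero A)"
  "cmult (Mn n A) = (\<lambda>X Y i j. if i < n \<and> j < n then csum A (\<lambda>k. cmult A (X i k) (Y k j)) n else czero A)"
  "cstar (Mn n A) = (\<lambda>X i j. if i < n \<and> j < n then cstar A (X j i) else czero A)"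
  by (simp_all add: Mn_def mat_pre_def)

definition elem_mat :: "'a calg \<Rightarrow> nat \<Rightarrow> nat \<Rightarrow> 'a \<Rightarrow> nat \<Rightarrow> nat \<Rightarrow> 'a" where
  "elem_mat A i j a = (\<lambda>k l. if k = i \<and> l = j then a else czero A)"

context cstar_record
begin

lemma zero_laws:
  "cadd B (czero B) (czero B) = czero B" "csmult B c (czero B) = czero B" "cstar B (czero B) = czero B"
  "x \<in> cset B \<Longrightarrow> cmult B (czero B) x = czero B" "x \<in> cset B \<Longrightarrow> cmult B x (czero B) = czero B"
  "x \<in> cset B \<Longrightarrow> cadd B (czero B) x = x" "x \<in> cset B \<Longrightarrow> cadd B x (czero B) = x"
  by (simp_all add: emb_inject[symmetric] emb_simps)

lemma csum_single:
  assumes "j < n" "x \<in> cset B" "\<And>k. f k = (if k = j then x else czero B)"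
  shows "csum B f n = x"
proof -
  have "emb B (csum B f n) = (\<Sum>k<n. emb B (f k))" "csum B f n \<in> cset B"
    using emb_csum[of n f] assms(2,3) by auto
  moreover have "(\<Sum>k<n. emb B (f k)) = (\<Sum>k<n. if k = j then emb B x else 0)"
    by (intro sum.cong refl) (simp add: assms(3) emb_simps)
  ultimately show ?thesis using assms by (simp add: emb_inject)
qed

lemma csum_zero: "(\<And>k. f k = czero B) \<Longrightarrow> csum B f n = czero B"
  by (induction n) (simp_all add: zero_laws)

lemma elem_mat_mem: "i < n \<Longrightarrow> j < n \<Longrightarrow> a \<in> cset B \<Longrightarrow> elem_mat B i j a \<in> cset (Mn n B)"
  by (auto simp: Mn_simps elem_mat_def)

lemma elem_mat_add:
  "i < n \<Longrightarrow> j < n \<Longrightarrow> elem_mat B i j (cadd B a b) = cadd (Mn n B) (elem_mat B i j a) (elem_mat B i j b)"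
  by (auto simp: Mn_simps elem_mat_def fun_eq_iff zero_laws)

lemma elem_mat_smult:
  "i < n \<Longrightarrow> j < n \<Longrightarrow> elem_mat B i j (csmult B c a) = csmult (Mn n B) c (elem_mat B i j a)"
  by (auto simp: Mn_simps elem_mat_def fun_eq_iff zero_laws)

lemma elem_mat_star:
  "i < n \<Longrightarrow> j < n \<Longrightarrow> elem_mat B j i (cstar B a) = cstar (Mn n B) (elem_mat B i j a)"
  by (auto simp: Mn_simps elem_mat_def fun_eq_iff zero_laws)

lemma elem_mat_mult:
  assumes "i < n" "j < n" "k < n" "l < n" "a \<in> cset B" "b \<in> cset B"
  shows "cmult (Mn n B) (elem_mat B i j a) (elem_mat B k l b) =
    (if j = k then elem_mat B i l (cmult B a b) else elem_mat B i l (czero B))"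
proof (intro ext)
  fix r s
  let ?f = "\<lambda>t. cmult B (elem_mat B i j a r t) (elem_mat B k l b t s)"
  show "cmult (Mn n B) (elem_mat B i j a) (elem_mat B k l b) r s =
    (if j = k then elem_mat B i l (cmult B a b) else elem_mat B i l (czero B)) r s"
  proof (cases "r = i \<and> s = l \<and> j = k")
    case True
    have "csum B ?f n = cmult B a b"
      using assms True by (intro csum_single[of j]) (auto simp: elem_mat_def zero_laws)
    then show ?thesis using True assms by (simp add: Mn_simps elem_mat_def)
  next
    case False
    have "csum B ?f n = czero B"
      using assms False by (intro csum_zero) (auto simp: elem_mat_def zero_laws)
    then show ?thesis using False assms by (auto simp: Mn_simps elem_mat_def)
  qed
qed

end

subsection \<open>Lifting maps on matrix algebras\<close>

lemma matrix_star_hom_expand: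
  fixes A :: "'a calg" and M :: "'m calg"
  assumes A: "cstar_algebra A" and M: "cstar_algebra M" and n: "n \<ge> 1"
    and \<phi>: "star_hom (Mn n A) M \<phi>"
  defines "\<Phi> \<equiv> \<lambda>i j a. emb M (\<phi> (elem_mat A i j a))"
  shows "i < n \<Longrightarrow> j < n \<Longrightarrow> k < n \<Longrightarrow> l < n \<Longrightarrow> a \<in> cset A \<Longrightarrow> b \<in> cset A \<Longrightarrow>
      \<Phi> i j a * \<Phi> k l b = (if j = k then \<Phi> i l (cmult A a b) else 0)"
    and "i < n \<Longrightarrow> j < n \<Longrightarrow> a \<in> cset A \<Longrightarrow> adj (\<Phi> i j a) = \<Phi> j i (cstar A a)"
    and "X \<in> cset (Mn n A) \<Longrightarrow> emb M (\<phi> X) = (\<Sum>i<n. \<Sum>j<n. \<Phi> i j (X i j))"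
proof -
  interpret A: cstar_record A by unfold_locales (rule A)
  interpret M: cstar_record M by unfold_locales (rule M)
  note h = star_homD[OF \<phi>]
  \<comment> \<open>\<open>Mn n A\<close> has not been shown to be a C*-algebra, so
    \<open>star_hom_czero\<close> does not apply; the zero matrix is written as 0 times itself
    instead.\<close>
  have zero: "\<Phi> i j (czero A) = 0" if "i < n" "j < n" for i j
  proof -
    have e: "elem_mat A i j (czero A) \<in> cset (Mn n A)" using that by (intro A.elem_mat_mem) auto
    have "elem_mat A i j (czero A) = csmult (Mn n A) 0 (elem_mat A i j (czero A))"
      using A.elem_mat_smult[OF that, of 0 "czero A"] by (simp add: A.zero_laws)
    then have "\<phi> (elem_mat A i j (czero A)) = csmult M 0 (\<phi> (elem_mat A i j (czero A)))"
      using h(3)[OF e, of 0] by metis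
    then have "\<Phi> i j (czero A) = 0 *\<^sub>C \<Phi> i j (czero A)"
      unfolding \<Phi>_def using h(1)[OF e] by (metis M.emb_simps(2))
    then show ?thesis by simp
  qed
  show "\<Phi> i j a * \<Phi> k l b = (if j = k then \<Phi> i l (cmult A a b) else 0)"
    if "i < n" "j < n" "k < n" "l < n" "a \<in> cset A" "b \<in> cset A"
  proof -
    have e: "elem_mat A i j a \<in> cset (Mn n A)" "elem_mat A k l b \<in> cset (Mn n A)"
      using that by (auto intro: A.elem_mat_mem)
    have "\<Phi> i j a * \<Phi> k l b = emb M (\<phi> (cmult (Mn n A) (elem_mat A i j a) (elem_mat A k l b)))"
      unfolding \<Phi>_def h(4)[OF e] using h(1)[OF e(1)] h(1)[OF e(2)] by (simp add: M.emb_simps)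
    then show ?thesis
      using zero[OF that(1,4)] by (simp add: A.elem_mat_mult[OF that] \<Phi>_def)
  qed
  show "adj (\<Phi> i j a) = \<Phi> j i (cstar A a)" if "i < n" "j < n" "a \<in> cset A"
  proof -
    have e: "elem_mat A i j a \<in> cset (Mn n A)" using that by (intro A.elem_mat_mem)
    show ?thesis
      unfolding \<Phi>_def A.elem_mat_star[OF that(1,2)] h(5)[OF e] using h(1)[OF e] by (simp add: M.emb_simps)
  qed
  show "emb M (\<phi> X) = (\<Sum>i<n. \<Sum>j<n. \<Phi> i j (X i j))" if X: "X \<in> cset (Mn n A)"
  proof -
    define R where "R I = (\<lambda>i j. if (i, j) \<in> I then X i j else czero A)" for I
    have X_mem: "X i j \<in> cset A" if "i < n" "j < n" for i j using X that by (simp add: Mn_simps)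
    have R_mem: "R I \<in> cset (Mn n A)" if "I \<subseteq> {..<n} \<times> {..<n}" for I
      using that X_mem by (auto simp: R_def Mn_simps)
    have "emb M (\<phi> (R I)) = (\<Sum>(i, j)\<in>I. \<Phi> i j (X i j))" if "finite I" "I \<subseteq> {..<n} \<times> {..<n}" for I
      using that
    proof (induction I rule: finite_induct)
      case empty
      \<comment> \<open>\<open>R I\<close> is \<open>X\<close> cut down to the index set
        \<open>I\<close>. The empty cut is the zero matrix, and position (0, 0) is a legitimate one
        because \<open>n \<ge> 1\<close>.\<close>
      have "R {} = elem_mat A 0 0 (czero A)" by (auto simp: R_def elem_mat_def)
      then show ?case using zero[of 0 0] n by (simp add: \<Phi>_def)
    next
      case (insert ij I)
      obtain i j where ij: "ij = (i, j)" by fastforce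
      have lt: "i < n" "j < n" using insert.prems by (auto simp: ij)
      have I: "I \<subseteq> {..<n} \<times> {..<n}" using insert.prems by auto
      have e: "elem_mat A i j (X i j) \<in> cset (Mn n A)" using lt X_mem by (intro A.elem_mat_mem)
      have "R (insert ij I) = cadd (Mn n A) (R I) (elem_mat A i j (X i j))"
      proof (intro ext)
        fix k l
        have "X k l = czero A" if "\<not> (k < n \<and> l < n)" using X that by (simp add: Mn_simps)
        then show "R (insert ij I) k l = cadd (Mn n A) (R I) (elem_mat A i j (X i j)) k l"
          using insert.hyps(2) X_mem lt
          by (auto simp: R_def Mn_simps elem_mat_def ij A.zero_laws)
      qed
      then have "emb M (\<phi> (R (insert ij I))) = emb M (\<phi> (R I)) + \<Phi> i j (X i j)"
        using h(2)[OF R_mem[OF I] e] h(1)[OF R_mem[OF I]] h(1)[OF e] by (simp add: M.emb_simps \<Phi>_def)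
      then show ?case using insert.IH[OF I] insert.hyps by (simp add: ij add.commute)
    qed
    from this[of "{..<n} \<times> {..<n}"] have "emb M (\<phi> (R ({..<n} \<times> {..<n}))) = (\<Sum>i<n. \<Sum>j<n. \<Phi> i j (X i j))"
      by (simp add: sum.cartesian_product)
    moreover have "R ({..<n} \<times> {..<n}) = X"
      using X by (auto simp: R_def Mn_simps fun_eq_iff)
    ultimately show ?thesis by simp
  qed
qed

text \<open>In the product of two values, the middle factors \<open>adj (v j) * v k\<close> collapse
  to \<open>P\<close> or 0, and \<open>P\<close> is absorbed by the values of \<open>f\<close>. What
  remains are the entries of the matrix product.\<close>

lemma star_hom_of_column:
  fixes A :: "'a calg" and B :: "'b calg"
  assumes A: "cstar_algebra A" and B: "cstar_algebra B" and f: "star_hom A B f"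
    and fP: "\<And>a. a \<in> cset A \<Longrightarrow> P * emb B (f a) = emb B (f a)"
    and v: "\<And>i. i < n \<Longrightarrow> v i \<in> carrier_of B"
    and vv: "\<And>i j. i < n \<Longrightarrow> j < n \<Longrightarrow> adj (v i) * v j = (if i = j then P else 0)"
  shows "star_hom (Mn n A) B (\<lambda>X. coord (\<Sum>i<n. \<Sum>j<n. v i * emb B (f (X i j)) * adj (v j)) B)"
proof -
  interpret A: cstar_record A by unfold_locales (rule A)
  interpret B: cstar_record B by unfold_locales (rule B)
  note h = star_homD[OF f]
  define T where "T X = (\<Sum>i<n. \<Sum>j<n. v i * emb B (f (X i j)) * adj (v j))" for X
  have X_mem: "X i j \<in> cset A" if "X \<in> cset (Mn n A)" "i < n" "j < n" for X i j
    using that by (simp add: Mn_simps)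
  have T_mem: "T X \<in> carrier_of B" if "X \<in> cset (Mn n A)" for X
    unfolding T_def using X_mem[OF that] v h(1)
    by (intro B.sum_mem B.mult_mem B.adj_mem B.emb_mem) auto
  have closed: "cadd (Mn n A) X Y \<in> cset (Mn n A)" "csmult (Mn n A) c X \<in> cset (Mn n A)"
      "cstar (Mn n A) X \<in> cset (Mn n A)" "cmult (Mn n A) X Y \<in> cset (Mn n A)"
    if "X \<in> cset (Mn n A)" "Y \<in> cset (Mn n A)" for X Y c
    using that A.emb_csum[of n] by (auto simp: Mn_simps)
  have T_add: "T (cadd (Mn n A) X Y) = T X + T Y" if "X \<in> cset (Mn n A)" "Y \<in> cset (Mn n A)" for X Y
    unfolding T_def sum.distrib[symmetric] using X_mem[OF that(1)] X_mem[OF that(2)]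
    by (intro sum.cong refl) (simp add: Mn_simps(2) h B.emb_simps distrib_left distrib_right)
  have T_smult: "T (csmult (Mn n A) c X) = c *\<^sub>C T X" if "X \<in> cset (Mn n A)" for X c
    unfolding T_def cscale.scale_sum_right using X_mem[OF that]
    by (intro sum.cong refl) (simp add: Mn_simps(3) h B.emb_simps)
  have T_star: "T (cstar (Mn n A) X) = adj (T X)" if "X \<in> cset (Mn n A)" for X
  proof -
    have "adj (T X) = (\<Sum>i<n. \<Sum>j<n. v j * emb B (f (cstar A (X i j))) * adj (v i))"
      unfolding T_def adj_sum using X_mem[OF that]
      by (intro sum.cong refl) (simp add: h B.emb_simps mult.assoc)
    also have "\<dots> = (\<Sum>j<n. \<Sum>i<n. v j * emb B (f (cstar A (X i j))) * adj (v i))"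
      by (rule sum.swap)
    also have "\<dots> = T (cstar (Mn n A) X)"
      unfolding T_def by (intro sum.cong refl) (simp add: Mn_simps(5))
    finally show ?thesis ..
  qed
  have T_mult: "T (cmult (Mn n A) X Y) = T X * T Y"
    if X: "X \<in> cset (Mn n A)" and Y: "Y \<in> cset (Mn n A)" for X Y
  proof -
    define x y where "x i j = emb B (f (X i j))" and "y i j = emb B (f (Y i j))" for i j
    have vT: "adj (v j) * T Y = (\<Sum>l<n. y j l * adj (v l))" if j: "j < n" for j
    proof -
      have "adj (v j) * T Y = (\<Sum>k<n. \<Sum>l<n. adj (v j) * v k * y k l * adj (v l))"
        by (simp add: T_def y_def sum_distrib_left mult.assoc)
      also have "\<dots> = (\<Sum>k<n. if j = k then \<Sum>l<n. y k l * adj (v l) else 0)"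
        using vv[OF j] fP X_mem[OF Y] by (intro sum.cong refl) (auto simp: y_def)
      finally show ?thesis using j by simp
    qed
    have "T X * T Y = (\<Sum>i<n. \<Sum>j<n. v i * x i j * (adj (v j) * T Y))"
      by (simp add: T_def[of X] x_def sum_distrib_right mult.assoc)
    also have "\<dots> = (\<Sum>i<n. \<Sum>j<n. \<Sum>l<n. v i * (x i j * y j l) * adj (v l))"
      by (intro sum.cong refl) (simp add: vT sum_distrib_left mult.assoc)
    also have "\<dots> = (\<Sum>i<n. \<Sum>l<n. \<Sum>j<n. v i * (x i j * y j l) * adj (v l))"
      by (intro sum.cong refl sum.swap)
    also have "\<dots> = (\<Sum>i<n. \<Sum>l<n. v i * (\<Sum>j<n. x i j * y j l) * adj (v l))"
      by (simp add: sum_distrib_left sum_distrib_right)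
    also have "\<dots> = T (cmult (Mn n A) X Y)"
      unfolding T_def
    proof (intro sum.cong refl)
      fix i l assume "i \<in> {..<n}" "l \<in> {..<n}"
      then have il: "i < n" "l < n" by auto
      let ?g = "\<lambda>k. cmult A (X i k) (Y k l)"
      have "emb B (f (csum A ?g n)) = (\<Sum>k<n. emb B (f (?g k)))"
        using emb_star_hom_csum[OF A B f, of n ?g] X_mem[OF X] X_mem[OF Y] il by simp
      also have "\<dots> = (\<Sum>k<n. x i k * y k l)"
        using X_mem[OF X] X_mem[OF Y] il by (intro sum.cong refl) (simp add: h B.emb_simps x_def y_def)
      finally show "v i * (\<Sum>j<n. x i j * y j l) * adj (v l) =
          v i * emb B (f (cmult (Mn n A) X Y i l)) * adj (v l)"
        using il by (simp add: Mn_simps(4))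
    qed
    finally show ?thesis ..
  qed
  show ?thesis
    unfolding star_hom_def T_def[symmetric]
    using T_add T_smult T_mult T_star T_mem closed
    by (auto simp: coord_simps[OF B])
qed

text \<open>The two lifting hypotheses abstract from the kind of projectivity, so that both halves
  of the theorem share this proof. From \<open>lift\<close> only a projection over
  \<open>\<phi> (elem_mat A 0 0 u)\<close> is retained; the lift of \<open>\<phi>\<close> is built
  from \<open>corner_lift\<close>.\<close>

lemma matrix_star_hom_lift:
  fixes A :: "'a calg" and B :: "'b calg" and M :: "'m calg"
  assumes A: "cstar_algebra A" "unital A" and n: "n \<ge> 1"
    and B: "wstar_algebra B" and M: "cstar_algebra M"
    and \<pi>: "star_hom B M \<pi>" "\<pi> ` cset B = cset M" and \<phi>: "star_hom (Mn n A) M \<phi>"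
    and lift: "\<And>\<phi>'. star_hom A M \<phi>' \<Longrightarrow> \<exists>\<psi>. star_hom A B \<psi> \<and> (\<forall>x\<in>cset A. \<pi> (\<psi> x) = \<phi>' x)"
    and corner_lift: "\<And>P \<phi>'. projection_record B P \<Longrightarrow> star_hom A (corner M (\<pi> P)) \<phi>' \<Longrightarrow>
      \<exists>\<psi>. star_hom A (corner B P) \<psi> \<and> (\<forall>x\<in>cset A. \<pi> (\<psi> x) = \<phi>' x)"
  shows "\<exists>\<psi>. star_hom (Mn n A) B \<psi> \<and> (\<forall>X\<in>cset (Mn n A). \<pi> (\<psi> X) = \<phi> X)"
proof -
  have Bc: "cstar_algebra B" using B by (simp add: wstar_algebra_iff_predual)
  interpret A: cstar_record A by unfold_locales (rule A)
  interpret B: cstar_record B by unfold_locales (rule Bc)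
  interpret M: cstar_record M by unfold_locales (rule M)
  define \<Phi> where "\<Phi> i j a = emb M (\<phi> (elem_mat A i j a))" for i j a
  note expand = matrix_star_hom_expand[OF A(1) M n \<phi>, folded \<Phi>_def]
  note h\<phi> = star_homD[OF \<phi>] and h\<pi> = star_homD[OF \<pi>(1)]
  have n0: "0 < n" using n by simp
  obtain u where u: "u \<in> cset A" "\<And>x. x \<in> cset A \<Longrightarrow> cmult A u x = x" "\<And>x. x \<in> cset A \<Longrightarrow> cmult A x u = x"
    using A(2) by (auto simp: unital_def)
  have uu: "cmult A u u = u" using u by simp
  have us: "cstar A u = u"
  proof -
    have "cmult A (cstar A u) u = cstar A u" using u by simp
    then have "cstar A (cmult A (cstar A u) u) = u" using cstar_algebra_mult(6)[OF A(1) u(1) u(1) u(1)] by simp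
    then have "cmult A (cstar A u) u = u"
      using u(1) by (simp add: cstar_algebra_mult(6,9)[OF A(1) _ u(1) u(1)])
    then show ?thesis using \<open>cmult A (cstar A u) u = cstar A u\<close> by simp
  qed
  define \<phi>0 where "\<phi>0 a = \<phi> (elem_mat A 0 0 a)" for a
  have e0: "elem_mat A 0 0 a \<in> cset (Mn n A)" if "a \<in> cset A" for a
    using n0 that by (intro A.elem_mat_mem)
  have \<phi>0_mult: "\<phi>0 (cmult A a b) = cmult M (\<phi>0 a) (\<phi>0 b)" if "a \<in> cset A" "b \<in> cset A" for a b
    unfolding \<phi>0_def h\<phi>(4)[OF e0[OF that(1)] e0[OF that(2)], symmetric]
    by (simp add: A.elem_mat_mult[OF n0 n0 n0 n0 that])
  have \<phi>0_hom: "star_hom A M \<phi>0"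
    unfolding star_hom_def using \<phi>0_mult h\<phi>(1)[OF e0]
    by (auto simp: \<phi>0_def A.elem_mat_add[OF n0 n0] A.elem_mat_smult[OF n0 n0] A.elem_mat_star[OF n0 n0]
        h\<phi>(2)[OF e0 e0] h\<phi>(3)[OF e0] h\<phi>(5)[OF e0])
  obtain \<psi>0 where \<psi>0: "star_hom A B \<psi>0" "\<And>x. x \<in> cset A \<Longrightarrow> \<pi> (\<psi>0 x) = \<phi>0 x"
    using lift[OF \<phi>0_hom] by blast
  define p where "p = emb B (\<psi>0 u)"
  have pB: "\<psi>0 u \<in> cset B" using star_homD(1)[OF \<psi>0(1) u(1)] .
  have p: "p \<in> carrier_of B" "p * p = p" "adj p = p"
    using star_homD(4)[OF \<psi>0(1) u(1) u(1)] star_homD(5)[OF \<psi>0(1) u(1)] pB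
    by (simp_all add: p_def uu us flip: B.emb_simps)
  define \<Theta> where "\<Theta> F = emb M (\<pi> (coord F B))" for F
  have \<Theta>_hom: "star_hom_on (carrier_of B) (carrier_of M) \<Theta>"
    using star_hom_on_emb[OF Bc M \<pi>(1)] by (simp add: \<Theta>_def[abs_def])
  have \<Theta>_surj: "\<Theta> ` carrier_of B = carrier_of M"
    unfolding \<Theta>_def carrier_of_def image_image using \<pi>(2)
    by (auto simp: image_iff) (metis B.coord_emb imageE)
  have \<Theta>p: "\<Theta> p = \<Phi> 0 0 u" using pB \<psi>0(2)[OF u(1)] by (simp add: \<Theta>_def p_def \<Phi>_def \<phi>0_def)
  have \<Phi>_mem: "\<Phi> i j a \<in> carrier_of M" if "i < n" "j < n" "a \<in> cset A" for i j a
    unfolding \<Phi>_def using h\<phi>(1)[OF A.elem_mat_mem[OF that]] by simp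
  have "\<exists>P v. P \<in> carrier_of B \<and> P * P = P \<and> adj P = P \<and> \<Theta> P = \<Theta> p \<and>
    (\<forall>i<n. v i \<in> carrier_of B \<and> v i * P = v i \<and> \<Theta> (v i) = \<Phi> i 0 u) \<and>
    (\<forall>i<n. \<forall>j<n. adj (v i) * v j = (if i = j then P else 0))"
  proof (rule B.lift_column_of_partial_isometries[OF B.has_cluster_points_if_wstar[OF B] _ \<Theta>_hom \<Theta>_surj p])
    show "cstar_set (carrier_of M) (norm_of M)" by (rule M.cstar_set_axioms)
    show "\<Phi> i 0 u \<in> carrier_of M" if "i < n" for i using \<Phi>_mem[OF that n0 u(1)] .
    show "\<Phi> i 0 u * \<Theta> p = \<Phi> i 0 u" if "i < n" for i
      using expand(1)[OF that n0 n0 n0 u(1) u(1)] by (simp add: \<Theta>p uu)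
    show "adj (\<Phi> i 0 u) * \<Phi> j 0 u = (if i = j then \<Theta> p else 0)" if "i < n" "j < n" for i j
      using expand(1)[OF n0 that n0 u(1) u(1)] expand(2)[OF that(1) n0 u(1)] by (simp add: \<Theta>p uu us)
  qed
  then obtain P v where P: "P \<in> carrier_of B" "P * P = P" "adj P = P" "\<Theta> P = \<Theta> p"
    and v: "\<And>i. i < n \<Longrightarrow> v i \<in> carrier_of B" "\<And>i. i < n \<Longrightarrow> \<Theta> (v i) = \<Phi> i 0 u"
    and vv: "\<And>i j. i < n \<Longrightarrow> j < n \<Longrightarrow> adj (v i) * v j = (if i = j then P else 0)"
    by blast
  define P' where "P' = coord P B"
  have P': "P' \<in> cset B" "emb B P' = P" using P(1) by (simp_all add: P'_def)
  have proj: "projection_record B P'"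
  proof
    show "cmult B P' P' = P'" "cstar B P' = P'"
      using P P' by (simp_all add: B.emb_inject[symmetric] B.emb_simps)
  qed (rule P'(1))
  have \<pi>P: "\<pi> P' = \<phi>0 u"
  proof -
    have "emb M (\<pi> P') = emb M (\<phi>0 u)" using P(4) \<Theta>p by (simp add: \<Theta>_def P'_def \<Phi>_def \<phi>0_def)
    then show ?thesis using h\<pi>(1)[OF P'(1)] star_homD(1)[OF \<phi>0_hom u(1)] by (simp add: M.emb_inject)
  qed
  have "cmult M (\<phi>0 u) (\<phi>0 a) = \<phi>0 a" "cmult M (\<phi>0 a) (\<phi>0 u) = \<phi>0 a" if "a \<in> cset A" for a
    using \<phi>0_mult[OF u(1) that] \<phi>0_mult[OF that u(1)] u(2,3)[OF that] by simp_all
  then have "star_hom A (corner M (\<pi> P')) \<phi>0"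
    using \<phi>0_hom unfolding star_hom_def \<pi>P by simp
  from corner_lift[OF proj this] obtain \<psi>1 where
    \<psi>1: "star_hom A (corner B P') \<psi>1" "\<And>x. x \<in> cset A \<Longrightarrow> \<pi> (\<psi>1 x) = \<phi>0 x" by blast
  have \<psi>1B: "star_hom A B \<psi>1" using \<psi>1(1) unfolding star_hom_def by simp
  have \<psi>1_mem: "\<psi>1 a \<in> cset B" if "a \<in> cset A" for a using star_homD(1)[OF \<psi>1B that] .
  have P\<psi>: "P * emb B (\<psi>1 a) = emb B (\<psi>1 a)" if a: "a \<in> cset A" for a
  proof -
    have "cmult B P' (\<psi>1 a) = \<psi>1 a" using star_homD(1)[OF \<psi>1(1) a] by simp
    then show ?thesis using B.emb_simps(5)[OF P'(1) \<psi>1_mem[OF a]] by (simp add: P'(2))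
  qed
  let ?T = "\<lambda>X. \<Sum>i<n. \<Sum>j<n. v i * emb B (\<psi>1 (X i j)) * adj (v j)"
  have "\<pi> (coord (?T X) B) = \<phi> X" if X: "X \<in> cset (Mn n A)" for X
  proof -
    have X_mem: "X i j \<in> cset A" if "i < n" "j < n" for i j using X that by (simp add: Mn_simps)
    note hs = B.star_hom_on_simps[OF \<Theta>_hom]
    have term_mem: "v i * emb B (\<psi>1 (X i j)) * adj (v j) \<in> carrier_of B" if "i < n" "j < n" for i j
      using v(1) \<psi>1_mem X_mem that by simp
    have "\<Theta> (?T X) = (\<Sum>i<n. \<Theta> (\<Sum>j<n. v i * emb B (\<psi>1 (X i j)) * adj (v j)))"
      using term_mem by (intro B.star_hom_on_sum[OF \<Theta>_hom] B.sum_mem) auto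
    also have "\<dots> = (\<Sum>i<n. \<Sum>j<n. \<Theta> (v i * emb B (\<psi>1 (X i j)) * adj (v j)))"
      using term_mem by (intro sum.cong refl B.star_hom_on_sum[OF \<Theta>_hom]) auto
    also have "\<dots> = (\<Sum>i<n. \<Sum>j<n. \<Phi> i j (X i j))"
    proof (intro sum.cong refl)
      fix i j assume "i \<in> {..<n}" "j \<in> {..<n}"
      then have ij: "i < n" "j < n" by auto
      note x = X_mem[OF ij]
      have "\<Theta> (v i * emb B (\<psi>1 (X i j)) * adj (v j)) = \<Phi> i 0 u * \<Theta> (emb B (\<psi>1 (X i j))) * adj (\<Phi> j 0 u)"
        using v ij \<psi>1_mem[OF x] by (simp add: hs)
      also have "\<Theta> (emb B (\<psi>1 (X i j))) = \<Phi> 0 0 (X i j)"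
        using \<psi>1(2)[OF x] \<psi>1_mem[OF x] by (simp add: \<Theta>_def \<Phi>_def \<phi>0_def)
      \<comment> \<open>The matrix unit relation \<open>e_i0 (X_ij e_00) e_0j = X_ij e_ij\<close>,
        transported by \<open>\<phi>\<close>.\<close>
      also have "\<Phi> i 0 u * \<Phi> 0 0 (X i j) * adj (\<Phi> j 0 u) = \<Phi> i j (X i j)"
        using expand(1)[OF ij(1) n0 n0 n0 u(1) x] expand(1)[OF ij(1) n0 n0 ij(2) x u(1)]
          expand(2)[OF ij(2) n0 u(1)] u x by (simp add: us)
      finally show "\<Theta> (v i * emb B (\<psi>1 (X i j)) * adj (v j)) = \<Phi> i j (X i j)" .
    qed
    also have "\<dots> = emb M (\<phi> X)" using expand(3)[OF X] by simp
    finally have "emb M (\<pi> (coord (?T X) B)) = emb M (\<phi> X)" by (simp add: \<Theta>_def)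
    then show ?thesis using h\<pi>(1)[OF B.coord_in_cset] h\<phi>(1)[OF X] by (simp add: M.emb_inject)
  qed
  then show ?thesis using star_hom_of_column[OF A(1) Bc \<psi>1B P\<psi> v(1) vv] by blast
qed

theorem theorem5p2:
  fixes A :: "'a calg" and n :: nat
  assumes "cstar_algebra A" and "unital A" and "n \<ge> 1"
  shows "(wc_projective A TYPE('b) TYPE('m) \<longrightarrow> wc_projective (Mn n A) TYPE('b) TYPE('m)) \<and>
         (ww_projective A TYPE('b) TYPE('m) \<longrightarrow> ww_projective (Mn n A) TYPE('b) TYPE('m))"
proof (intro conjI impI)
  \<comment> \<open>\<open>\<pi> P\<close> is again a projection, so the target corner is of the
    same kind as \<open>M\<close>: a C*-algebra by \<open>corner_cstar\<close>, a W*-algebra by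
    \<open>corner_wstar\<close>.\<close>
  have corner_proj: "projection_record M (\<pi> P)"
    if "projection_record B P" "cstar_algebra M" "star_hom B M \<pi>" for B :: "'b calg" and M :: "'m calg" and \<pi> P
  proof -
    interpret projection_record B P by (rule that(1))
    show ?thesis
      using that(2) star_homD(1)[OF that(3) p_mem] star_homD(4)[OF that(3) p_mem p_mem]
        star_homD(5)[OF that(3) p_mem] by unfold_locales (simp_all add: p_idem p_adj)
  qed
  {
    assume proj: "wc_projective A TYPE('b) TYPE('m)"
    show "wc_projective (Mn n A) TYPE('b) TYPE('m)"
      unfolding wc_projective_def
    proof (intro allI impI)
      fix B :: "'b calg" and M :: "'m calg" and \<pi> \<phi>
      assume B: "wstar_algebra B" and M: "cstar_algebra M" and \<pi>: "star_hom B M \<pi>" "\<pi> ` cset B = cset M"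
        and \<phi>: "star_hom (Mn n A) M \<phi>"
      have Bc: "cstar_algebra B" using B by (simp add: wstar_algebra_iff_predual)
      show "\<exists>\<psi>. star_hom (Mn n A) B \<psi> \<and> (\<forall>X\<in>cset (Mn n A). \<pi> (\<psi> X) = \<phi> X)"
      proof (rule matrix_star_hom_lift[OF assms B M \<pi> \<phi>])
        show "\<exists>\<psi>. star_hom A B \<psi> \<and> (\<forall>x\<in>cset A. \<pi> (\<psi> x) = \<phi>' x)" if "star_hom A M \<phi>'" for \<phi>'
          using proj B M \<pi> that unfolding wc_projective_def by blast
        fix P \<phi>' assume P: "projection_record B P" and \<phi>': "star_hom A (corner M (\<pi> P)) \<phi>'"
        note Q = corner_proj[OF P M \<pi>(1)]
        note hom = star_hom_corner[OF Bc M \<pi> projection_record.p_mem[OF P] projection_record.p_idem[OF P]]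
        show "\<exists>\<psi>. star_hom A (corner B P) \<psi> \<and> (\<forall>x\<in>cset A. \<pi> (\<psi> x) = \<phi>' x)"
          using proj projection_record.corner_wstar[OF P B] projection_record.corner_cstar[OF Q] hom \<phi>'
          unfolding wc_projective_def by blast
      qed
    qed
  next
    assume proj: "ww_projective A TYPE('b) TYPE('m)"
    show "ww_projective (Mn n A) TYPE('b) TYPE('m)"
      unfolding ww_projective_def
    proof (intro allI impI)
      fix B :: "'b calg" and M :: "'m calg" and \<pi> \<phi>
      assume B: "wstar_algebra B" and Mw: "wstar_algebra M" and \<pi>: "star_hom B M \<pi>" "\<pi> ` cset B = cset M"
        and \<phi>: "star_hom (Mn n A) M \<phi>"
      have Bc: "cstar_algebra B" and M: "cstar_algebra M" using B Mw by (simp_all add: wstar_algebra_iff_predual)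
      show "\<exists>\<psi>. star_hom (Mn n A) B \<psi> \<and> (\<forall>X\<in>cset (Mn n A). \<pi> (\<psi> X) = \<phi> X)"
      proof (rule matrix_star_hom_lift[OF assms B M \<pi> \<phi>])
        show "\<exists>\<psi>. star_hom A B \<psi> \<and> (\<forall>x\<in>cset A. \<pi> (\<psi> x) = \<phi>' x)" if "star_hom A M \<phi>'" for \<phi>'
          using proj B Mw \<pi> that unfolding ww_projective_def by blast
        fix P \<phi>' assume P: "projection_record B P" and \<phi>': "star_hom A (corner M (\<pi> P)) \<phi>'"
        note Q = corner_proj[OF P M \<pi>(1)]
        note hom = star_hom_corner[OF Bc M \<pi> projection_record.p_mem[OF P] projection_record.p_idem[OF P]]
        show "\<exists>\<psi>. star_hom A (corner B P) \<psi> \<and> (\<forall>x\<in>cset A. \<pi> (\<psi> x) = \<phi>' x)"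
          using proj projection_record.corner_wstar[OF P B] projection_record.corner_wstar[OF Q Mw] hom \<phi>'
          unfolding ww_projective_def by blast
      qed
    qed
  }
qed

end
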